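(* For every countable $R\subseteq\mathbb{R}^{>0}$, the isometry group $\mathrm{Iso}(X_R)$ of the Polish ultrametric Urysohn space $X_R$ has ample generics. Moreover, there exists a Polish ultrametric $2$-Urysohn space whose isometry group has ample generics; for example, $X^2_{\mathbb{Q}^{>0}}$ is such a space.
   Context: For a countable $R\subseteq \mathbb{R}^{>0}$, the Polish ultrametric Urysohn space is $$X_R=\{x\in\mathbb{N}^R: \text{for every } r>0 \text{ the set } \{r'\in R: r'>r,\ x(r')\neq 0\}\text{ is finite}\},$$ with the ultrametric $d(x,y)=\max\{r\in R: x(r)\neq y(r)\}$ for $x\ne y$. For a natural number $n$, the Polish ultrametric $n$-Urysohn space $X_R^n\subseteq X_R$ is the subspace of those $x\in X_R$ with all values in $\{0,\ldots,n-1\}$. For a Polish metric space $X$, $\mathrm{Iso}(X)$ is the group of all distance-preserving bijections of $X$ with the topology of pointwise convergence; it is a Polish group. A Polish group $G$ has ample generics if for every $n\in\mathbb{N}$ (including $n=0$) the diagonal conjugation action of $G$ on $G^{n+1}$, $g.(g_0,\ldots,g_n)=(gg_0g^{-1},\ldots,gg_ng^{-1})$, has a comeager orbit. *)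

theory Defs
  imports
    "HOL-Analysis.Abstract_Metric_Spaces"
    "HOL-Algebra.Group_Action"
begin

section \<open>Ultrametric Urysohn spaces\<close>

text \<open>Elements of \<open>\<nat>\<^sup>R\<close> are extensional functions, i.e. equal to \<^const>\<open>undefined\<close> outside \<open>R\<close>.\<close>

definition urysohn :: "real set \<Rightarrow> (real \<Rightarrow> nat) set" where
  "urysohn R = {x \<in> R \<rightarrow>\<^sub>E UNIV. \<forall>r>0. finite {r' \<in> R. r' > r \<and> x r' \<noteq> 0}}"

text \<open>The set of coordinates at which two points differ may be infinite (accumulating at \<open>0\<close>),
  so its maximum is expressed with \<^const>\<open>Greatest\<close>; \<^const>\<open>Max\<close> is only meaningful for finite
  sets. Existence of the maximum is shown below. Off \<open>urysohn R\<close> the value is \<open>0\<close> because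
  \<^locale>\<open>Metric_space\<close> demands symmetry and nonnegativity on the whole type.\<close>

definition urysohn_dist :: "real set \<Rightarrow> (real \<Rightarrow> nat) \<Rightarrow> (real \<Rightarrow> nat) \<Rightarrow> real" where
  "urysohn_dist R x y =
     (if x \<in> urysohn R \<and> y \<in> urysohn R \<and> x \<noteq> y then (GREATEST r. r \<in> R \<and> x r \<noteq> y r) else 0)"

definition n_urysohn :: "nat \<Rightarrow> real set \<Rightarrow> (real \<Rightarrow> nat) set" where
  "n_urysohn n R = {x \<in> urysohn R. \<forall>r\<in>R. x r < n}"

lemma n_urysohn_subset: "n_urysohn n R \<subseteq> urysohn R"
  by (auto simp: n_urysohn_def)

lemma urysohn_dist_max:
  assumes R: "R \<subseteq> {0<..}" and x: "x \<in> urysohn R" and y: "y \<in> urysohn R" and ne: "x \<noteq> y"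
  shows "urysohn_dist R x y \<in> R" "x (urysohn_dist R x y) \<noteq> y (urysohn_dist R x y)"
    and "\<And>r. \<lbrakk>r \<in> R; x r \<noteq> y r\<rbrakk> \<Longrightarrow> r \<le> urysohn_dist R x y"
proof -
  let ?P = "\<lambda>r. r \<in> R \<and> x r \<noteq> y r"
  have "x \<in> extensional R" "y \<in> extensional R"
    using x y by (auto simp: urysohn_def PiE_def)
  with ne obtain s where s: "?P s" by (meson extensionalityI)
  with R have "s / 2 > 0" "s / 2 < s" by auto
  define D where "D = {r. ?P r \<and> r > s / 2}"
  have "finite {r \<in> R. r > s / 2 \<and> x r \<noteq> 0}" "finite {r \<in> R. r > s / 2 \<and> y r \<noteq> 0}"
    using x y \<open>s / 2 > 0\<close> unfolding urysohn_def by blast+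
  moreover have "D \<subseteq> {r \<in> R. r > s / 2 \<and> x r \<noteq> 0} \<union> {r \<in> R. r > s / 2 \<and> y r \<noteq> 0}"
    by (auto simp: D_def)
  ultimately have fin: "finite D" by (meson finite_UnI finite_subset)
  have "s \<in> D" using s \<open>s / 2 < s\<close> by (simp add: D_def)
  then have "Max D \<in> D" "\<And>r. r \<in> D \<Longrightarrow> r \<le> Max D" using fin by (auto intro: Max_in)
  then have m: "?P (Max D)" "\<And>r. ?P r \<Longrightarrow> r \<le> Max D"
    by (auto simp: D_def) (smt (verit, best))
  have "(GREATEST r. ?P r) = Max D"
    using m by (intro Greatest_equality) auto
  then have eq: "urysohn_dist R x y = Max D" using x y ne by (simp add: urysohn_dist_def)
  show "urysohn_dist R x y \<in> R" "x (urysohn_dist R x y) \<noteq> y (urysohn_dist R x y)"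
    "\<And>r. \<lbrakk>r \<in> R; x r \<noteq> y r\<rbrakk> \<Longrightarrow> r \<le> urysohn_dist R x y"
    using m by (auto simp: eq)
qed

lemma Metric_space_urysohn:
  assumes R: "R \<subseteq> {0<..}"
  shows "Metric_space (urysohn R) (urysohn_dist R)"
proof
  have pos: "0 < urysohn_dist R x y" if "x \<in> urysohn R" "y \<in> urysohn R" "x \<noteq> y" for x y
    using urysohn_dist_max(1)[OF R that] R by auto
  show nonneg: "0 \<le> urysohn_dist R x y" for x y
    using pos[of x y] by (cases "x \<in> urysohn R \<and> y \<in> urysohn R \<and> x \<noteq> y")
      (auto simp: urysohn_dist_def)
  show "urysohn_dist R x y = urysohn_dist R y x" for x y
    by (simp add: urysohn_dist_def eq_commute[of "x _" "y _"] eq_commute[of x y])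
  show "urysohn_dist R x y = 0 \<longleftrightarrow> x = y" if "x \<in> urysohn R" "y \<in> urysohn R" for x y
    using pos[OF that] by (cases "x = y") (auto simp: urysohn_dist_def)
  show "urysohn_dist R x z \<le> urysohn_dist R x y + urysohn_dist R y z"
    if x: "x \<in> urysohn R" and y: "y \<in> urysohn R" and z: "z \<in> urysohn R" for x y z
  proof (cases "x = z \<or> x = y \<or> y = z")
    case True
    then show ?thesis using nonneg[of x y] nonneg[of y z] by (auto simp: urysohn_dist_def)
  next
    case False
    let ?r = "urysohn_dist R x z"
    have r: "?r \<in> R" "x ?r \<noteq> z ?r" using urysohn_dist_max[OF R x z] False by auto
    then consider "x ?r \<noteq> y ?r" | "y ?r \<noteq> z ?r" by metis
    then show ?thesis
    proof cases
      case 1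
      then have "?r \<le> urysohn_dist R x y" using urysohn_dist_max(3)[OF R x y] False r by auto
      then show ?thesis using nonneg[of y z] by linarith
    next
      case 2
      then have "?r \<le> urysohn_dist R y z" using urysohn_dist_max(3)[OF R y z] False r by auto
      then show ?thesis using nonneg[of x y] by linarith
    qed
  qed
qed

lemma Metric_space_n_urysohn:
  "R \<subseteq> {0<..} \<Longrightarrow> Metric_space (n_urysohn n R) (urysohn_dist R)"
  by (intro Metric_space.subspace[OF Metric_space_urysohn] n_urysohn_subset)


section \<open>Isometry groups\<close>

definition Iso :: "'a set \<Rightarrow> ('a \<Rightarrow> 'a \<Rightarrow> real) \<Rightarrow> ('a \<Rightarrow> 'a) monoid" where
  "Iso M d = (BijGroup M)\<lparr>carrier := {f \<in> Bij M. \<forall>x\<in>M. \<forall>y\<in>M. d (f x) (f y) = d x y}\<rparr>"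

text \<open>The topology of pointwise convergence.\<close>

definition Iso_topology :: "'a set \<Rightarrow> ('a \<Rightarrow> 'a \<Rightarrow> real) \<Rightarrow> ('a \<Rightarrow> 'a) topology" where
  "Iso_topology M d =
     subtopology (product_topology (\<lambda>_. Metric_space.mtopology M d) M) (carrier (Iso M d))"


section \<open>Ample generics\<close>

definition nowhere_dense_in :: "'a topology \<Rightarrow> 'a set \<Rightarrow> bool" where
  "nowhere_dense_in X S \<longleftrightarrow> S \<subseteq> topspace X \<and> X interior_of (X closure_of S) = {}"

definition meager_in :: "'a topology \<Rightarrow> 'a set \<Rightarrow> bool" where
  "meager_in X S \<longleftrightarrow> (\<exists>\<F>. countable \<F> \<and> (\<forall>F\<in>\<F>. nowhere_dense_in X F) \<and> S = \<Union>\<F>)"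

definition comeager_in :: "'a topology \<Rightarrow> 'a set \<Rightarrow> bool" where
  "comeager_in X S \<longleftrightarrow> S \<subseteq> topspace X \<and> meager_in X (topspace X - S)"

definition Polish_group :: "('a, 'b) monoid_scheme \<Rightarrow> 'a topology \<Rightarrow> bool" where
  "Polish_group G X \<longleftrightarrow>
     group G \<and> topspace X = carrier G \<and>
     continuous_map (prod_topology X X) X (\<lambda>(g, h). g \<otimes>\<^bsub>G\<^esub> h) \<and>
     continuous_map X X (\<lambda>g. inv\<^bsub>G\<^esub> g) \<and>
     separable_space X \<and> completely_metrizable_space X"

text \<open>\<open>G\<close> acting on \<open>G\<^bsup>n+1\<^esup>\<close>, whose elements are extensional families indexed by \<open>{..n}\<close>.\<close>

definition diag_conj ::
    "('a, 'b) monoid_scheme \<Rightarrow> nat \<Rightarrow> 'a \<Rightarrow> (nat \<Rightarrow> 'a) \<Rightarrow> (nat \<Rightarrow> 'a)" where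
  "diag_conj G n g =
     (\<lambda>p \<in> {..n} \<rightarrow>\<^sub>E carrier G. \<lambda>i\<in>{..n}. g \<otimes>\<^bsub>G\<^esub> p i \<otimes>\<^bsub>G\<^esub> inv\<^bsub>G\<^esub> g)"

definition ample_generics :: "('a, 'b) monoid_scheme \<Rightarrow> 'a topology \<Rightarrow> bool" where
  "ample_generics G X \<longleftrightarrow>
     Polish_group G X \<and>
     (\<forall>n. \<exists>p \<in> {..n} \<rightarrow>\<^sub>E carrier G.
        comeager_in (product_topology (\<lambda>_. X) {..n}) (orbit G (diag_conj G n) p))"

end

theory Submission
  imports Defs "HOL-Analysis.Urysohn" "HOL-Combinatorics.Permutations"
begin

text \<open>Isometry groups of ultrametric spaces have small open subgroups, so by Rosendal's criterion a
  diagonal conjugacy class is comeager once conjugation is topologically transitive and, around a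
  dense set of tuples \<open>p\<close>, remains so for conjugators fixing finitely many points up to \<open>\<epsilon>\<close>.
  Truncating the coordinates of finitely many points at \<open>\<epsilon>\<close> puts them into a finite homogeneous set
  of points whose support lies in a fixed finite set of distances, so such tuples can be chosen to
  permute a finite set \<open>A\<close>. Two tuples close to \<open>p\<close> on \<open>A\<close> that permute a finite \<open>B \<supseteq> A\<close> are
  amalgamated by moving one copy of \<open>B\<close>: each \<open>b \<in> B\<close> is moved into a branch that is not used by \<open>B\<close>,
  starting at a height determined by the distance from \<open>b\<close> to \<open>A\<close>. If all natural numbers are allowed
  as coordinates this height is that distance itself; if only \<open>0\<close> and \<open>1\<close> are allowed it is a slightly
  smaller one, which exists because the set of distances is dense.\<close>


section \<open>Comeager orbits of Polish group actions\<close>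

text \<open>Two obstacles shape the amalgamation. A tuple close to \<open>p\<close> is controlled on
  \<open>A\<close> only up to \<open>\<epsilon>\<close>, so the height at which \<open>b\<close> is
  moved may depend on nothing finer than the distance from \<open>b\<close> to \<open>A\<close>, cut
  off below at about \<open>\<epsilon>\<close>. Because \<open>p\<close> permutes \<open>A\<close>,
  this height is invariant under both tuples, and at scales above the height of \<open>b'\<close>
  comparing \<open>p2 b\<close> with \<open>p1 b'\<close> is the same as comparing \<open>b\<close>
  with \<open>b'\<close>. So \<open>p2\<close> on \<open>B\<close> together with a transported
  \<open>p1\<close> on the moved copy is a partial isometry, and homogeneity extends it.

  The second obstacle is the supply of branches. With coordinates \<open>0\<close> and
  \<open>1\<close>, both branches at the distance \<open>r\<close> from \<open>b\<close> to
  \<open>A\<close> may already be taken, by \<open>A\<close> and by \<open>b\<close>. Just below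
  \<open>r\<close> there is a distance at which all of \<open>B\<close> has coordinate
  \<open>0\<close>, so \<open>1\<close> is free. The price is that the tuples must also agree about
  points closer than \<open>r\<close>; with two values they do, because all points at distance
  exactly \<open>r\<close> from a given point lie in one branch.\<close>

lemma comeager_in_superset_dense_opens:
  assumes "countable \<G>" and op: "\<And>T. T \<in> \<G> \<Longrightarrow> openin Y T \<and> Y closure_of T = topspace Y"
    and sub: "topspace Y \<inter> \<Inter>\<G> \<subseteq> S" and S: "S \<subseteq> topspace Y"
  shows "comeager_in Y S"
  unfolding comeager_in_def meager_in_def
proof (intro conjI exI ballI)
  \<comment> \<open>\<open>meager_in\<close> asks for an exact union, so each closed piece
    \<open>topspace Y - T\<close> is trimmed by \<open>S\<close>; it stays nowhere dense.\<close>
  let ?\<F> = "(\<lambda>T. (topspace Y - T) - S) ` \<G>"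
  show "S \<subseteq> topspace Y" by fact
  show "countable ?\<F>" using assms(1) by simp
  show "topspace Y - S = \<Union>?\<F>" using sub by auto
  fix F assume "F \<in> ?\<F>"
  then obtain T where T: "T \<in> \<G>" "F = (topspace Y - T) - S" by auto
  have "Y closure_of F \<subseteq> topspace Y - T"
    using op[OF T(1)] T(2) by (intro closure_of_minimal) auto
  then have "Y interior_of (Y closure_of F) \<subseteq> Y interior_of (topspace Y - T)"
    by (rule interior_of_mono)
  also have "\<dots> = {}" using op[OF T(1)] by (simp add: interior_of_complement)
  finally show "nowhere_dense_in Y F" using T(2) by (auto simp: nowhere_dense_in_def)
qed

text \<open>Balls of radius \<open>1 / Suc k\<close> around a countable dense set form a base. It
  supplies the countably many conditions of the Baire argument below.\<close>

lemma metrizable_separable_imp_second_countable: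
  assumes "metrizable_space Y" "separable_space Y"
  shows "second_countable Y"
proof -
  obtain M d where M: "Metric_space M d" and Y: "Y = Metric_space.mtopology M d"
    using assms(1) by (auto simp: metrizable_space_def)
  interpret Metric_space M d by (rule M)
  obtain C where C: "countable C" "C \<subseteq> M" "mtopology closure_of C = M"
    using assms(2) by (auto simp: separable_space_def Y)
  define \<B> where "\<B> = (\<lambda>(c, k). mball c (1 / Suc k)) ` (C \<times> UNIV)"
  have "countable \<B>" using C(1) by (auto simp: \<B>_def)
  moreover have "\<exists>V\<in>\<B>. x \<in> V \<and> V \<subseteq> U" if U: "openin mtopology U" "x \<in> U" for U x
  proof -
    obtain r where r: "r > 0" "mball x r \<subseteq> U" using U by (auto simp: openin_mtopology)
    obtain k where k: "1 / Suc k < r / 2" using r(1) by (metis half_gt_zero nat_approx_posE)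
    have x: "x \<in> mtopology closure_of C" using U C(3) openin_subset by fastforce
    then obtain c where c: "c \<in> C" "c \<in> mball x (1 / Suc k)"
      unfolding metric_closure_of by (auto dest: spec[of _ "1 / Suc k"])
    have "mball c (1 / Suc k) \<subseteq> U"
    proof (rule order_trans[OF _ r(2)], rule subsetI)
      fix y assume "y \<in> mball c (1 / Suc k)"
      then show "y \<in> mball x r" using c k triangle[of x c y] by (auto simp: in_mball)
    qed
    moreover have "x \<in> mball c (1 / Suc k)" using c by (auto simp: in_mball commute)
    ultimately show ?thesis using c(1) by (auto simp: \<B>_def)
  qed
  moreover have "\<forall>V\<in>\<B>. openin mtopology V" by (auto simp: \<B>_def)
  ultimately show ?thesis unfolding second_countable_def Y by blast
qed

lemma separable_space_finite_power:
  assumes "separable_space X" "finite I"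
  shows "separable_space (product_topology (\<lambda>_. X) I)"
proof -
  obtain C where C: "countable C" "C \<subseteq> topspace X" "X closure_of C = topspace X"
    using assms(1) by (auto simp: separable_space_def)
  have "product_topology (\<lambda>_. X) I closure_of (I \<rightarrow>\<^sub>E C) = (I \<rightarrow>\<^sub>E topspace X)"
    by (simp add: closure_of_product_topology C(3))
  moreover have "countable (I \<rightarrow>\<^sub>E C)" using assms(2) C(1) by (intro countable_PiE) auto
  ultimately show ?thesis
    unfolding separable_space_def using C(2)
    by (intro exI[of _ "I \<rightarrow>\<^sub>E C"]) (auto simp: PiE_mono)
qed

lemma (in Metric_space) MCauchy_geometric:
  assumes M: "range c \<subseteq> M" and step: "\<And>k. d (c (Suc k)) (c k) < (1/2) ^ k"
  shows "MCauchy c"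
proof -
  \<comment> \<open>The bound is the exact partial sum of the geometric series; carrying the factor
    \<open>1 - (1/2) ^ j\<close> makes the induction on \<open>j\<close> close.\<close>
  have *: "d (c (m + j)) (c m) \<le> 2 * (1/2) ^ m * (1 - (1/2) ^ j)" for m j
  proof (induction j)
    case 0
    have "c m \<in> M" using M by auto
    then show ?case by simp
  next
    case (Suc j)
    have "d (c (m + Suc j)) (c m) \<le> d (c (Suc (m + j))) (c (m + j)) + d (c (m + j)) (c m)"
      using M triangle[of "c (Suc (m + j))" "c (m + j)" "c m"] by auto
    also have "\<dots> \<le> (1/2) ^ (m + j) + 2 * (1/2) ^ m * (1 - (1/2) ^ j)"
      using step[of "m + j"] Suc by linarith
    also have "\<dots> = 2 * (1/2) ^ m * (1 - (1/2) ^ Suc j)"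
      by (simp add: power_add algebra_simps)
    finally show ?case .
  qed
  have **: "d (c (m + j)) (c m) \<le> 2 * (1/2) ^ m" for m j
    by (rule order_trans[OF *]) (auto simp: algebra_simps)
  show ?thesis
    unfolding MCauchy_def
  proof (intro conjI allI impI)
    show "range c \<subseteq> M" by fact
    fix \<epsilon> :: real assume "\<epsilon> > 0"
    then obtain N where N: "(1/2 :: real) ^ N < \<epsilon> / 4"
      using real_arch_pow_inv[of "\<epsilon> / 4" "1 / 2"] by auto
    show "\<exists>N. \<forall>n n'. N \<le> n \<longrightarrow> N \<le> n' \<longrightarrow> d (c n) (c n') < \<epsilon>"
    proof (intro exI[of _ N] allI impI)
      fix n n' assume "N \<le> n" "N \<le> n'"
      then obtain i j where "n = N + i" "n' = N + j" by (metis le_Suc_ex)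
      then show "d (c n) (c n') < \<epsilon>"
        using **[of N i] **[of N j] N triangle[of "c n" "c N" "c n'"] commute[of "c N"] M by fastforce
    qed
  qed
qed

lemma Polish_group_continuous_mult:
  assumes "Polish_group G X" "continuous_map Z X f" "continuous_map Z X g"
  shows "continuous_map Z X (\<lambda>z. f z \<otimes>\<^bsub>G\<^esub> g z)"
proof -
  have "continuous_map (prod_topology X X) X (\<lambda>(g, h). g \<otimes>\<^bsub>G\<^esub> h)"
    using assms(1) by (simp add: Polish_group_def)
  from continuous_map_compose[OF _ this, of Z "\<lambda>z. (f z, g z)"] show ?thesis
    using assms by (simp add: continuous_map_pairwise o_def)
qed

text \<open>Continuity is asked for separately in each variable, and it enters in these two ways:
  translations pull open sets back to open sets, and orbit maps turn convergent sequences of group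
  elements into convergent sequences of points.\<close>

locale continuous_action = group_action G E \<phi> for G (structure) and E and \<phi> +
  fixes X and Y
  assumes Polish: "Polish_group G X"
    and Y: "topspace Y = E" "completely_metrizable_space Y" "separable_space Y"
    and continuous_act: "\<And>g. g \<in> carrier G \<Longrightarrow> continuous_map Y Y (\<phi> g)"
    and continuous_orbit_map: "\<And>y. y \<in> E \<Longrightarrow> continuous_map X Y (\<lambda>g. \<phi> g y)"
begin

sublocale group G using Polish by (simp add: Polish_group_def)

lemma topspace_X: "topspace X = carrier G"
  using Polish by (simp add: Polish_group_def)

lemma act_closed [simp]: "g \<in> carrier G \<Longrightarrow> y \<in> E \<Longrightarrow> \<phi> g y \<in> E"
  using element_image by blast

lemma act_one [simp]: "y \<in> E \<Longrightarrow> \<phi> \<one> y = y"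
  by (metis id_eq_one restrict_apply')

lemma act_mult: "g \<in> carrier G \<Longrightarrow> h \<in> carrier G \<Longrightarrow> y \<in> E \<Longrightarrow> \<phi> (g \<otimes> h) y = \<phi> g (\<phi> h y)"
  by (rule composition_rule)

lemma act_inv [simp]: "g \<in> carrier G \<Longrightarrow> y \<in> E \<Longrightarrow> \<phi> (inv g) (\<phi> g y) = y"
  by (simp flip: act_mult)

lemma act_inv' [simp]: "g \<in> carrier G \<Longrightarrow> y \<in> E \<Longrightarrow> \<phi> g (\<phi> (inv g) y) = y"
  by (simp flip: act_mult)

lemmas continuous_mult = Polish_group_continuous_mult[OF Polish]

lemma openin_act_vimage:
  "g \<in> carrier G \<Longrightarrow> openin Y W \<Longrightarrow> openin Y {y \<in> E. \<phi> g y \<in> W}"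
  using openin_continuous_map_preimage[OF continuous_act] Y(1) by simp

text \<open>With \<open>U\<close> as witness, this says that \<open>y\<close> lies in the interior
  of the closure of its local orbit \<open>V y\<close>.\<close>

definition dense_around :: "'a set \<Rightarrow> 'c \<Rightarrow> 'c set \<Rightarrow> bool" where
  "dense_around V y U \<longleftrightarrow>
     openin Y U \<and> y \<in> U \<and> (\<forall>W. openin Y W \<and> W \<subseteq> U \<and> W \<noteq> {} \<longrightarrow> (\<exists>v\<in>V. \<phi> v y \<in> W))"

definition locally_generic :: "'c \<Rightarrow> bool" where
  "locally_generic y \<longleftrightarrow> (\<forall>V. openin X V \<and> \<one> \<in> V \<longrightarrow> (\<exists>U. dense_around V y U))"

lemma dense_around_shrink:
  "dense_around V y U \<Longrightarrow> openin Y U' \<Longrightarrow> y \<in> U' \<Longrightarrow> dense_around V y (U \<inter> U')"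
  by (auto simp: dense_around_def intro: openin_Int)

text \<open>Conjugation by \<open>g\<close> is continuous and fixes the identity, and
  \<open>g h g^-1\<close> sends \<open>g y\<close> to \<open>g (h y)\<close>. So \<open>V\<close> is
  pulled back along conjugation, while \<open>U\<close> is carried forward by
  \<open>g\<close>.\<close>

lemma locally_generic_act:
  assumes y: "locally_generic y" "y \<in> E" and g: "g \<in> carrier G"
  shows "locally_generic (\<phi> g y)"
  unfolding locally_generic_def
proof (intro allI impI)
  fix V assume V: "openin X V \<and> \<one> \<in> V"
  let ?V = "{h \<in> carrier G. g \<otimes> h \<otimes> inv g \<in> V}"
  have "continuous_map X X (\<lambda>h. g \<otimes> h \<otimes> inv g)"
    using g by (intro continuous_mult) (auto simp: topspace_X)
  then have "openin X ?V"
    using openin_continuous_map_preimage V topspace_X by fastforce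
  moreover have "\<one> \<in> ?V" using V g by simp
  ultimately obtain U where U: "dense_around ?V y U"
    using y unfolding locally_generic_def by blast
  show "\<exists>U. dense_around V (\<phi> g y) U"
    unfolding dense_around_def
  proof (intro exI[of _ "{z \<in> E. \<phi> (inv g) z \<in> U}"] conjI allI impI)
    show "openin Y {z \<in> E. \<phi> (inv g) z \<in> U}"
      using U g by (intro openin_act_vimage) (auto simp: dense_around_def)
    show "\<phi> g y \<in> {z \<in> E. \<phi> (inv g) z \<in> U}" using U y g by (simp add: dense_around_def)
    fix W assume W: "openin Y W \<and> W \<subseteq> {z \<in> E. \<phi> (inv g) z \<in> U} \<and> W \<noteq> {}"
    let ?W = "{z \<in> E. \<phi> g z \<in> W}"
    obtain w where w: "w \<in> W" using W by blast
    then have "w \<in> E" using W by blast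
    then have "\<phi> (inv g) w \<in> ?W" using w g by simp
    moreover have "?W \<subseteq> U" using W g by fastforce
    moreover have "openin Y ?W" using W g by (intro openin_act_vimage) auto
    ultimately obtain v where v: "v \<in> ?V" "\<phi> v y \<in> ?W"
      using U unfolding dense_around_def by blast
    have "\<phi> (g \<otimes> v \<otimes> inv g) (\<phi> g y) = \<phi> g (\<phi> v y)"
      using v g y by (simp add: act_mult)
    then show "\<exists>v\<in>V. \<phi> v (\<phi> g y) \<in> W"
      using v by (intro bexI[of _ "g \<otimes> v \<otimes> inv g"]) auto
  qed
qed

text \<open>An alternating construction: \<open>b k\<close> moves \<open>x\<close> for even \<open>k\<close> and \<open>y\<close> for odd \<open>k\<close>, where
  \<open>b (k + 2)\<close> is \<open>2\<^sup>-\<^sup>k\<close>-close to \<open>b k\<close> and the images of \<open>x\<close> and \<open>y\<close> approach each other.\<close>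

lemma locally_generic_conjugate:
  assumes x: "locally_generic x" "x \<in> E" and y: "locally_generic y" "y \<in> E"
    and dense: "\<And>W. openin Y W \<Longrightarrow> W \<noteq> {} \<Longrightarrow> \<exists>g\<in>carrier G. \<phi> g y \<in> W"
  shows "y \<in> orbit G \<phi> x"
proof -
  obtain d where M: "Metric_space (carrier G) d" "Metric_space.mcomplete (carrier G) d"
    and X: "X = Metric_space.mtopology (carrier G) d"
    using Polish Metric_space.topspace_mtopology
    by (fastforce simp: Polish_group_def completely_metrizable_space_def)
  obtain e where N: "Metric_space E e" and Ye: "Y = Metric_space.mtopology E e"
    using Y(1,2) Metric_space.topspace_mtopology by (fastforce simp: completely_metrizable_space_def)
  interpret X: Metric_space "carrier G" d by (rule M)
  interpret Y: Metric_space E e by (rule N)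
  define z where "z k = (if even k then x else y)" for k :: nat
  have z: "locally_generic (z k)" "z k \<in> E" "z (Suc (Suc k)) = z k" for k
    using x y by (auto simp: z_def)
  \<comment> \<open>\<open>d\<close> is a complete compatible metric that need not be invariant, so
    the size of \<open>v\<close> is measured by how far left multiplication by \<open>v\<close>
    moves the current \<open>b\<close>.\<close>
  define B where "B b k = {v \<in> carrier G. d (v \<otimes> b) b < (1/2) ^ k}" for b and k :: nat
  have B: "openin X (B b k)" "\<one> \<in> B b k" if "b \<in> carrier G" for b k
  proof -
    have "continuous_map X X (\<lambda>v. v \<otimes> b)"
      using that by (intro continuous_mult) (auto simp: topspace_X)
    moreover have "openin X (X.mball b ((1/2) ^ k))" by (simp add: X)
    ultimately have "openin X {v \<in> topspace X. v \<otimes> b \<in> X.mball b ((1/2) ^ k)}"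
      by (rule openin_continuous_map_preimage)
    also have "{v \<in> topspace X. v \<otimes> b \<in> X.mball b ((1/2) ^ k)} = B b k"
      using that by (auto simp: B_def topspace_X X.in_mball X.commute)
    finally show "openin X (B b k)" .
    show "\<one> \<in> B b k" using that by (simp add: B_def)
  qed
  \<comment> \<open>In a state \<open>(a, b)\<close>, \<open>b\<close> has placed one point, whose
    local orbit is dense in a small \<open>U\<close>, and \<open>a\<close> has already placed the
    other point inside \<open>U\<close>. The roles swap at every stage.\<close>
  define P where "P k s = (case s of (a, b) \<Rightarrow> a \<in> carrier G \<and> b \<in> carrier G \<and>
     (\<exists>U. dense_around (B b k) (\<phi> b (z k)) U \<and> \<phi> a (z (Suc k)) \<in> U \<and>
          U \<subseteq> Y.mball (\<phi> b (z k)) ((1/2) ^ k)))" for k s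
  have nbhd: "\<exists>U. dense_around (B b k) (\<phi> b (z k)) U \<and> U \<subseteq> Y.mball (\<phi> b (z k)) ((1/2) ^ k) \<and> U \<subseteq> U0"
    if b: "b \<in> carrier G" and U0: "openin Y U0" "\<phi> b (z k) \<in> U0" for b k U0
  proof -
    have "locally_generic (\<phi> b (z k))" using locally_generic_act z b by blast
    then obtain U where "dense_around (B b k) (\<phi> b (z k)) U"
      using B[OF b] unfolding locally_generic_def by blast
    then have "dense_around (B b k) (\<phi> b (z k)) (U \<inter> (U0 \<inter> Y.mball (\<phi> b (z k)) ((1/2) ^ k)))"
      using U0 b z by (intro dense_around_shrink openin_Int) (auto simp: Ye)
    then show ?thesis by blast
  qed
  have "\<exists>s. \<forall>k. P k (s k) \<and>
    (snd (s (Suc k)) = fst (s k) \<and> d (fst (s (Suc k))) (snd (s k)) < (1/2) ^ k)"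
  proof (rule dependent_nat_choice)
    \<comment> \<open>Density of the whole orbit of \<open>y\<close> is used once, to bring
      \<open>y\<close> close to \<open>x\<close>; from then on local density does the work.\<close>
    obtain U where U: "dense_around (B \<one> 0) (\<phi> \<one> (z 0)) U" "U \<subseteq> Y.mball (\<phi> \<one> (z 0)) ((1/2) ^ 0)"
      using nbhd[of \<one> "topspace Y" 0] z Y(1) by (metis act_one one_closed openin_topspace)
    then obtain a where "a \<in> carrier G" "\<phi> a y \<in> U"
      using dense[of U] unfolding dense_around_def by blast
    then have "P 0 (a, \<one>)" using U unfolding P_def by (auto simp: z_def)
    then show "\<exists>s. P 0 s" by blast
  next
    fix s k assume "P k s"
    then obtain a b U where s: "s = (a, b)" "a \<in> carrier G" "b \<in> carrier G"
      and U: "dense_around (B b k) (\<phi> b (z k)) U" "\<phi> a (z (Suc k)) \<in> U"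
      unfolding P_def by (cases s) auto
    \<comment> \<open>The next neighbourhood is shrunk into \<open>U\<close> before \<open>b\<close>
      is corrected. It is then a target that the local orbit dense in \<open>U\<close> can reach,
      and the corrected point lands where the next stage needs it.\<close>
    obtain U' where U': "dense_around (B a (Suc k)) (\<phi> a (z (Suc k))) U'"
      "U' \<subseteq> Y.mball (\<phi> a (z (Suc k))) ((1/2) ^ Suc k)" "U' \<subseteq> U"
      using nbhd[OF s(2), of U "Suc k"] U by (auto simp: dense_around_def)
    then have "openin Y U'" "U' \<noteq> {}" by (auto simp: dense_around_def)
    then obtain v where v: "v \<in> B b k" "\<phi> v (\<phi> b (z k)) \<in> U'"
      using U(1) U'(3) unfolding dense_around_def by blast
    then have "P (Suc k) (v \<otimes> b, a)"
      using U' s z unfolding P_def by (auto simp: B_def act_mult)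
    then show "\<exists>t. P (Suc k) t \<and> (snd t = fst s \<and> d (fst t) (snd s) < (1/2) ^ k)"
      using v s by (intro exI[of _ "(v \<otimes> b, a)"]) (auto simp: B_def)
  qed
  then obtain s where s: "\<And>k. P k (s k)" "\<And>k. snd (s (Suc k)) = fst (s k)"
    "\<And>k. d (fst (s (Suc k))) (snd (s k)) < (1/2) ^ k" by blast
  define b where "b k = snd (s k)" for k
  have b: "b k \<in> carrier G" "d (b (Suc (Suc k))) (b k) < (1/2) ^ k"
    "e (\<phi> (b k) (z k)) (\<phi> (b (Suc k)) (z (Suc k))) < (1/2) ^ k" for k
    using s(1)[of k] s(2)[of k] s(2)[of "Suc k"] s(3)[of k]
    by (auto simp: P_def b_def Y.in_mball split: prod.splits)
  \<comment> \<open>In the group only steps of length two are controlled, so the even and the odd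
    subsequences converge separately, to \<open>g\<close> for \<open>x\<close> and to
    \<open>h\<close> for \<open>y\<close>.\<close>
  have lim: "\<exists>g\<in>carrier G. limitin Y (\<lambda>k. \<phi> (b (2 * k + i)) w) (\<phi> g w) sequentially"
    if w: "w \<in> E" for i w
  proof -
    have "X.MCauchy (\<lambda>k. b (2 * k + i))"
    proof (rule X.MCauchy_geometric)
      fix k
      have "d (b (2 * Suc k + i)) (b (2 * k + i)) < (1/2) ^ (2 * k + i)"
        using b(2)[of "2 * k + i"] by simp
      also have "\<dots> \<le> (1/2) ^ k" by (rule power_decreasing) auto
      finally show "d (b (2 * Suc k + i)) (b (2 * k + i)) < (1/2) ^ k" .
    qed (use b in auto)
    then obtain g where g: "limitin X (\<lambda>k. b (2 * k + i)) g sequentially"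
      using M(2) X unfolding X.mcomplete_def by blast
    then have "g \<in> carrier G" using limitin_topspace topspace_X by fast
    then show ?thesis
      using continuous_map_limit[OF continuous_orbit_map[OF w] g] by (auto simp: o_def)
  qed
  obtain g where g: "g \<in> carrier G" "limitin Y (\<lambda>k. \<phi> (b (2 * k)) x) (\<phi> g x) sequentially"
    using lim[OF x(2), of 0] by auto
  obtain h where h: "h \<in> carrier G" "limitin Y (\<lambda>k. \<phi> (b (2 * k + 1)) y) (\<phi> h y) sequentially"
    using lim[OF y(2), of 1] by auto
  \<comment> \<open>Consecutive stages keep the two images within \<open>(1/2) ^ k\<close> of each
    other, so the limit points coincide although \<open>g\<close> and \<open>h\<close> may
    differ.\<close>
  have "e (\<phi> g x) (\<phi> h y) < \<epsilon>" if "\<epsilon> > 0" for \<epsilon>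
  proof -
    from that have \<epsilon>: "\<epsilon> / 3 > 0" by simp
    have "eventually (\<lambda>k. (1/2 :: real) ^ k < \<epsilon> / 3) sequentially"
      using \<epsilon> by (intro order_tendstoD(2)[OF LIMSEQ_power_zero]) auto
    moreover have "eventually (\<lambda>k. e (\<phi> (b (2 * k)) x) (\<phi> g x) < \<epsilon> / 3) sequentially"
      by (rule eventually_mono[OF mp[OF spec[OF conjunct2[OF g(2)[unfolded Ye Y.limitin_metric]]] \<epsilon>]])
        simp
    moreover have "eventually (\<lambda>k. e (\<phi> (b (2 * k + 1)) y) (\<phi> h y) < \<epsilon> / 3) sequentially"
      by (rule eventually_mono[OF mp[OF spec[OF conjunct2[OF h(2)[unfolded Ye Y.limitin_metric]]] \<epsilon>]])
        simp
    ultimately have "eventually (\<lambda>k. e (\<phi> g x) (\<phi> h y) < \<epsilon>) sequentially"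
    proof eventually_elim
      case (elim k)
      have "e (\<phi> (b (2 * k)) x) (\<phi> (b (2 * k + 1)) y) < (1/2) ^ (2 * k)"
        using b(3)[of "2 * k"] by (simp add: z_def)
      also have "\<dots> \<le> (1/2) ^ k" by (rule power_decreasing) auto
      finally show ?case
        using elim b(1) g(1) h(1) x(2) y(2) Y.commute[of "\<phi> g x" "\<phi> (b (2 * k)) x"]
          Y.triangle[of "\<phi> g x" "\<phi> (b (2 * k)) x" "\<phi> h y"]
          Y.triangle[of "\<phi> (b (2 * k)) x" "\<phi> (b (2 * k + 1)) y" "\<phi> h y"] by simp
    qed
    then show ?thesis by simp
  qed
  then have "\<not> e (\<phi> g x) (\<phi> h y) > 0" by blast
  then have "\<phi> g x = \<phi> h y" using g(1) h(1) x(2) y(2) by auto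
  then have "y = \<phi> (inv h \<otimes> g) x" using g(1) h(1) x(2) y(2) by (simp add: act_mult)
  then show ?thesis using g(1) h(1) unfolding orbit_def by blast
qed

text \<open>A point satisfying countably many open dense conditions is locally generic with dense
  orbit, and any two such points are conjugate by the back-and-forth lemma. So one orbit contains a
  countable intersection of dense open sets, which is nonempty by Baire.\<close>

theorem comeager_orbit_criterion:
  assumes ne: "E \<noteq> {}"
    and transitive: "\<And>W1 W2. openin Y W1 \<Longrightarrow> openin Y W2 \<Longrightarrow> W1 \<noteq> {} \<Longrightarrow> W2 \<noteq> {} \<Longrightarrow>
          \<exists>g\<in>carrier G. \<exists>w\<in>W1. \<phi> g w \<in> W2"
    and locally_transitive: "\<And>V U. openin X V \<Longrightarrow> \<one> \<in> V \<Longrightarrow> openin Y U \<Longrightarrow> U \<noteq> {} \<Longrightarrow>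
          \<exists>U'. openin Y U' \<and> U' \<noteq> {} \<and> U' \<subseteq> U \<and>
            (\<forall>W1 W2. openin Y W1 \<and> openin Y W2 \<and> W1 \<noteq> {} \<and> W2 \<noteq> {} \<and> W1 \<subseteq> U' \<and> W2 \<subseteq> U' \<longrightarrow>
              (\<exists>v\<in>V. \<exists>w\<in>W1. \<phi> v w \<in> W2))"
  shows "\<exists>p\<in>E. comeager_in Y (orbit G \<phi> p)"
proof -
  obtain d where M: "Metric_space (carrier G) d" and X: "X = Metric_space.mtopology (carrier G) d"
    using Polish Metric_space.topspace_mtopology
    by (fastforce simp: Polish_group_def completely_metrizable_space_def)
  interpret X: Metric_space "carrier G" d by (rule M)
  define V where "V k = X.mball \<one> (1 / Suc k)" for k
  have V: "openin X (V k)" "\<one> \<in> V k" "V k \<subseteq> carrier G" for k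
    by (auto simp: V_def X)
  have V_base: "\<exists>k. V k \<subseteq> V'" if "openin X V'" "\<one> \<in> V'" for V'
  proof -
    obtain r where r: "r > 0" "X.mball \<one> r \<subseteq> V'" using \<open>openin X V'\<close> \<open>\<one> \<in> V'\<close> by (auto simp: X X.openin_mtopology)
    obtain k where "1 / Suc k < r" using r(1) by (metis nat_approx_posE)
    then have "V k \<subseteq> X.mball \<one> r" by (auto simp: V_def)
    with r(2) show ?thesis by blast
  qed
  have "second_countable Y"
    using Y completely_metrizable_imp_metrizable_space metrizable_separable_imp_second_countable by blast
  then obtain \<B> where \<B>: "countable \<B>" "\<And>W. W \<in> \<B> \<Longrightarrow> openin Y W"
    "\<And>U y. openin Y U \<Longrightarrow> y \<in> U \<Longrightarrow> \<exists>W\<in>\<B>. y \<in> W \<and> W \<subseteq> U"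
    by (metis second_countable_def)
  \<comment> \<open>Local topological transitivity of \<open>V k\<close> on \<open>U\<close>. By
    \<open>locally_transitive\<close> every nonempty open set contains a nonempty open set of this
    kind.\<close>
  define good where "good k U \<longleftrightarrow> openin Y U \<and>
    (\<forall>W1 W2. openin Y W1 \<and> openin Y W2 \<and> W1 \<noteq> {} \<and> W2 \<noteq> {} \<and> W1 \<subseteq> U \<and> W2 \<subseteq> U \<longrightarrow>
              (\<exists>v\<in>V k. \<exists>w\<in>W1. \<phi> v w \<in> W2))" for k U
  define H where "H A W = {y \<in> E. \<exists>v\<in>A. \<phi> v y \<in> W}" for A W
  have H: "openin Y (H A W)" if "A \<subseteq> carrier G" "openin Y W" for A W
  proof -
    have "H A W = (\<Union>v\<in>A. {y \<in> E. \<phi> v y \<in> W})" by (auto simp: H_def)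
    moreover have "\<forall>U\<in>(\<lambda>v. {y \<in> E. \<phi> v y \<in> W}) ` A. openin Y U"
      using that openin_act_vimage by blast
    ultimately show ?thesis by (simp only: openin_Union)
  qed
  have dense_iff: "Y closure_of S = E \<longleftrightarrow> (\<forall>U. openin Y U \<and> U \<noteq> {} \<longrightarrow> S \<inter> U \<noteq> {})" for S
    using dense_intersects_open[of Y S] Y(1) by auto
  define D where "D k = \<Union>{U. good k U}" for k
  \<comment> \<open>An open set together with the exterior of its closure is always dense. A generic
    \<open>y\<close> is thus either sent into \<open>W\<close> by \<open>V k\<close>, or has a
    neighbourhood none of whose points is.\<close>
  define Q where "Q k W = H (V k) W \<union> (E - Y closure_of H (V k) W)" for k W
  define K where "K W = H (carrier G) W" for W
  define \<G> where "\<G> = range D \<union> (\<lambda>(k, W). Q k W) ` (UNIV \<times> \<B>) \<union> K ` (\<B> - {{}})"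
  have "countable \<G>" using \<B>(1) by (auto simp: \<G>_def)
  have op: "openin Y T \<and> Y closure_of T = topspace Y" if "T \<in> \<G>" for T
  proof -
    have "openin Y (D k) \<and> Y closure_of (D k) = E" for k
      unfolding dense_iff
    proof (intro conjI allI impI)
      show "openin Y (D k)" by (auto simp: D_def good_def)
      fix U assume U: "openin Y U \<and> U \<noteq> {}"
      then obtain U' where "good k U'" "U' \<noteq> {}" "U' \<subseteq> U"
        using locally_transitive[OF V(1) V(2), of U k] unfolding good_def by auto
      then show "D k \<inter> U \<noteq> {}" unfolding D_def by blast
    qed
    moreover have "openin Y (Q k W) \<and> Y closure_of (Q k W) = E" if "W \<in> \<B>" for k W
      unfolding dense_iff
    proof (intro conjI allI impI)
      have op: "openin Y (H (V k) W)" using H[OF V(3)] \<B>(2)[OF that] by simp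
      then show "openin Y (Q k W)"
        unfolding Q_def Y(1)[symmetric] by (intro openin_Un openin_diff openin_topspace closedin_closure_of)
      fix U assume U: "openin Y U \<and> U \<noteq> {}"
      show "Q k W \<inter> U \<noteq> {}"
      proof (cases "H (V k) W \<inter> U = {}")
        case True
        then have "U \<inter> Y closure_of H (V k) W = {}"
          using U openin_Int_closure_of_eq_empty[of Y U "H (V k) W"] by blast
        then show ?thesis using U openin_subset[of Y U] Y(1) unfolding Q_def by blast
      qed (auto simp: Q_def)
    qed
    moreover have "openin Y (K W) \<and> Y closure_of (K W) = E" if W: "W \<in> \<B>" "W \<noteq> {}" for W
      unfolding dense_iff
    proof (intro conjI allI impI)
      show "openin Y (K W)" unfolding K_def using H[OF subset_refl] \<B>(2)[OF W(1)] by simp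
      fix U assume U: "openin Y U \<and> U \<noteq> {}"
      then obtain g w where "g \<in> carrier G" "w \<in> U" "\<phi> g w \<in> W"
        using transitive[of U W] \<B>(2)[OF W(1)] W by blast
      then show "K W \<inter> U \<noteq> {}"
        using U openin_subset[of Y U] Y(1) unfolding K_def H_def by blast
    qed
    ultimately show ?thesis 
      using that unfolding \<G>_def Y(1) by (elim UnE imageE) (simp_all add: case_prod_beta mem_Times_iff)
  qed
  have generic: "locally_generic y \<and> (\<forall>W. openin Y W \<longrightarrow> W \<noteq> {} \<longrightarrow> (\<exists>g\<in>carrier G. \<phi> g y \<in> W))"
    if y: "y \<in> E" "y \<in> \<Inter>\<G>" for y
  proof (intro conjI allI impI)
    fix W assume "openin Y W" "W \<noteq> {}"
    then obtain W' where W': "W' \<in> \<B>" "W' \<subseteq> W" "W' \<noteq> {}" using \<B>(3) by blast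
    then have "y \<in> K W'" using y unfolding \<G>_def by blast
    then show "\<exists>g\<in>carrier G. \<phi> g y \<in> W" using W' unfolding K_def H_def by blast
  next
    show "locally_generic y"
      unfolding locally_generic_def
    proof (intro allI impI)
      fix V' assume "openin X V' \<and> \<one> \<in> V'"
      then obtain k where k: "V k \<subseteq> V'" using V_base by blast
      have "y \<in> D k" using y unfolding \<G>_def by blast
      then obtain U where U: "good k U" "y \<in> U" unfolding D_def by blast
      have "\<exists>v\<in>V k. \<phi> v y \<in> W" if W: "openin Y W \<and> W \<subseteq> U \<and> W \<noteq> {}" for W
      proof -
        obtain W' where W': "W' \<in> \<B>" "W' \<subseteq> W" "W' \<noteq> {}" using \<B>(3) W by blast
        have "y \<in> Q k W'" using y W' unfolding \<G>_def by blast
        \<comment> \<open>Otherwise the exterior part of \<open>U\<close> would be a nonempty open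
          set that \<open>V k\<close> never moves into \<open>W'\<close>, against transitivity on
          \<open>U\<close>.\<close>
        moreover have "\<not> y \<in> E - Y closure_of H (V k) W'"
        proof
          assume y': "y \<in> E - Y closure_of H (V k) W'"
          let ?S = "U \<inter> (E - Y closure_of H (V k) W')"
          have "openin Y ?S"
            using U unfolding good_def Y(1)[symmetric]
            by (intro openin_Int openin_diff openin_topspace closedin_closure_of) auto
          moreover have "?S \<noteq> {}" using y' U by blast
          moreover have "openin Y W'" using \<B>(2)[OF W'(1)] .
          ultimately obtain v w where v: "v \<in> V k" "w \<in> ?S" "\<phi> v w \<in> W'"
            using U(1) W' W unfolding good_def by (metis inf_le1 order_trans)
          then have "w \<in> H (V k) W'" unfolding H_def by blast
          moreover have "H (V k) W' \<subseteq> Y closure_of H (V k) W'"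
            using Y(1) by (intro closure_of_subset) (auto simp: H_def)
          ultimately show False using v by blast
        qed
        ultimately show ?thesis using W' unfolding Q_def H_def by blast
      qed
      moreover have "openin Y U" using U(1) by (simp add: good_def)
      ultimately have "dense_around V' y U"
        using U(2) k unfolding dense_around_def by blast
      then show "\<exists>U. dense_around V' y U" by blast
    qed
  qed
  have "Y closure_of \<Inter>\<G> = topspace Y"
    using Baire_category[of Y \<G>] Y(2) \<open>countable \<G>\<close> op by blast
  then obtain p where p: "p \<in> E" "p \<in> \<Inter>\<G>"
    using ne Y(1) dense_iff[of "\<Inter>\<G>"] openin_topspace[of Y] by blast
  have "comeager_in Y (orbit G \<phi> p)"
  proof (rule comeager_in_superset_dense_opens[OF \<open>countable \<G>\<close> op])
    show "topspace Y \<inter> \<Inter>\<G> \<subseteq> orbit G \<phi> p"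
    proof
      fix y assume y: "y \<in> topspace Y \<inter> \<Inter>\<G>"
      then show "y \<in> orbit G \<phi> p"
        using generic[of p] generic[of y] p Y(1) by (intro locally_generic_conjugate) auto
    qed
    show "orbit G \<phi> p \<subseteq> topspace Y" unfolding Y(1) orbit_def using p by auto
  qed
  with p show ?thesis by blast
qed

end

section \<open>Diagonal conjugation as a continuous action on finite powers\<close>

lemma diag_conj_apply:
  assumes "p \<in> {..n} \<rightarrow>\<^sub>E carrier G" "i \<le> n"
  shows "diag_conj G n g p i = g \<otimes>\<^bsub>G\<^esub> p i \<otimes>\<^bsub>G\<^esub> inv\<^bsub>G\<^esub> g"
  using assms by (simp add: diag_conj_def)

lemma continuous_action_diag_conj:
  fixes G (structure)
  assumes P: "Polish_group G X"
  shows "continuous_action G ({..n} \<rightarrow>\<^sub>E carrier G) (diag_conj G n) X (product_topology (\<lambda>_. X) {..n})"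
proof -
  let ?E = "{..n} \<rightarrow>\<^sub>E carrier G" and ?Y = "product_topology (\<lambda>_. X) {..n}"
  interpret group G using P by (simp add: Polish_group_def)
  have top: "topspace X = carrier G" using P by (simp add: Polish_group_def)
  have closed: "diag_conj G n g p \<in> ?E" if "g \<in> carrier G" "p \<in> ?E" for g p
    using that by (auto simp: diag_conj_def PiE_iff)
  have comp: "diag_conj G n (g \<otimes> h) p = diag_conj G n g (diag_conj G n h p)"
    if g: "g \<in> carrier G" and h: "h \<in> carrier G" and p: "p \<in> ?E" for g h p
  proof (rule PiE_ext[of _ "{..n}" "\<lambda>_. carrier G"])
    fix i assume "i \<in> {..n}"
    then have i: "i \<le> n" and "p i \<in> carrier G" using p by auto
    then show "diag_conj G n (g \<otimes> h) p i = diag_conj G n g (diag_conj G n h p) i"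
      using g h by (simp add: diag_conj_apply[OF p] diag_conj_apply[OF closed[OF h p]] inv_mult_group m_assoc)
  qed (use g h p closed in auto)
  have one: "diag_conj G n \<one> p = p" if p: "p \<in> ?E" for p
    by (rule PiE_ext[of _ "{..n}" "\<lambda>_. carrier G"])
      (use p closed[OF one_closed p] in \<open>auto simp: diag_conj_apply[OF p] PiE_mem[OF p]\<close>)
  have Bij: "diag_conj G n g \<in> Bij ?E" if g: "g \<in> carrier G" for g
  proof -
    have "bij_betw (diag_conj G n g) ?E ?E"
      by (rule bij_betw_byWitness[where f' = "diag_conj G n (inv g)"])
        (use g closed comp[symmetric] one in auto)
    then show ?thesis by (simp add: Bij_def diag_conj_def)
  qed
  have hom: "diag_conj G n \<in> hom G (BijGroup ?E)"
  proof (rule homI)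
    show "diag_conj G n g \<in> carrier (BijGroup ?E)" if "g \<in> carrier G" for g
      using Bij[OF that] by (simp add: BijGroup_def)
    fix g h assume gh: "g \<in> carrier G" "h \<in> carrier G"
    have "diag_conj G n (g \<otimes> h) = compose ?E (diag_conj G n g) (diag_conj G n h)"
    proof (rule extensionalityI[of _ ?E])
      show "diag_conj G n (g \<otimes> h) \<in> extensional ?E" by (simp add: diag_conj_def)
      show "diag_conj G n (g \<otimes> h) p = compose ?E (diag_conj G n g) (diag_conj G n h) p" if "p \<in> ?E" for p
        using comp[OF gh that] that by (simp add: compose_eq)
    qed simp
    then show "diag_conj G n (g \<otimes> h) = diag_conj G n g \<otimes>\<^bsub>BijGroup ?E\<^esub> diag_conj G n h"
      using Bij gh by (simp add: BijGroup_def)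
  qed
  show ?thesis
  proof (intro continuous_action.intro group_action.intro continuous_action_axioms.intro)
    show "group_hom G (BijGroup ?E) (diag_conj G n)"
      by (intro group_hom.intro group_hom_axioms.intro group_BijGroup hom group_axioms)
    show "topspace ?Y = ?E" by (simp add: top)
    have "countable {i \<in> {..n}. Q i}" for Q by (rule countable_finite) simp
    then show "completely_metrizable_space ?Y"
      using P by (simp add: completely_metrizable_space_product_topology Polish_group_def)
    show "separable_space ?Y"
      using P by (intro separable_space_finite_power) (auto simp: Polish_group_def)
    show "Polish_group G X" by (rule P)
  next
    fix g assume g: "g \<in> carrier G"
    have "continuous_map ?Y X (\<lambda>p. g \<otimes> p i \<otimes> inv g)" if "i \<in> {..n}" for i
      using g that by (intro Polish_group_continuous_mult[OF P] continuous_map_product_projection)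
        (auto simp: top)
    then have "continuous_map ?Y ?Y (\<lambda>p. \<lambda>i\<in>{..n}. g \<otimes> p i \<otimes> inv g)"
      by (auto simp: continuous_map_componentwise image_subset_iff)
    then show "continuous_map ?Y ?Y (diag_conj G n g)"
      by (rule continuous_map_eq) (simp add: diag_conj_def top)
  next
    fix p assume p: "p \<in> ?E"
    have "continuous_map X X (\<lambda>g. inv g)" using P by (simp add: Polish_group_def)
    then have "continuous_map X X (\<lambda>g. g \<otimes> p i \<otimes> inv g)" if "i \<in> {..n}" for i
      using p that by (intro Polish_group_continuous_mult[OF P]) (auto simp: top)
    then show "continuous_map X ?Y (\<lambda>g. diag_conj G n g p)"
      using p by (auto simp: continuous_map_componentwise image_subset_iff diag_conj_def)
  qed
qed

section \<open>Isometry groups of complete separable metric spaces\<close>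

context Metric_space
begin

lemma Iso_carrier:
  "f \<in> carrier (Iso M d) \<longleftrightarrow> f \<in> extensional M \<and> bij_betw f M M \<and> (\<forall>x\<in>M. \<forall>y\<in>M. d (f x) (f y) = d x y)"
  by (auto simp: Iso_def Bij_def)

lemma Iso_closed: "f \<in> carrier (Iso M d) \<Longrightarrow> x \<in> M \<Longrightarrow> f x \<in> M"
  by (auto simp: Iso_carrier bij_betw_def)

lemma Iso_dist: "f \<in> carrier (Iso M d) \<Longrightarrow> x \<in> M \<Longrightarrow> y \<in> M \<Longrightarrow> d (f x) (f y) = d x y"
  by (simp add: Iso_carrier)

lemma Iso_PiE: "carrier (Iso M d) \<subseteq> M \<rightarrow>\<^sub>E M"
  using Iso_closed by (auto simp: PiE_def Iso_carrier)

lemma Iso_eqI: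
  "f \<in> carrier (Iso M d) \<Longrightarrow> g \<in> carrier (Iso M d) \<Longrightarrow> (\<And>x. x \<in> M \<Longrightarrow> f x = g x) \<Longrightarrow> f = g"
  by (meson Iso_carrier extensionalityI)

text \<open>Preserving distances already gives injectivity, so a right inverse \<open>g\<close> is
  enough for bijectivity.\<close>

lemma Iso_memI:
  assumes "f \<in> extensional M" "\<And>x. x \<in> M \<Longrightarrow> f x \<in> M" "\<And>x. x \<in> M \<Longrightarrow> g x \<in> M"
    and "\<And>x. x \<in> M \<Longrightarrow> f (g x) = x" "\<And>x y. x \<in> M \<Longrightarrow> y \<in> M \<Longrightarrow> d (f x) (f y) = d x y"
  shows "f \<in> carrier (Iso M d)"
proof -
  have "inj_on f M"
    using assms(2,5) by (intro inj_onI) (metis zero)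
  moreover have "f ` M = M" using assms(2,3,4) by force
  ultimately show ?thesis using assms by (auto simp: Iso_carrier bij_betw_def)
qed

lemma Iso_subgroup: "subgroup (carrier (Iso M d)) (BijGroup M)"
proof (rule subgroup.intro)
  show "carrier (Iso M d) \<subseteq> carrier (BijGroup M)" by (auto simp: Iso_def BijGroup_def)
  show "\<one>\<^bsub>BijGroup M\<^esub> \<in> carrier (Iso M d)" by (auto simp: Iso_def id_Bij BijGroup_def)
next
  fix f assume f: "f \<in> carrier (Iso M d)"
  then have fB: "f \<in> Bij M" by (simp add: Iso_def)
  have "d (inv_into M f x) (inv_into M f y) = d x y" if "x \<in> M" "y \<in> M" for x y
  proof -
    have "x \<in> f ` M" "y \<in> f ` M" using f that by (auto simp: Iso_carrier bij_betw_def)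
    then show ?thesis
      using Iso_dist[OF f, of "inv_into M f x" "inv_into M f y"]
      by (simp add: f_inv_into_f inv_into_into)
  qed
  then show "inv\<^bsub>BijGroup M\<^esub> f \<in> carrier (Iso M d)"
    using restrict_inv_into_Bij[OF fB] by (simp add: inv_BijGroup[OF fB] Iso_def)
next
  fix f g assume f: "f \<in> carrier (Iso M d)" and g: "g \<in> carrier (Iso M d)"
  then have B: "f \<in> Bij M" "g \<in> Bij M" by (simp_all add: Iso_def)
  have "d (f (g x)) (f (g y)) = d x y" if "x \<in> M" "y \<in> M" for x y
    using f g that by (simp add: Iso_dist Iso_closed)
  then have "compose M f g \<in> carrier (Iso M d)"
    using compose_Bij[OF B] by (simp add: Iso_def compose_eq)
  then show "f \<otimes>\<^bsub>BijGroup M\<^esub> g \<in> carrier (Iso M d)"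
    using B by (simp add: BijGroup_def)
qed

lemma group_Iso: "group (Iso M d)"
proof -
  have "(BijGroup M)\<lparr>carrier := carrier (Iso M d)\<rparr> = Iso M d"
    by (simp add: Iso_def)
  then show ?thesis
    using subgroup.subgroup_is_group[OF Iso_subgroup group_BijGroup] by simp
qed

lemmas Iso_m_closed [simp] = group.is_monoid[OF group_Iso, THEN monoid.m_closed]
  and Iso_one_closed [simp] = group.is_monoid[OF group_Iso, THEN monoid.one_closed]
  and Iso_inv_closed [simp] = group.inv_closed[OF group_Iso]
  and Iso_l_inv [simp] = group.l_inv[OF group_Iso]
  and Iso_r_inv [simp] = group.r_inv[OF group_Iso]

lemma Iso_mult [simp]:
  assumes "f \<in> carrier (Iso M d)" "g \<in> carrier (Iso M d)" "x \<in> M"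
  shows "(f \<otimes>\<^bsub>Iso M d\<^esub> g) x = f (g x)"
proof -
  have "f \<in> Bij M" "g \<in> Bij M" using assms by (simp_all add: Iso_def)
  then show ?thesis using assms(3) by (simp add: Iso_def BijGroup_def compose_eq)
qed

lemma Iso_one [simp]: "x \<in> M \<Longrightarrow> \<one>\<^bsub>Iso M d\<^esub> x = x"
  by (simp add: Iso_def BijGroup_def)

lemma Iso_inv_apply [simp]:
  assumes "f \<in> carrier (Iso M d)" "x \<in> M"
  shows "(inv\<^bsub>Iso M d\<^esub> f) (f x) = x" "f ((inv\<^bsub>Iso M d\<^esub> f) x) = x"
  using assms Iso_mult[of "inv\<^bsub>Iso M d\<^esub> f" f x] Iso_mult[of f "inv\<^bsub>Iso M d\<^esub> f" x] by auto

declare Iso_closed [simp] Iso_dist [simp]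

section \<open>Topology of pointwise convergence on the isometry group\<close>

lemma topspace_Iso_topology [simp]: "topspace (Iso_topology M d) = carrier (Iso M d)"
  using Iso_PiE by (auto simp: Iso_topology_def)

lemma continuous_map_Iso_eval:
  "x \<in> M \<Longrightarrow> continuous_map (Iso_topology M d) mtopology (\<lambda>f. f x)"
  unfolding Iso_topology_def
  by (intro continuous_map_from_subtopology continuous_map_product_projection)

lemma continuous_map_into_Iso:
  assumes "\<And>z. z \<in> topspace Z \<Longrightarrow> f z \<in> carrier (Iso M d)"
    and "\<And>x. x \<in> M \<Longrightarrow> continuous_map Z mtopology (\<lambda>z. f z x)"
  shows "continuous_map Z (Iso_topology M d) f"
  using assms Iso_PiE
  by (auto simp: Iso_topology_def continuous_map_in_subtopology continuous_map_componentwise PiE_def)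

lemma openin_Iso_basic:
  assumes "finite F" "F \<subseteq> M" "\<And>x. x \<in> F \<Longrightarrow> c x \<in> M"
  shows "openin (Iso_topology M d) {f \<in> carrier (Iso M d). \<forall>x\<in>F. d (c x) (f x) < \<epsilon>}"
proof -
  have "openin (Iso_topology M d) {f \<in> topspace (Iso_topology M d). f x \<in> mball (c x) \<epsilon>}" if "x \<in> F" for x
    using that assms by (intro openin_continuous_map_preimage[OF continuous_map_Iso_eval]) auto
  then have "openin (Iso_topology M d)
      (\<Inter>((\<lambda>x. {f \<in> topspace (Iso_topology M d). f x \<in> mball (c x) \<epsilon>}) ` F) \<inter> topspace (Iso_topology M d))"
    using assms(1) by (intro openin_INT)
  also have "\<Inter>((\<lambda>x. {f \<in> topspace (Iso_topology M d). f x \<in> mball (c x) \<epsilon>}) ` F) \<inter> topspace (Iso_topology M d) =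
      {f \<in> carrier (Iso M d). \<forall>x\<in>F. d (c x) (f x) < \<epsilon>}"
    using assms by (auto simp: subset_iff)
  finally show ?thesis .
qed

lemma Iso_nbhd_basic:
  assumes "openin (Iso_topology M d) U" "f \<in> U"
  obtains F \<epsilon> where "finite F" "F \<subseteq> M" "\<epsilon> > 0"
    "\<And>g. g \<in> carrier (Iso M d) \<Longrightarrow> (\<And>x. x \<in> F \<Longrightarrow> d (f x) (g x) < \<epsilon>) \<Longrightarrow> g \<in> U"
proof -
  obtain U0 where U0: "openin (product_topology (\<lambda>_. mtopology) M) U0" "U = U0 \<inter> carrier (Iso M d)"
    using assms(1) by (auto simp: Iso_topology_def openin_subtopology)
  then obtain W where W: "finite {x \<in> M. W x \<noteq> M}" "\<And>x. x \<in> M \<Longrightarrow> openin mtopology (W x)"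
    "f \<in> Pi\<^sub>E M W" "Pi\<^sub>E M W \<subseteq> U0"
    using assms(2) unfolding openin_product_topology_alt by fastforce
  define F where "F = {x \<in> M. W x \<noteq> M}"
  have "\<exists>r>0. mball (f x) r \<subseteq> W x" if "x \<in> F" for x
    using W(2)[of x] W(3) that by (auto simp: F_def openin_mtopology PiE_iff)
  then obtain r where r: "\<And>x. x \<in> F \<Longrightarrow> r x > 0" "\<And>x. x \<in> F \<Longrightarrow> mball (f x) (r x) \<subseteq> W x"
    by metis
  \<comment> \<open>The \<open>1\<close> keeps the minimum meaningful when \<open>F\<close> is
    empty.\<close>
  define \<epsilon> where "\<epsilon> = Min (insert 1 (r ` F))"
  have fin: "finite F" using W(1) by (simp add: F_def)
  have f: "f \<in> carrier (Iso M d)" using assms(2) U0(2) by simp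
  show thesis
  proof
    show "finite F" "F \<subseteq> M" by (simp_all add: fin) (auto simp: F_def)
    show "\<epsilon> > 0" using fin r(1) by (auto simp: \<epsilon>_def)
    fix g assume g: "g \<in> carrier (Iso M d)" "\<And>x. x \<in> F \<Longrightarrow> d (f x) (g x) < \<epsilon>"
    have "g x \<in> W x" if "x \<in> M" for x
    proof (cases "x \<in> F")
      case True
      then have "\<epsilon> \<le> r x" using fin by (simp add: \<epsilon>_def)
      then have "g x \<in> mball (f x) (r x)" using g True that f by (force simp: in_mball)
      then show ?thesis using r(2) True by blast
    next
      case False
      then show ?thesis using g(1) that by (simp add: F_def)
    qed
    then have "g \<in> Pi\<^sub>E M W" using g(1) Iso_PiE by (auto simp: PiE_def)
    then show "g \<in> U" using W(4) U0(2) g(1) by blast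
  qed
qed

text \<open>Replacing \<open>h x\<close> by \<open>h' x\<close> under the isometry \<open>g'\<close>
  costs exactly \<open>d (h x) (h' x)\<close>. So \<open>g'\<close> needs control at the single
  point \<open>h x\<close>, and \<open>h'\<close> at \<open>x\<close>.\<close>

lemma continuous_map_Iso_mult:
  "continuous_map (prod_topology (Iso_topology M d) (Iso_topology M d)) (Iso_topology M d)
     (\<lambda>(g, h). g \<otimes>\<^bsub>Iso M d\<^esub> h)"
proof (rule continuous_map_into_Iso)
  let ?Z = "prod_topology (Iso_topology M d) (Iso_topology M d)"
  fix x assume x: "x \<in> M"
  show "continuous_map ?Z mtopology (\<lambda>z. (case z of (g, h) \<Rightarrow> g \<otimes>\<^bsub>Iso M d\<^esub> h) x)"
    unfolding continuous_map_to_metric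
  proof (intro ballI allI impI)
    fix z and \<epsilon> :: real assume z: "z \<in> topspace ?Z" and \<epsilon>: "\<epsilon> > 0"
    then obtain g h where gh: "z = (g, h)" "g \<in> carrier (Iso M d)" "h \<in> carrier (Iso M d)" by auto
    let ?U = "{f \<in> carrier (Iso M d). \<forall>y\<in>{h x}. d (g y) (f y) < \<epsilon> / 2}"
    let ?V = "{f \<in> carrier (Iso M d). \<forall>y\<in>{x}. d (h y) (f y) < \<epsilon> / 2}"
    have "openin ?Z (?U \<times> ?V)"
      unfolding openin_prod_Times_iff using gh x by (intro disjI2 conjI openin_Iso_basic) auto
    moreover have "z \<in> ?U \<times> ?V" using gh x \<epsilon> by simp
    moreover have "(case z' of (g, h) \<Rightarrow> g \<otimes>\<^bsub>Iso M d\<^esub> h) x \<in> mball ((case z of (g, h) \<Rightarrow> g \<otimes>\<^bsub>Iso M d\<^esub> h) x) \<epsilon>"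
      if z'UV: "z' \<in> ?U \<times> ?V" for z'
    proof -
      obtain g' h' where z': "z' = (g', h')" "g' \<in> ?U" "h' \<in> ?V" using z'UV by (rule SigmaE) blast
      then have "d (g (h x)) (g' (h' x)) \<le> d (g (h x)) (g' (h x)) + d (g' (h x)) (g' (h' x))"
        using gh x by (intro triangle) auto
      then show ?thesis using z' gh x by auto
    qed
    ultimately show "\<exists>U. openin ?Z U \<and> z \<in> U \<and>
        (\<forall>z'\<in>U. (case z' of (g, h) \<Rightarrow> g \<otimes>\<^bsub>Iso M d\<^esub> h) x \<in> mball ((case z of (g, h) \<Rightarrow> g \<otimes>\<^bsub>Iso M d\<^esub> h) x) \<epsilon>)"
      by blast
  qed
qed auto

text \<open>Let \<open>y\<close> be the preimage of \<open>x\<close> under \<open>g\<close>.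
  Applying \<open>f\<close> turns the distance from \<open>f^-1 x\<close> to \<open>y\<close> into
  the distance from \<open>x = g y\<close> to \<open>f y\<close>, so control of \<open>f\<close> at
  \<open>y\<close> suffices.\<close>

lemma continuous_map_Iso_inv:
  "continuous_map (Iso_topology M d) (Iso_topology M d) (\<lambda>g. inv\<^bsub>Iso M d\<^esub> g)"
proof (rule continuous_map_into_Iso)
  fix x assume x: "x \<in> M"
  show "continuous_map (Iso_topology M d) mtopology (\<lambda>g. (inv\<^bsub>Iso M d\<^esub> g) x)"
    unfolding continuous_map_to_metric
  proof (intro ballI allI impI)
    fix g and \<epsilon> :: real assume "g \<in> topspace (Iso_topology M d)" and \<epsilon>: "\<epsilon> > 0"
    then have g: "g \<in> carrier (Iso M d)" by simp
    define y where "y = (inv\<^bsub>Iso M d\<^esub> g) x"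
    have y: "y \<in> M" "g y = x" using g x by (auto simp: y_def)
    let ?U = "{f \<in> carrier (Iso M d). \<forall>u\<in>{y}. d (g u) (f u) < \<epsilon>}"
    have "openin (Iso_topology M d) ?U" using g y by (intro openin_Iso_basic) auto
    moreover have "g \<in> ?U" using g y \<epsilon> x by simp
    moreover have "(inv\<^bsub>Iso M d\<^esub> f) x \<in> mball y \<epsilon>" if "f \<in> ?U" for f
    proof -
      have f: "f \<in> carrier (Iso M d)" "d (g y) (f y) < \<epsilon>" using that by auto
      have "d (f ((inv\<^bsub>Iso M d\<^esub> f) x)) (f y) = d ((inv\<^bsub>Iso M d\<^esub> f) x) y"
        using f x y by (intro Iso_dist) auto
      then show ?thesis using f x y by (simp add: commute)
    qed
    ultimately show "\<exists>U. openin (Iso_topology M d) U \<and> g \<in> U \<and>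
        (\<forall>f\<in>U. (inv\<^bsub>Iso M d\<^esub> f) x \<in> mball ((inv\<^bsub>Iso M d\<^esub> g) x) \<epsilon>)"
      unfolding y_def by blast
  qed
qed auto

text \<open>For each finite set \<open>P\<close> of pairs from a countable dense set and each
  \<open>k\<close>, one isometry realising \<open>P\<close> up to \<open>1 / Suc k\<close> is chosen
  whenever there is one. These countably many choices meet every basic neighbourhood.\<close>

lemma separable_space_Iso:
  assumes "separable_space mtopology"
  shows "separable_space (Iso_topology M d)"
proof -
  obtain D where D: "countable D" "D \<subseteq> M" "mtopology closure_of D = M"
    using assms by (auto simp: separable_space_def)
  have near: "\<exists>y\<in>D. d x y < r" if "x \<in> M" "r > 0" for x r
    using that D(3) unfolding metric_closure_of by (force simp: in_mball)
  define N where "N P k = {f \<in> carrier (Iso M d). \<forall>(x, y)\<in>P. d (f x) y < 1 / Suc k}" for P k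
  define \<S> where "\<S> = {P. finite P \<and> P \<subseteq> D \<times> D}"
  define C where "C = (\<lambda>(P, k). SOME f. f \<in> N P k) ` {(P, k) \<in> \<S> \<times> UNIV. N P k \<noteq> {}}"
  have "countable (\<S> \<times> (UNIV :: nat set))"
    unfolding \<S>_def using D(1) by (intro countable_SIGMA countable_Collect_finite_subset) auto
  then have "countable C"
    unfolding C_def by (rule countable_image[OF countable_subset, rotated]) auto
  moreover have sub: "C \<subseteq> carrier (Iso M d)"
  proof -
    have "(SOME f. f \<in> N P k) \<in> N P k" if "N P k \<noteq> {}" for P k
      using that by (metis some_in_eq)
    then show ?thesis unfolding C_def by (auto simp: N_def)
  qed
  moreover have "(Iso_topology M d) closure_of C = carrier (Iso M d)"
  proof -
    have "C \<inter> U \<noteq> {}" if U: "openin (Iso_topology M d) U" "U \<noteq> {}" for U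
    proof -
      obtain f where f: "f \<in> U" using U by blast
      then have fG: "f \<in> carrier (Iso M d)" using openin_subset[OF U(1)] by auto
      obtain F \<epsilon> where F: "finite F" "F \<subseteq> M" "\<epsilon> > 0"
        "\<And>g. g \<in> carrier (Iso M d) \<Longrightarrow> (\<And>x. x \<in> F \<Longrightarrow> d (f x) (g x) < \<epsilon>) \<Longrightarrow> g \<in> U"
        using Iso_nbhd_basic[OF U(1) f] by metis
      \<comment> \<open>Four errors are added: the distance from \<open>x\<close> to
        \<open>u x\<close>, once under each isometry, and the distance from \<open>v x\<close> to
        each of the images of \<open>u x\<close>.\<close>
      obtain k where k: "1 / Suc k < \<epsilon> / 4" using F(3) by (metis nat_approx_posE zero_less_divide_iff zero_less_numeral)
      have k0: "(1 :: real) / Suc k > 0" by simp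
      obtain u where u: "\<And>x. x \<in> F \<Longrightarrow> u x \<in> D \<and> d x (u x) < 1 / Suc k"
        using near[OF _ k0] F(2) by (metis subsetD)
      have "\<exists>y\<in>D. d (f (u x)) y < 1 / Suc k" if "x \<in> F" for x
        using near[OF _ k0, of "f (u x)"] u[OF that] fG D(2) by auto
      then obtain v where v: "\<And>x. x \<in> F \<Longrightarrow> v x \<in> D \<and> d (f (u x)) (v x) < 1 / Suc k"
        by metis
      define P where "P = (\<lambda>x. (u x, v x)) ` F"
      have "f \<in> N P k" using fG v by (auto simp: N_def P_def)
      moreover have "P \<in> \<S>" using F(1) u v by (auto simp: P_def \<S>_def)
      moreover define g where "g = (SOME f. f \<in> N P k)"
      ultimately have "g \<in> N P k" "(P, k) \<in> {(P, k) \<in> \<S> \<times> UNIV. N P k \<noteq> {}}"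
        by (auto intro: someI[of _ f])
      then have g: "g \<in> N P k" "g \<in> C"
        unfolding C_def g_def by (auto intro!: image_eqI[where x = "(P, k)"])
      have gG: "g \<in> carrier (Iso M d)" using g(1) by (simp add: N_def)
      have "d (f x) (g x) < \<epsilon>" if x: "x \<in> F" for x
      proof -
        have M: "x \<in> M" "u x \<in> M" "v x \<in> M" using x F(2) u v D(2) by auto
        have 1: "d (g (u x)) (v x) < 1 / Suc k" using g(1) x by (auto simp: N_def P_def)
        have 2: "d (f x) (f (u x)) < 1 / Suc k" "d (g x) (g (u x)) < 1 / Suc k"
          using fG gG M u[OF x] by auto
        have "d (f x) (g x) \<le> d (f x) (f (u x)) + d (f (u x)) (g x)"
          using fG gG M by (intro triangle) auto
        also have "d (f (u x)) (g x) \<le> d (f (u x)) (v x) + d (v x) (g x)"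
          using fG gG M by (intro triangle) auto
        also have "d (v x) (g x) \<le> d (v x) (g (u x)) + d (g (u x)) (g x)"
          using fG gG M by (intro triangle) auto
        finally show ?thesis
          using 1 2 v[OF x] k commute[of "v x" "g (u x)"] commute[of "g (u x)" "g x"] by linarith
      qed
      then have "g \<in> U" using F(4) gG by blast
      with g(2) show ?thesis by blast
    qed
    then show ?thesis
      using dense_intersects_open[of "Iso_topology M d" C] by simp
  qed
  ultimately show ?thesis unfolding separable_space_def by auto
qed

section \<open>Complete metrizability of the isometry group\<close>

lemma isometric_extension_from_dense:
  assumes "mcomplete" "D \<subseteq> M" "mtopology closure_of D = M"
    and f: "\<And>x. x \<in> D \<Longrightarrow> f x \<in> M" "\<And>x y. x \<in> D \<Longrightarrow> y \<in> D \<Longrightarrow> d (f x) (f y) = d x y"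
  obtains g where "continuous_map mtopology mtopology g" "\<And>x. x \<in> D \<Longrightarrow> g x = f x"
proof -
  have "Lipschitz_continuous_map (submetric (metric (M, d)) D) (metric (M, d)) f"
    unfolding Lipschitz_continuous_map_def using f assms(2) by (auto intro!: exI[of _ 1])
  then obtain g where g: "Lipschitz_continuous_map
      (submetric (metric (M, d)) (mtopology_of (metric (M, d)) closure_of D)) (metric (M, d)) g"
    "\<And>x. x \<in> D \<Longrightarrow> g x = f x"
    using Lipschitz_continuous_map_extends_to_closure_of[of "metric (M, d)" "metric (M, d)" D f] assms(1)
    by auto
  have "mtopology_of (metric (M, d)) closure_of D = mspace (metric (M, d))"
    using assms(3) by simp
  then have "continuous_map mtopology mtopology g"
    using Lipschitz_continuous_imp_continuous_map[OF g(1)] by (simp add: mtopology_of_submetric assms(3))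
  with g(2) show thesis by (rule that[rotated])
qed

lemma continuous_map_dist:
  assumes "continuous_map X mtopology f" "continuous_map X mtopology g"
  shows "continuous_map X euclideanreal (\<lambda>x. d (f x) (g x))"
  using continuous_map_mdist[of X "metric (M, d)" f g] assms by simp

text \<open>Both sides are continuous in each variable, so the identity is extended one variable at
  a time. Four independent maps are allowed in order to cover both preservation of distances and the
  adjunction between a map and its inverse.\<close>

lemma dist_eq_on_dense:
  assumes D: "D \<subseteq> M" "mtopology closure_of D = M"
    and c: "continuous_map mtopology mtopology f1" "continuous_map mtopology mtopology f2"
      "continuous_map mtopology mtopology g1" "continuous_map mtopology mtopology g2"
    and eq: "\<And>x y. x \<in> D \<Longrightarrow> y \<in> D \<Longrightarrow> d (f1 x) (f2 y) = d (g1 x) (g2 y)"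
    and M: "x \<in> M" "y \<in> M"
  shows "d (f1 x) (f2 y) = d (g1 x) (g2 y)"
proof -
  have cl: "h z \<in> M" if "continuous_map mtopology mtopology h" "z \<in> M" for h z
    using that continuous_map_image_subset_topspace by fastforce
  have const: "continuous_map mtopology mtopology (\<lambda>_. z)" if "z \<in> M" for z
    using that by simp
  have 1: "d (f1 x) (f2 z) = d (g1 x) (g2 z)" if "z \<in> D" for z
  proof (rule forall_in_closure_of_eq[of x mtopology D euclideanreal "\<lambda>x. d (f1 x) (f2 z)"])
    have "z \<in> M" using that D(1) by blast
    then show "continuous_map mtopology euclideanreal (\<lambda>x. d (f1 x) (f2 z))"
      "continuous_map mtopology euclideanreal (\<lambda>x. d (g1 x) (g2 z))"
      using continuous_map_dist[OF c(1) const[OF cl[OF c(2)]]]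
        continuous_map_dist[OF c(3) const[OF cl[OF c(4)]]] by simp_all
  qed (use D M eq that in auto)
  show ?thesis
  proof (rule forall_in_closure_of_eq[of y mtopology D euclideanreal "\<lambda>y. d (f1 x) (f2 y)"])
    show "continuous_map mtopology euclideanreal (\<lambda>y. d (f1 x) (f2 y))"
      "continuous_map mtopology euclideanreal (\<lambda>y. d (g1 x) (g2 y))"
      using continuous_map_dist[OF const[OF cl[OF c(1) M(1)]] c(2)]
        continuous_map_dist[OF const[OF cl[OF c(3) M(1)]] c(4)] by simp_all
  qed (use D M 1 in auto)
qed

text \<open>With \<open>f'\<close> restricted from \<open>g\<^sup>-\<^sup>1\<close>, the pair \<open>(f, f')\<close> of restrictions of an isometry \<open>g\<close> and its
  inverse to a dense set is characterised by closed conditions.\<close>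

lemma isometry_from_dense_pair:
  assumes "mcomplete" and D: "D \<subseteq> M" "mtopology closure_of D = M"
    and f: "f \<in> D \<rightarrow>\<^sub>E M" "\<And>x y. x \<in> D \<Longrightarrow> y \<in> D \<Longrightarrow> d (f x) (f y) = d x y"
    and f': "f' \<in> D \<rightarrow>\<^sub>E M" "\<And>x y. x \<in> D \<Longrightarrow> y \<in> D \<Longrightarrow> d (f' x) (f' y) = d x y"
    and inv: "\<And>x y. x \<in> D \<Longrightarrow> y \<in> D \<Longrightarrow> d (f x) y = d x (f' y)"
  shows "\<exists>g\<in>carrier (Iso M d). restrict g D = f \<and> restrict (inv\<^bsub>Iso M d\<^esub> g) D = f'"
proof -
  obtain F where F: "continuous_map mtopology mtopology F" "\<And>x. x \<in> D \<Longrightarrow> F x = f x"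
    using isometric_extension_from_dense[OF assms(1) D, of f] f by (auto simp: PiE_iff)
  obtain F' where F': "continuous_map mtopology mtopology F'" "\<And>x. x \<in> D \<Longrightarrow> F' x = f' x"
    using isometric_extension_from_dense[OF assms(1) D, of f'] f' by (auto simp: PiE_iff)
  have id: "continuous_map mtopology mtopology (\<lambda>x. x)" by simp
  have cl: "F x \<in> M" "F' x \<in> M" if "x \<in> M" for x
    using F(1) F'(1) that continuous_map_image_subset_topspace by fastforce+
  have iso: "d (F x) (F y) = d x y" if "x \<in> M" "y \<in> M" for x y
    using dist_eq_on_dense[OF D F(1) F(1) id id _ that] F f by simp
  have adj: "d (F x) y = d x (F' y)" if "x \<in> M" "y \<in> M" for x y
    using dist_eq_on_dense[OF D F(1) id id F'(1) _ that] F F' inv by simp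
  \<comment> \<open>At the first argument \<open>F' y\<close> the right side of the adjunction is
    \<open>0\<close>; thus \<open>F'\<close> is a right inverse of \<open>F\<close>, which provides
    surjectivity.\<close>
  have FF': "F (F' y) = y" if "y \<in> M" for y
    using adj[of "F' y" y] that cl by simp
  define g where "g = restrict F M"
  have g: "g \<in> carrier (Iso M d)"
    by (rule Iso_memI[of _ F']) (auto simp: g_def cl FF' iso)
  have "(inv\<^bsub>Iso M d\<^esub> g) x = F' x" if "x \<in> M" for x
  proof -
    have "(inv\<^bsub>Iso M d\<^esub> g) (g (F' x)) = F' x" using g that cl by simp
    then show ?thesis using that cl FF' by (simp add: g_def)
  qed
  then have "restrict (inv\<^bsub>Iso M d\<^esub> g) D = f'"
    using D(1) F'(2) f'(1) by (intro extensionalityI[of _ D]) (auto simp: PiE_def)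
  moreover have "restrict g D = f"
    using D(1) F(2) f(1) by (intro extensionalityI[of _ D]) (auto simp: g_def PiE_def)
  ultimately show ?thesis using g by blast
qed

text \<open>A pointwise limit of bijective isometries need not be onto, so restriction to a dense
  set alone may fail to have a closed image. Recording the inverse as well makes the group
  homeomorphic to a closed subspace of a countable product of copies of \<open>M\<close>.\<close>

lemma completely_metrizable_space_Iso:
  assumes "mcomplete" "separable_space mtopology"
  shows "completely_metrizable_space (Iso_topology M d)"
proof -
  obtain D where D: "countable D" "D \<subseteq> M" "mtopology closure_of D = M"
    using assms(2) by (auto simp: separable_space_def)
  define P where "P = product_topology (\<lambda>_. mtopology) D"
  define Z where "Z = prod_topology P P"
  have "countable {x \<in> D. Q x}" for Q using D(1) by (rule countable_subset[rotated]) auto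
  then have "completely_metrizable_space P"
    unfolding P_def completely_metrizable_space_product_topology
    using assms(1) completely_metrizable_space_mtopology by auto
  then have Z: "completely_metrizable_space Z"
    by (simp add: Z_def completely_metrizable_space_prod_topology)
  have Ztop: "topspace Z = (D \<rightarrow>\<^sub>E M) \<times> (D \<rightarrow>\<^sub>E M)" by (simp add: Z_def P_def)
  have proj: "continuous_map Z mtopology (\<lambda>z. fst z x)" "continuous_map Z mtopology (\<lambda>z. snd z x)"
    if "x \<in> D" for x
  proof -
    have "continuous_map P mtopology (\<lambda>f. f x)"
      unfolding P_def by (rule continuous_map_product_projection[OF that])
    from continuous_map_compose[OF continuous_map_fst this] continuous_map_compose[OF continuous_map_snd this]
    show "continuous_map Z mtopology (\<lambda>z. fst z x)" "continuous_map Z mtopology (\<lambda>z. snd z x)"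
      by (auto simp: Z_def o_def)
  qed
  define S where "S x y = {z \<in> topspace Z. d (fst z x) (fst z y) = d x y} \<inter>
      {z \<in> topspace Z. d (snd z x) (snd z y) = d x y} \<inter>
      {z \<in> topspace Z. d (fst z x) y = d x (snd z y)}" for x y
  define C where "C = topspace Z \<inter> (\<Inter>x\<in>D. \<Inter>y\<in>D. S x y)"
  have "closedin Z (S x y)" if "x \<in> D" "y \<in> D" for x y
  proof -
    have "x \<in> M" "y \<in> M" using that D by auto
    then show ?thesis
      unfolding S_def
      by (intro closedin_Int closedin_continuous_maps_eq[OF Hausdorff_space_euclidean]
          continuous_map_dist proj that) auto
  qed
  then have C: "closedin Z C"
    unfolding C_def
    by (cases "D = {}") (auto intro!: closedin_Int closedin_INT)
  define e where "e g = (restrict g D, restrict (inv\<^bsub>Iso M d\<^esub> g) D)" for g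
  have eC: "e g \<in> C" if g: "g \<in> carrier (Iso M d)" for g
  proof -
    have "d (g x) y = d x ((inv\<^bsub>Iso M d\<^esub> g) y)" if "x \<in> M" "y \<in> M" for x y
      using Iso_dist[OF g, of x "(inv\<^bsub>Iso M d\<^esub> g) y"] that g by simp
    then show ?thesis
      using g D(2) unfolding C_def S_def Ztop e_def
      by (auto simp: subset_iff)
  qed
  have surj: "\<exists>g\<in>carrier (Iso M d). e g = z" if "z \<in> C" for z
  proof -
    obtain f f' where z: "z = (f, f')" by (cases z)
    show ?thesis
      using isometry_from_dense_pair[OF assms(1) D(2,3), of f f'] that
      unfolding C_def S_def Ztop e_def z by auto
  qed
  define r where "r z = (SOME g. g \<in> carrier (Iso M d) \<and> e g = z)" for z
  have r: "r z \<in> carrier (Iso M d) \<and> e (r z) = z" if "z \<in> C" for z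
    unfolding r_def
    by (rule someI_ex[of "\<lambda>g. g \<in> carrier (Iso M d) \<and> e g = z"]) (use surj[OF that] in blast)
  have near: "\<exists>y\<in>D. d x y < s" if "x \<in> M" "s > 0" for x s
    using that D(3) unfolding metric_closure_of by (force simp: in_mball)
  \<comment> \<open>Both isometries preserve the distance from \<open>x\<close> to a nearby
    \<open>y\<close> in \<open>D\<close>, so their values at \<open>x\<close> are controlled by
    those at \<open>y\<close>. This gives continuity of the reconstruction \<open>r\<close>.\<close>
  have dist_r: "d (r z x) (r w x) \<le> d (fst z y) (fst w y) + 2 * d x y"
    if "z \<in> C" "w \<in> C" "x \<in> M" "y \<in> D" for z w x y
  proof -
    have rz: "r z \<in> carrier (Iso M d)" "r w \<in> carrier (Iso M d)" and y: "y \<in> M"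
      using r that D by auto
    have "fst z = restrict (r z) D" "fst w = restrict (r w) D"
      using r[OF that(1)] r[OF that(2)] by (metis e_def fst_conv)+
    then have 1: "fst z y = r z y" "fst w y = r w y" using that by auto
    have "d (r z x) (r w x) \<le> d (r z x) (r z y) + d (r z y) (r w x)"
      using rz y that by (intro triangle) auto
    also have "d (r z y) (r w x) \<le> d (r z y) (r w y) + d (r w y) (r w x)"
      using rz y that by (intro triangle) auto
    finally show ?thesis using 1 rz y that by (simp add: commute)
  qed
  have inj: "r (e g) = g" if g: "g \<in> carrier (Iso M d)" for g
  proof (rule Iso_eqI)
    note rg = r[OF eC[OF g]]
    show "r (e g) \<in> carrier (Iso M d)" using rg by blast
    fix x assume x: "x \<in> M"
    have "restrict (r (e g)) D = restrict g D" using rg by (simp add: e_def)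
    then have eq: "r (e g) y = g y" if "y \<in> D" for y using that by (metis restrict_apply')
    have "d (r (e g) x) (g x) < s" if s: "s > 0" for s
    proof -
      obtain y where y: "y \<in> D" "d x y < s / 2" using near[OF x, of "s / 2"] s by auto
      have "d (r (e g) x) (g x) \<le> d (r (e g) x) (r (e g) y) + d (r (e g) y) (g x)"
        using rg g x y D(2) by (intro triangle) auto
      also have "\<dots> = d x y + d y x"
        using Iso_dist[of "r (e g)" x y] eq[OF y(1)] y rg g x D(2) by auto
      finally show ?thesis using y by (simp add: commute)
    qed
    then have "\<not> d (r (e g) x) (g x) > 0" by blast
    then show "r (e g) x = g x" using rg g x by (auto simp: order_less_le)
  qed (rule g)
  have "homeomorphic_maps (Iso_topology M d) (subtopology Z C) e r"
    unfolding homeomorphic_maps_def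
  proof (intro conjI ballI)
    have "continuous_map (Iso_topology M d) mtopology (\<lambda>g. (inv\<^bsub>Iso M d\<^esub> g) x)" if "x \<in> D" for x
      using continuous_map_compose[OF continuous_map_Iso_inv continuous_map_Iso_eval[of x]] that D(2)
      by (auto simp: o_def)
    moreover have "continuous_map (Iso_topology M d) mtopology (\<lambda>g. g x)" if "x \<in> D" for x
      using that D(2) by (intro continuous_map_Iso_eval) auto
    ultimately have "continuous_map (Iso_topology M d) Z e"
      unfolding Z_def P_def e_def
      by (simp add: continuous_map_pairwise o_def continuous_map_componentwise image_subset_iff)
    then show "continuous_map (Iso_topology M d) (subtopology Z C) e"
      using eC by (auto simp: continuous_map_in_subtopology)
    show "continuous_map (subtopology Z C) (Iso_topology M d) r"
    proof (rule continuous_map_into_Iso)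
      show "r z \<in> carrier (Iso M d)" if "z \<in> topspace (subtopology Z C)" for z
        using r that by simp
      fix x assume x: "x \<in> M"
      show "continuous_map (subtopology Z C) mtopology (\<lambda>z. r z x)"
        unfolding continuous_map_to_metric
      proof (intro ballI allI impI)
        fix z and \<epsilon> :: real assume "z \<in> topspace (subtopology Z C)" and \<epsilon>: "\<epsilon> > 0"
        then have z: "z \<in> C" "z \<in> topspace Z" by auto
        obtain y where y: "y \<in> D" "d x y < \<epsilon> / 4" using near[OF x, of "\<epsilon> / 4"] \<epsilon> by auto
        have zy: "fst z y \<in> M" using z y by (auto simp: Ztop)
        let ?U = "{w \<in> topspace Z. fst w y \<in> mball (fst z y) (\<epsilon> / 2)}"
        have "openin Z ?U"
          by (rule openin_continuous_map_preimage[OF proj(1)[OF y(1)]]) simp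
        then have "openin (subtopology Z C) (C \<inter> ?U)" by (rule openin_subtopology_Int2)
        moreover have "z \<in> C \<inter> ?U" using z zy \<epsilon> by simp
        moreover have "r w x \<in> mball (r z x) \<epsilon>" if "w \<in> C \<inter> ?U" for w
          using dist_r[OF z(1) _ x y(1), of w] that y r[OF z(1)] r[of w] x by auto
        ultimately show "\<exists>U. openin (subtopology Z C) U \<and> z \<in> U \<and> (\<forall>w\<in>U. r w x \<in> mball (r z x) \<epsilon>)"
          by blast
      qed
    qed
  qed (use inj r in auto)
  then have "Iso_topology M d homeomorphic_space subtopology Z C"
    by (auto simp: homeomorphic_space_def)
  then show ?thesis
    using completely_metrizable_space_closedin[OF Z C] homeomorphic_completely_metrizable_space by blast
qed

theorem Polish_group_Iso:
  assumes "mcomplete" "separable_space mtopology"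
  shows "Polish_group (Iso M d) (Iso_topology M d)"
  unfolding Polish_group_def
  using assms group_Iso continuous_map_Iso_mult continuous_map_Iso_inv separable_space_Iso
    completely_metrizable_space_Iso by simp

end

section \<open>Distances in ultrametric Urysohn spaces\<close>

context
  fixes R :: "real set"
  assumes R: "R \<subseteq> {0<..}"
begin

lemma urysohn_dist_nonneg: "0 \<le> urysohn_dist R x y"
  using Metric_space.nonneg[OF Metric_space_urysohn[OF R]] .

text \<open>The maximum is attained at a coordinate in \<open>R\<close>, so comparing a distance
  with a threshold means comparing coordinates from the threshold upwards.\<close>

lemma urysohn_dist_less_iff:
  assumes x: "x \<in> urysohn R" and y: "y \<in> urysohn R" and s: "s > 0"
  shows "urysohn_dist R x y < s \<longleftrightarrow> (\<forall>r\<in>R. s \<le> r \<longrightarrow> x r = y r)"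
proof (cases "x = y")
  case True
  then show ?thesis using s by (simp add: urysohn_dist_def)
next
  case False
  note m = urysohn_dist_max[OF R x y False]
  show ?thesis using m(1,2) m(3) by (meson leD le_less_trans not_le)
qed

lemma urysohn_dist_le_iff:
  assumes x: "x \<in> urysohn R" and y: "y \<in> urysohn R" and s: "s \<ge> 0"
  shows "urysohn_dist R x y \<le> s \<longleftrightarrow> (\<forall>r\<in>R. s < r \<longrightarrow> x r = y r)"
proof (cases "x = y")
  case True
  then show ?thesis using s by (simp add: urysohn_dist_def)
next
  case False
  note m = urysohn_dist_max[OF R x y False]
  show ?thesis using m(1,2) m(3) by (meson leD le_less_trans not_le)
qed

lemma urysohn_dist_ultra:
  assumes x: "x \<in> urysohn R" and y: "y \<in> urysohn R" and z: "z \<in> urysohn R"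
  shows "urysohn_dist R x z \<le> max (urysohn_dist R x y) (urysohn_dist R y z)"
proof -
  let ?m = "max (urysohn_dist R x y) (urysohn_dist R y z)"
  have "?m \<ge> 0" using urysohn_dist_nonneg[of x y] by linarith
  then show ?thesis
    using urysohn_dist_le_iff[OF x y, of ?m] urysohn_dist_le_iff[OF y z, of ?m] urysohn_dist_le_iff[OF x z, of ?m]
    by simp
qed

lemma urysohn_update:
  assumes x: "x \<in> urysohn R" and r: "r \<in> R"
  shows "x(r := v) \<in> urysohn R"
proof -
  have "finite {r' \<in> R. r' > s \<and> (x(r := v)) r' \<noteq> 0}" if "s > 0" for s
  proof (rule finite_subset)
    show "{r' \<in> R. r' > s \<and> (x(r := v)) r' \<noteq> 0} \<subseteq> insert r {r' \<in> R. r' > s \<and> x r' \<noteq> 0}" by auto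
    show "finite (insert r {r' \<in> R. r' > s \<and> x r' \<noteq> 0})" using x that by (simp add: urysohn_def)
  qed
  then show ?thesis using x r by (auto simp: urysohn_def PiE_def extensional_def)
qed

text \<open>Coordinates of \<open>y\<close> above \<open>r\<close> are untouched, coordinate
  \<open>r\<close> now differs from that of \<open>x\<close>, and what happens below
  \<open>r\<close> no longer matters.\<close>

lemma urysohn_dist_update:
  assumes x: "x \<in> urysohn R" and y: "y \<in> urysohn R" and r: "r \<in> R" and v: "x r \<noteq> v"
  shows "urysohn_dist R x (y(r := v)) = max (urysohn_dist R x y) r"
proof (rule antisym)
  have r0: "r > 0" using r R by auto
  note y' = urysohn_update[OF y r, of v]
  have "urysohn_dist R x y \<le> max (urysohn_dist R x y) r" by simp
  then show "urysohn_dist R x (y(r := v)) \<le> max (urysohn_dist R x y) r"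
    using r0 urysohn_dist_le_iff[OF x y, of "max (urysohn_dist R x y) r"]
      urysohn_dist_le_iff[OF x y', of "max (urysohn_dist R x y) r"] by auto
  have "\<not> urysohn_dist R x (y(r := v)) < r"
    using urysohn_dist_less_iff[OF x y' r0] v r by auto
  then have *: "r \<le> urysohn_dist R x (y(r := v))" by simp
  moreover have "urysohn_dist R x y \<le> urysohn_dist R x (y(r := v))"
    using urysohn_dist_le_iff[OF x y urysohn_dist_nonneg[of x "y(r := v)"]]
      urysohn_dist_le_iff[OF x y' urysohn_dist_nonneg[of x "y(r := v)"]] * by auto
  ultimately show "max (urysohn_dist R x y) r \<le> urysohn_dist R x (y(r := v))" by simp
qed

lemma urysohn_dist_eqI:
  assumes "x \<in> urysohn R" "y \<in> urysohn R" "x' \<in> urysohn R" "y' \<in> urysohn R"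
    and "\<And>s. s \<ge> 0 \<Longrightarrow> urysohn_dist R x y \<le> s \<longleftrightarrow> urysohn_dist R x' y' \<le> s"
  shows "urysohn_dist R x y = urysohn_dist R x' y'"
  using assms(5)[of "urysohn_dist R x y"] assms(5)[of "urysohn_dist R x' y'"] urysohn_dist_nonneg
  by (simp add: antisym)

lemma urysohn_dist_shift:
  assumes x: "x \<in> urysohn R" and y: "y \<in> urysohn R" and r: "r \<in> R"
  shows "urysohn_dist R (x(r := x r + c)) (y(r := y r + c)) = urysohn_dist R x y"
proof (rule urysohn_dist_eqI)
  show "(urysohn_dist R (x(r := x r + c)) (y(r := y r + c)) \<le> s) = (urysohn_dist R x y \<le> s)" if "s \<ge> 0" for s
    unfolding urysohn_dist_le_iff[OF x y that]
      urysohn_dist_le_iff[OF urysohn_update[OF x r] urysohn_update[OF y r] that] by auto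
qed (use assms urysohn_update in auto)

end

text \<open>Domain and range of a finite partial injection have complements of equal size in
  \<open>S\<close>.\<close>

lemma permutes_extension:
  assumes "finite S" "A \<subseteq> S" "inj_on f A" "f ` A \<subseteq> S"
  obtains p where "p permutes S" "\<And>a. a \<in> A \<Longrightarrow> p a = f a"
proof -
  have "card (S - A) = card (S - f ` A)"
    using assms by (simp add: card_Diff_subset card_image finite_subset)
  then obtain h where h: "bij_betw h (S - A) (S - f ` A)"
    using assms(1) finite_same_card_bij[of "S - A" "S - f ` A"] by auto
  define p where "p x = (if x \<in> A then f x else if x \<in> S then h x else x)" for x
  have "bij_betw p A (f ` A)"
    using assms(3) by (intro bij_betw_imageI) (auto simp: p_def inj_on_def)
  moreover have "bij_betw p (S - A) (S - f ` A)"
    using h by (rule bij_betw_cong[THEN iffD1, rotated]) (auto simp: p_def)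
  ultimately have "bij_betw p (A \<union> (S - A)) (f ` A \<union> (S - f ` A))"
    by (rule bij_betw_combine) auto
  then have "bij_betw p S S" using assms by (simp add: Un_absorb1 Un_Diff_cancel)
  then have "p permutes S" using assms(2) by (intro bij_imp_permutes) (auto simp: p_def)
  then show thesis by (rule that) (simp add: p_def)
qed

section \<open>Spaces with coordinates in an initial segment, finite boxes and truncation\<close>

locale urysohn_values =
  fixes R :: "real set" and V :: "nat set"
  assumes countable_R: "countable R" and R_pos: "R \<subseteq> {0<..}"
    and zero_V: "0 \<in> V" and V_down: "\<And>m n. n \<in> V \<Longrightarrow> m < n \<Longrightarrow> m \<in> V"
begin

text \<open>\<open>V = UNIV\<close> gives the full space and \<open>V = {..<n}\<close> the space
  with \<open>n\<close> values. As \<open>V\<close> is closed downwards, any finite set of occurring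
  values lies in some \<open>{..<N}\<close> inside \<open>V\<close>.\<close>

definition M :: "(real \<Rightarrow> nat) set" where "M = {x \<in> urysohn R. \<forall>r\<in>R. x r \<in> V}"

abbreviation dist_R :: "(real \<Rightarrow> nat) \<Rightarrow> (real \<Rightarrow> nat) \<Rightarrow> real" ("\<delta>")
  where "\<delta> \<equiv> urysohn_dist R"

abbreviation G :: "((real \<Rightarrow> nat) \<Rightarrow> (real \<Rightarrow> nat)) monoid" where "G \<equiv> Iso M \<delta>"

lemma M_urysohn: "x \<in> M \<Longrightarrow> x \<in> urysohn R" by (simp add: M_def)

sublocale Metric_space M \<delta>
  by (intro Metric_space.subspace[OF Metric_space_urysohn[OF R_pos]]) (auto simp: M_def)

lemmas dist_less_iff = urysohn_dist_less_iff[OF R_pos M_urysohn M_urysohn]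
  and dist_le_iff = urysohn_dist_le_iff[OF R_pos M_urysohn M_urysohn]
  and dist_ultra = urysohn_dist_ultra[OF R_pos M_urysohn M_urysohn M_urysohn]

lemma ultra_less: "\<delta> x y < r \<Longrightarrow> \<delta> y z < r \<Longrightarrow> x \<in> M \<Longrightarrow> y \<in> M \<Longrightarrow> z \<in> M \<Longrightarrow> \<delta> x z < r"
  using dist_ultra[of x y z] by linarith

lemma ultra_le: "\<delta> x y \<le> r \<Longrightarrow> \<delta> y z \<le> r \<Longrightarrow> x \<in> M \<Longrightarrow> y \<in> M \<Longrightarrow> z \<in> M \<Longrightarrow> \<delta> x z \<le> r"
  using dist_ultra[of x y z] by linarith

text \<open>For finite \<open>T\<close> inside \<open>R\<close> and \<open>{..<N}\<close> inside
  \<open>V\<close> this is a finite copy of the \<open>N\<close>-Urysohn space over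
  \<open>T\<close>; its nonzero distances lie in \<open>T\<close>.\<close>

definition box :: "real set \<Rightarrow> nat \<Rightarrow> (real \<Rightarrow> nat) set" where
  "box T N = {x \<in> M. (\<forall>r\<in>T. x r < N) \<and> (\<forall>r\<in>R - T. x r = 0)}"

lemma box_M: "x \<in> box T N \<Longrightarrow> x \<in> M" by (simp add: box_def)

lemma box_mono:
  assumes "T \<subseteq> T'" "N \<le> N'" "T' \<subseteq> R" "N > 0"
  shows "box T N \<subseteq> box T' N'"
proof
  fix x assume x: "x \<in> box T N"
  have "x r < N'" if "r \<in> T'" for r
  proof (cases "r \<in> T")
    case True
    then have "x r < N" using x by (simp add: box_def)
    then show ?thesis using assms(2) by simp
  next
    case False
    then have "x r = 0" using x that assms(3) by (auto simp: box_def)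
    then show ?thesis using assms by simp
  qed
  then show "x \<in> box T' N'" using x assms(1) by (auto simp: box_def)
qed

lemma finite_box:
  assumes "finite T" "T \<subseteq> R"
  shows "finite (box T N)"
proof (rule finite_subset)
  show "box T N \<subseteq> (\<lambda>f. \<lambda>r\<in>R. if r \<in> T then f r else 0) ` (T \<rightarrow>\<^sub>E {..<N})"
  proof
    fix x assume x: "x \<in> box T N"
    then have "x = (\<lambda>r\<in>R. if r \<in> T then restrict x T r else 0)"
      by (intro extensionalityI[of _ R]) (auto simp: box_def M_def urysohn_def PiE_def)
    moreover have "restrict x T \<in> T \<rightarrow>\<^sub>E {..<N}" using x by (auto simp: box_def)
    ultimately show "x \<in> (\<lambda>f. \<lambda>r\<in>R. if r \<in> T then f r else 0) ` (T \<rightarrow>\<^sub>E {..<N})" by blast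
  qed
  show "finite ((\<lambda>f. \<lambda>r\<in>R. if r \<in> T then f r else 0) ` (T \<rightarrow>\<^sub>E {..<N}))"
    using assms by (intro finite_imageI finite_PiE) auto
qed

lemma box_dist_in:
  assumes "x \<in> box T N" "y \<in> box T N"
  shows "\<delta> x y \<in> insert 0 T"
proof (cases "x = y")
  case True
  then show ?thesis by (simp add: urysohn_dist_def)
next
  case False
  then show ?thesis
    using urysohn_dist_max(1,2)[OF R_pos _ _ False] assms by (auto simp: box_def M_def)
qed

definition trunc :: "real \<Rightarrow> (real \<Rightarrow> nat) \<Rightarrow> (real \<Rightarrow> nat)" where
  "trunc \<epsilon> x = (\<lambda>r\<in>R. if \<epsilon> \<le> r then x r else 0)"

lemma finite_support_above:
  assumes "x \<in> M" "\<epsilon> > 0"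
  shows "finite {r \<in> R. \<epsilon> \<le> r \<and> x r \<noteq> 0}"
proof (rule finite_subset)
  have "\<forall>s>0. finite {r \<in> R. r > s \<and> x r \<noteq> 0}"
    using assms(1) unfolding M_def urysohn_def by blast
  then show "finite {r \<in> R. r > \<epsilon> / 2 \<and> x r \<noteq> 0}" using assms(2) half_gt_zero by blast
qed (use assms(2) in auto)

lemma trunc_M:
  assumes "x \<in> M" "\<epsilon> > 0"
  shows "trunc \<epsilon> x \<in> M"
proof -
  have "finite {r' \<in> R. s < r' \<and> trunc \<epsilon> x r' \<noteq> 0}" for s
    by (rule finite_subset[OF _ finite_support_above[OF assms]]) (auto simp: trunc_def)
  then show ?thesis using assms zero_V by (auto simp: M_def urysohn_def trunc_def)
qed

lemma dist_trunc: "x \<in> M \<Longrightarrow> \<epsilon> > 0 \<Longrightarrow> \<delta> x (trunc \<epsilon> x) < \<epsilon>"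
  by (subst dist_less_iff) (auto simp: trunc_M, auto simp: trunc_def)

text \<open>Truncation keeps distances of at least \<open>\<epsilon>\<close> and turns smaller ones
  into \<open>0\<close>, so the new distance is a function of the old one. Hence a partial isometry
  survives truncation of all its points.\<close>

lemma dist_trunc_eq:
  assumes "x \<in> M" "y \<in> M" "x' \<in> M" "y' \<in> M" "\<epsilon> > 0" "\<delta> x y = \<delta> x' y'"
  shows "\<delta> (trunc \<epsilon> x) (trunc \<epsilon> y) = \<delta> (trunc \<epsilon> x') (trunc \<epsilon> y')"
proof (rule urysohn_dist_eqI[OF R_pos])
  have *: "\<delta> (trunc \<epsilon> x) (trunc \<epsilon> y) \<le> s \<longleftrightarrow> (if \<epsilon> \<le> s then \<delta> x y \<le> s else (\<delta> x y < \<epsilon> \<or> \<delta> x y \<le> s))"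
    if "x \<in> M" "y \<in> M" "s \<ge> 0" for x y s
  proof -
    have "\<delta> (trunc \<epsilon> x) (trunc \<epsilon> y) \<le> s \<longleftrightarrow> (\<forall>r\<in>R. s < r \<and> \<epsilon> \<le> r \<longrightarrow> x r = y r)"
      using that assms(5) by (subst dist_le_iff) (auto simp: trunc_M, auto simp: trunc_def)
    then show ?thesis
      using that assms(5) by (auto simp: dist_le_iff dist_less_iff)
  qed
  show "(\<delta> (trunc \<epsilon> x) (trunc \<epsilon> y) \<le> s) = (\<delta> (trunc \<epsilon> x') (trunc \<epsilon> y') \<le> s)" if "s \<ge> 0" for s
    using * assms that by auto
qed (use assms trunc_M M_urysohn in auto)

text \<open>Membership is stated for all larger boxes because later several families have to be
  placed in a common one.\<close>

lemma trunc_in_some_box: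
  assumes E: "finite E" "E \<subseteq> M" and \<epsilon>: "\<epsilon> > 0"
  obtains T N where "finite T" "T \<subseteq> R" "{..<N} \<subseteq> V" "N > 0"
    "\<And>T' N' x. T \<subseteq> T' \<Longrightarrow> T' \<subseteq> R \<Longrightarrow> N \<le> N' \<Longrightarrow> x \<in> E \<Longrightarrow> trunc \<epsilon> x \<in> box T' N'"
proof -
  define T where "T = (\<Union>x\<in>E. {r \<in> R. \<epsilon> \<le> r \<and> x r \<noteq> 0})"
  define W where "W = insert 0 ((\<lambda>(x, r). x r) ` (E \<times> T))"
  have T: "finite T" "T \<subseteq> R" unfolding T_def using E \<epsilon> finite_support_above by auto
  then have W: "finite W" "W \<noteq> {}" using E by (auto simp: W_def)
  have "W \<subseteq> V" using E T zero_V by (auto simp: W_def M_def)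
  show thesis
  proof (rule that[of T "Suc (Max W)"])
    have "Max W \<in> V" using Max_in[OF W] \<open>W \<subseteq> V\<close> by blast
    then show "{..<Suc (Max W)} \<subseteq> V" using V_down by (auto simp: less_Suc_eq)
    fix T' N' x assume *: "T \<subseteq> T'" "T' \<subseteq> R" "Suc (Max W) \<le> N'" "x \<in> E"
    have xM: "x \<in> M" using * E by auto
    have "trunc \<epsilon> x r < N'" if "r \<in> T'" for r
    proof (cases "r \<in> T")
      case True
      then have "x r \<in> W" using * by (auto simp: W_def)
      then have "x r \<le> Max W" using W by simp
      then show ?thesis using * that by (auto simp: trunc_def)
    next
      case False
      then have "trunc \<epsilon> x r = 0" using * that by (auto simp: trunc_def T_def)
      then show ?thesis using * by simp
    qed
    moreover have "trunc \<epsilon> x r = 0" if "r \<in> R - T'" for r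
      using that * by (auto simp: trunc_def T_def)
    ultimately show "trunc \<epsilon> x \<in> box T' N'"
      using trunc_M[OF xM \<epsilon>] by (auto simp: box_def)
  qed (use T in auto)
qed

lemma separable: "separable_space mtopology"
proof -
  define C where "C = (\<Union>(T, N) \<in> {T. finite T \<and> T \<subseteq> R} \<times> UNIV. box T N)"
  have "countable ({T. finite T \<and> T \<subseteq> R} \<times> (UNIV :: nat set))"
    using countable_R by (intro countable_SIGMA countable_Collect_finite_subset) auto
  then have "countable C"
    unfolding C_def by (rule countable_UN) (auto intro: countable_finite finite_box)
  moreover have "C \<subseteq> M" by (auto simp: C_def box_def)
  moreover have "mtopology closure_of C = M"
  proof -
    have "\<exists>y\<in>C. y \<in> mball x r" if x: "x \<in> M" and r: "r > 0" for x r
    proof -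
      obtain T N where T: "finite T" "T \<subseteq> R"
        "\<And>T' N' y. T \<subseteq> T' \<Longrightarrow> T' \<subseteq> R \<Longrightarrow> N \<le> N' \<Longrightarrow> y \<in> {x} \<Longrightarrow> trunc r y \<in> box T' N'"
        by (rule trunc_in_some_box[of "{x}" r]) (use x r in auto)
      then have "trunc r x \<in> C" using T(1,2) T(3)[of T N x] unfolding C_def by (intro UN_I[of "(T, N)"]) auto
      then show ?thesis using dist_trunc[OF x r] trunc_M[OF x r] x by auto
    qed
    then show ?thesis unfolding metric_closure_of by auto
  qed
  ultimately show ?thesis by (auto simp: separable_space_def)
qed

lemma complete: mcomplete
  unfolding mcomplete_def
proof (intro allI impI)
  fix c assume c: "MCauchy c"
  then have cM: "c n \<in> M" for n unfolding MCauchy_def by auto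
  have "\<forall>s. \<exists>N. s > 0 \<longrightarrow> (\<forall>m n. N \<le> m \<longrightarrow> N \<le> n \<longrightarrow> \<delta> (c m) (c n) < s)"
    using c by (simp add: MCauchy_def)
  then obtain K where "\<forall>s. s > 0 \<longrightarrow> (\<forall>m n. K s \<le> m \<longrightarrow> K s \<le> n \<longrightarrow> \<delta> (c m) (c n) < s)"
    by (rule choice[THEN exE])
  then have K: "\<And>s m n. s > 0 \<Longrightarrow> m \<ge> K s \<Longrightarrow> n \<ge> K s \<Longrightarrow> \<delta> (c m) (c n) < s"
    by simp
  \<comment> \<open>From the term \<open>K r\<close> on, coordinate \<open>r\<close> no longer
    changes, so the limit is read off there coordinate by coordinate.\<close>
  define x where "x = (\<lambda>r\<in>R. c (K r) r)"
  have x: "x r = c n r" if "r \<in> R" "s > 0" "s \<le> r" "n \<ge> K s" for r s n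
  proof -
    let ?m = "max n (max (K s) (K r))"
    have r: "r > 0" using that R_pos by auto
    have "\<delta> (c ?m) (c n) < s" using K that by simp
    then have "c ?m r = c n r" using dist_less_iff[OF cM cM \<open>s > 0\<close>] that by auto
    moreover have "\<delta> (c ?m) (c (K r)) < r" using K r by simp
    then have "c ?m r = c (K r) r" using dist_less_iff[OF cM cM r] that by auto
    ultimately show ?thesis using that by (simp add: x_def)
  qed
  have "finite {r' \<in> R. r' > s \<and> x r' \<noteq> 0}" if "s > 0" for s
  proof (rule finite_subset)
    show "{r' \<in> R. r' > s \<and> x r' \<noteq> 0} \<subseteq> {r' \<in> R. s \<le> r' \<and> c (K s) r' \<noteq> 0}"
      using x[of _ s "K s"] that by auto
  qed (rule finite_support_above[OF cM that])
  moreover have "x r \<in> V" if "r \<in> R" for r using cM that by (auto simp: x_def M_def)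
  ultimately have xM: "x \<in> M" by (auto simp: M_def urysohn_def x_def)
  have "limitin mtopology c x sequentially"
    unfolding limitin_metric
  proof (intro conjI allI impI)
    fix s :: real assume s: "s > 0"
    have "c n \<in> M \<and> \<delta> (c n) x < s" if "n \<ge> K s" for n
      using cM dist_less_iff[OF cM xM s, of n] x[OF _ s _ that] by auto
    then show "\<forall>\<^sub>F n in sequentially. c n \<in> M \<and> \<delta> (c n) x < s"
      unfolding eventually_sequentially by blast
  qed (rule xM)
  then show "\<exists>x. limitin mtopology c x sequentially" by blast
qed

lemma Polish: "Polish_group G (Iso_topology M \<delta>)"
  by (rule Polish_group_Iso[OF complete separable])

subsection \<open>Homogeneity\<close>

text \<open>An isometry may permute the \<open>r\<close>-th coordinate of \<open>x\<close> depending on the coordinates above \<open>r\<close>.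
  To send a family \<open>a\<close> to a family \<open>b\<close> it suffices that the permutation depends on the set of those
  indices \<open>i\<close> for which \<open>a i\<close> agrees with \<open>x\<close> above \<open>r\<close>. The image of \<open>x\<close> has the same index sets
  with respect to \<open>b\<close>, so the inverse has the same form and needs no recursion over \<open>R\<close>, which is not
  well-founded in general.\<close>

definition agree :: "'i set \<Rightarrow> ('i \<Rightarrow> real \<Rightarrow> nat) \<Rightarrow> real \<Rightarrow> (real \<Rightarrow> nat) \<Rightarrow> 'i set" where
  "agree I a r x = {i \<in> I. \<delta> (a i) x \<le> r}"

definition twist :: "'i set \<Rightarrow> ('i \<Rightarrow> real \<Rightarrow> nat) \<Rightarrow> (real \<Rightarrow> 'i set \<Rightarrow> nat \<Rightarrow> nat) \<Rightarrow> (real \<Rightarrow> nat) \<Rightarrow> (real \<Rightarrow> nat)" where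
  "twist I a \<sigma> = (\<lambda>x\<in>M. \<lambda>r\<in>R. \<sigma> r (agree I a r x) (x r))"

text \<open>Only index sets whose members lie pairwise within \<open>r\<close> are constrained,
  since by the ultrametric inequality no others occur as \<open>agree I a r x\<close>. The data are
  symmetric: exchanging \<open>a\<close> with \<open>b\<close> and inverting the permutations gives
  a \<open>twister\<close> again, so facts about \<open>twist\<close> also apply to its
  inverse.\<close>

definition twister :: "real set \<Rightarrow> nat \<Rightarrow> 'i set \<Rightarrow> ('i \<Rightarrow> real \<Rightarrow> nat) \<Rightarrow> ('i \<Rightarrow> real \<Rightarrow> nat) \<Rightarrow>
    (real \<Rightarrow> 'i set \<Rightarrow> nat \<Rightarrow> nat) \<Rightarrow> bool" where
  "twister T N I a b \<sigma> \<longleftrightarrow> finite T \<and> T \<subseteq> R \<and> {..<N} \<subseteq> V \<and> a ` I \<subseteq> box T N \<and> b ` I \<subseteq> box T N \<and>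
     (\<forall>i\<in>I. \<forall>j\<in>I. \<delta> (a i) (a j) = \<delta> (b i) (b j)) \<and>
     (\<forall>r K. \<sigma> r K permutes {..<N}) \<and> (\<forall>r K. r \<notin> T \<longrightarrow> \<sigma> r K = id) \<and>
     (\<forall>r\<in>T. \<forall>K\<subseteq>I. (\<forall>i\<in>K. \<forall>j\<in>K. \<delta> (a i) (a j) \<le> r) \<longrightarrow> (\<forall>i\<in>K. \<sigma> r K (a i r) = b i r))"

lemma twister_inverse:
  assumes "twister T N I a b \<sigma>"
  shows "twister T N I b a (\<lambda>r K. inv_into UNIV (\<sigma> r K))"
proof -
  have "inv_into UNIV (\<sigma> r K) (b i r) = a i r"
    if "r \<in> T" "K \<subseteq> I" "\<forall>i\<in>K. \<forall>j\<in>K. \<delta> (b i) (b j) \<le> r" "i \<in> K" for r K i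
  proof -
    have "\<forall>i\<in>I. \<forall>j\<in>I. \<delta> (a i) (a j) = \<delta> (b i) (b j)"
      using assms by (simp add: twister_def)
    then have "\<forall>i\<in>K. \<forall>j\<in>K. \<delta> (a i) (a j) \<le> r" using that by (simp add: subset_iff)
    then have "\<sigma> r K (a i r) = b i r" using that assms unfolding twister_def by blast
    moreover have "\<sigma> r K permutes {..<N}" using assms by (simp add: twister_def)
    ultimately show ?thesis by (metis permutes_inverses(2))
  qed
  then show ?thesis
    using assms unfolding twister_def by (auto simp: permutes_inv)
qed

context
  fixes T N I and a b :: "'i \<Rightarrow> real \<Rightarrow> nat" and \<sigma>
  assumes tw: "twister T N I a b \<sigma>"
begin

lemma twister_M: "i \<in> I \<Longrightarrow> a i \<in> M" "i \<in> I \<Longrightarrow> b i \<in> M"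
  using tw by (auto simp: twister_def box_def)

lemma twister_permutes: "\<sigma> r K permutes {..<N}"
  using tw by (simp add: twister_def)

lemma twister_maps:
  assumes "r \<in> T" "K \<subseteq> I" "\<And>i j. i \<in> K \<Longrightarrow> j \<in> K \<Longrightarrow> \<delta> (a i) (a j) \<le> r" "i \<in> K"
  shows "\<sigma> r K (a i r) = b i r"
  using tw assms by (simp add: twister_def)

lemma twister_V:
  assumes "v \<in> V"
  shows "\<sigma> r K v \<in> V"
proof (cases "v < N")
  case True
  then have "\<sigma> r K v \<in> {..<N}" using permutes_in_image[OF twister_permutes] by blast
  then show ?thesis using tw by (auto simp: twister_def)
next
  case False
  then show ?thesis using permutes_not_in[OF twister_permutes, of v] assms by simp
qed

lemma twister_inj: "\<sigma> r K u = \<sigma> r K v \<longleftrightarrow> u = v"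
  using permutes_inj[OF twister_permutes] by (simp add: inj_eq)

lemma twist_apply: "x \<in> M \<Longrightarrow> r \<in> R \<Longrightarrow> twist I a \<sigma> x r = \<sigma> r (agree I a r x) (x r)"
  by (simp add: twist_def)

lemma twist_M:
  assumes x: "x \<in> M"
  shows "twist I a \<sigma> x \<in> M"
proof -
  have T: "finite T" "\<And>r K. r \<notin> T \<Longrightarrow> \<sigma> r K = id" using tw by (auto simp: twister_def)
  have "finite {r \<in> R. r > s \<and> twist I a \<sigma> x r \<noteq> 0}" if "s > 0" for s
  proof (rule finite_subset)
    show "{r \<in> R. r > s \<and> twist I a \<sigma> x r \<noteq> 0} \<subseteq> T \<union> {r \<in> R. s \<le> r \<and> x r \<noteq> 0}"
      using x T(2) by (auto simp: twist_apply)
  qed (use T(1) finite_support_above[OF x that] in auto)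
  moreover have "twist I a \<sigma> x r \<in> V" if "r \<in> R" for r
    using x that twister_V by (auto simp: twist_apply M_def)
  ultimately show ?thesis using x by (auto simp: M_def urysohn_def twist_def)
qed

lemma agree_cong:
  assumes "\<delta> x y \<le> r" "x \<in> M" "y \<in> M"
  shows "agree I a r x = agree I a r y"
proof -
  have "\<delta> y x \<le> r" using assms by (simp add: commute)
  then show ?thesis
    using assms ultra_le[of _ x r y] ultra_le[of _ y r x] twister_M unfolding agree_def by blast
qed

text \<open>At every coordinate from \<open>\<delta> x y\<close> upwards, \<open>x\<close> and
  \<open>y\<close> have the same index set and are subject to the same permutation. Above it their
  equal coordinates stay equal; at it injectivity keeps them different.\<close>

lemma twist_le_iff:
  assumes x: "x \<in> M" and y: "y \<in> M" and s: "s \<ge> 0"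
  shows "\<delta> (twist I a \<sigma> x) (twist I a \<sigma> y) \<le> s \<longleftrightarrow> \<delta> x y \<le> s"
proof
  assume le: "\<delta> x y \<le> s"
  have "twist I a \<sigma> x r = twist I a \<sigma> y r" if "r \<in> R" "s < r" for r
    using that x y le s agree_cong[of x y r] dist_le_iff[OF x y s] by (simp add: twist_apply)
  then show "\<delta> (twist I a \<sigma> x) (twist I a \<sigma> y) \<le> s"
    using dist_le_iff[OF twist_M[OF x] twist_M[OF y] s] by blast
next
  assume le: "\<delta> (twist I a \<sigma> x) (twist I a \<sigma> y) \<le> s"
  show "\<delta> x y \<le> s"
  proof (rule ccontr)
    assume gt: "\<not> \<delta> x y \<le> s"
    define r where "r = \<delta> x y"
    have "x \<noteq> y" using gt s x by auto
    then have r: "r \<in> R" "x r \<noteq> y r"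
      using urysohn_dist_max(1,2)[OF R_pos M_urysohn[OF x] M_urysohn[OF y]] by (auto simp: r_def)
    have "agree I a r x = agree I a r y" by (rule agree_cong) (auto simp: r_def x y)
    then have "twist I a \<sigma> x r \<noteq> twist I a \<sigma> y r"
      using r x y twister_inj by (simp add: twist_apply)
    then show False
      using le dist_le_iff[OF twist_M[OF x] twist_M[OF y] s] r(1) gt by (auto simp: r_def)
  qed
qed

lemma dist_twist:
  assumes "x \<in> M" "y \<in> M"
  shows "\<delta> (twist I a \<sigma> x) (twist I a \<sigma> y) = \<delta> x y"
  by (rule urysohn_dist_eqI[OF R_pos]) (use assms twist_M M_urysohn twist_le_iff in auto)

text \<open>The index set of \<open>a i\<close> contains \<open>i\<close>, and its members lie
  pairwise within \<open>r\<close>, so the chosen permutation sends \<open>a i r\<close> to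
  \<open>b i r\<close>. Outside \<open>T\<close> both points vanish and nothing is permuted.\<close>

lemma twist_family:
  assumes i: "i \<in> I"
  shows "twist I a \<sigma> (a i) = b i"
proof (rule extensionalityI[of _ R])
  show "twist I a \<sigma> (a i) \<in> extensional R" "b i \<in> extensional R"
    using twist_M[OF twister_M(1)[OF i]] twister_M(2)[OF i] by (auto simp: M_def urysohn_def PiE_def)
  fix r assume r: "r \<in> R"
  let ?K = "agree I a r (a i)"
  have aM: "a i \<in> M" using i twister_M by blast
  show "twist I a \<sigma> (a i) r = b i r"
  proof (cases "r \<in> T")
    case True
    have "i \<in> ?K" using i r R_pos aM by (auto simp: agree_def)
    moreover have "\<delta> (a j) (a k) \<le> r" if "j \<in> ?K" "k \<in> ?K" for j k
    proof -
      have "\<delta> (a j) (a i) \<le> r" "\<delta> (a i) (a k) \<le> r" "j \<in> I" "k \<in> I"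
        using that by (auto simp: agree_def commute)
      then show ?thesis using ultra_le twister_M(1) i by blast
    qed
    moreover have "?K \<subseteq> I" by (auto simp: agree_def)
    ultimately have "\<sigma> r ?K (a i r) = b i r" using True by (intro twister_maps)
    then show ?thesis using r aM by (simp add: twist_apply)
  next
    case False
    then have "\<sigma> r ?K = id" "a i r = 0" "b i r = 0" using tw r i by (auto simp: twister_def box_def)
    then show ?thesis using r aM by (simp add: twist_apply)
  qed
qed

lemma agree_twist:
  assumes x: "x \<in> M"
  shows "agree I b r (twist I a \<sigma> x) = agree I a r x"
proof -
  have "\<delta> (b i) (twist I a \<sigma> x) = \<delta> (a i) x" if "i \<in> I" for i
    using dist_twist[of "a i" x] twister_M x that by (simp add: twist_family)
  then show ?thesis by (auto simp: agree_def)
qed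

lemma twist_inverse:
  assumes x: "x \<in> M"
  shows "twist I b (\<lambda>r K. inv_into UNIV (\<sigma> r K)) (twist I a \<sigma> x) = x"
proof (rule extensionalityI[of _ R])
  show "twist I b (\<lambda>r K. inv_into UNIV (\<sigma> r K)) (twist I a \<sigma> x) \<in> extensional R" "x \<in> extensional R"
    using twist_M[OF x] x by (auto simp: twist_def M_def urysohn_def PiE_def)
  fix r assume r: "r \<in> R"
  have "inv_into UNIV (\<sigma> r K) (\<sigma> r K v) = v" for K v
    by (rule permutes_inverses(2)[OF twister_permutes])
  moreover have "twist I b (\<lambda>r K. inv_into UNIV (\<sigma> r K)) (twist I a \<sigma> x) r =
      inv_into UNIV (\<sigma> r (agree I b r (twist I a \<sigma> x))) (twist I a \<sigma> x r)"
    unfolding twist_def[of I b] using twist_M[OF x] r by simp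
  ultimately show "twist I b (\<lambda>r K. inv_into UNIV (\<sigma> r K)) (twist I a \<sigma> x) r = x r"
    using r x by (simp only: agree_twist twist_apply)
qed

lemma twist_box:
  assumes x: "x \<in> box T N"
  shows "twist I a \<sigma> x \<in> box T N"
proof -
  have xM: "x \<in> M" using x by (rule box_M)
  have "\<sigma> r K v < N" if "v < N" for r K v
    using that permutes_in_image[OF twister_permutes, of r K v] by simp
  moreover have "\<sigma> r K v = v" if "r \<notin> T" for r K v using tw that by (auto simp: twister_def)
  moreover have "T \<subseteq> R" using tw by (simp add: twister_def)
  ultimately show ?thesis
    using x twist_M[OF xM] by (auto simp: box_def twist_apply[OF xM] subset_iff)
qed

end

text \<open>If \<open>a i\<close> and \<open>a j\<close> lie within \<open>r\<close>, they coincide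
  at \<open>r\<close> iff their distance is below \<open>r\<close>, and \<open>b\<close> has the
  same distances. So \<open>a i r\<close> to \<open>b i r\<close> is a well-defined injection on
  part of \<open>{..<N}\<close> and extends to a permutation.\<close>

lemma twister_exists:
  assumes T: "finite T" "T \<subseteq> R" "{..<N} \<subseteq> V"
    and ab: "\<And>i. i \<in> I \<Longrightarrow> a i \<in> box T N" "\<And>i. i \<in> I \<Longrightarrow> b i \<in> box T N"
    and dist: "\<And>i j. i \<in> I \<Longrightarrow> j \<in> I \<Longrightarrow> \<delta> (a i) (a j) = \<delta> (b i) (b j)"
  shows "\<exists>\<sigma>. twister T N I a b \<sigma>"
proof -
  have "\<exists>p. p permutes {..<N} \<and> (r \<notin> T \<longrightarrow> p = id) \<and>
      (r \<in> T \<longrightarrow> K \<subseteq> I \<longrightarrow> (\<forall>i\<in>K. \<forall>j\<in>K. \<delta> (a i) (a j) \<le> r) \<longrightarrow> (\<forall>i\<in>K. p (a i r) = b i r))"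
    for r and K :: "'a set"
  proof (cases "r \<in> T \<and> K \<subseteq> I \<and> (\<forall>i\<in>K. \<forall>j\<in>K. \<delta> (a i) (a j) \<le> r)")
    case False
    then show ?thesis using permutes_id by blast
  next
    case True
    have r: "r \<in> R" "r > 0" using True T(2) R_pos by auto
    have split: "x r = y r \<longleftrightarrow> \<delta> x y < r" if "\<delta> x y \<le> r" "x \<in> M" "y \<in> M" for x y
      using that dist_less_iff[of x y r] dist_le_iff[of x y r] r by (auto simp: order_le_less)
    have eq: "a i r = a j r \<longleftrightarrow> b i r = b j r" if "i \<in> K" "j \<in> K" for i j
    proof -
      have I: "i \<in> I" "j \<in> I" using that True by auto
      have "\<delta> (a i) (a j) \<le> r" using that True by blast
      then show ?thesis
        using split[of "a i" "a j"] split[of "b i" "b j"] dist[OF I] ab[OF I(1)] ab[OF I(2)] box_M by auto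
    qed
    define f where "f v = b (SOME i. i \<in> K \<and> a i r = v) r" for v
    have f: "f (a i r) = b i r" if "i \<in> K" for i
    proof -
      have "(SOME j. j \<in> K \<and> a j r = a i r) \<in> K \<and> a (SOME j. j \<in> K \<and> a j r = a i r) r = a i r"
        by (rule someI[of "\<lambda>j. j \<in> K \<and> a j r = a i r" i]) (simp add: that)
      then show ?thesis unfolding f_def using eq that by blast
    qed
    let ?A = "(\<lambda>i. a i r) ` K"
    have less: "a i r < N" "b i r < N" if "i \<in> K" for i
      using that True ab by (auto simp: box_def subset_iff)
    have inj: "inj_on f ?A" using f eq by (auto simp: inj_on_def)
    obtain p where p: "p permutes {..<N}" "\<And>v. v \<in> ?A \<Longrightarrow> p v = f v"
      by (rule permutes_extension[of "{..<N}" ?A f]) (use f less inj in auto)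
    then have "\<forall>i\<in>K. p (a i r) = b i r" using f by simp
    then show ?thesis using True p(1) by blast
  qed
  then obtain \<sigma> where "\<And>r K. \<sigma> r K permutes {..<N} \<and> (r \<notin> T \<longrightarrow> \<sigma> r K = id) \<and>
      (r \<in> T \<longrightarrow> K \<subseteq> I \<longrightarrow> (\<forall>i\<in>K. \<forall>j\<in>K. \<delta> (a i) (a j) \<le> r) \<longrightarrow> (\<forall>i\<in>K. \<sigma> r K (a i r) = b i r))"
    by metis
  then have "twister T N I a b \<sigma>" unfolding twister_def using assms by auto
  then show ?thesis by blast
qed

text \<open>The permutations stay within \<open>{..<N}\<close> and act only at coordinates in
  \<open>T\<close>, hence the box is mapped into itself. Indexed families allow repeated points:
  equality of distances makes repetitions consistent.\<close>

theorem homogeneity: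
  assumes T: "finite T" "T \<subseteq> R" "{..<N} \<subseteq> V"
    and ab: "\<And>i. i \<in> I \<Longrightarrow> a i \<in> box T N" "\<And>i. i \<in> I \<Longrightarrow> b i \<in> box T N"
    and dist: "\<And>i j. i \<in> I \<Longrightarrow> j \<in> I \<Longrightarrow> \<delta> (a i) (a j) = \<delta> (b i) (b j)"
  obtains g where "g \<in> carrier G" "\<And>i. i \<in> I \<Longrightarrow> g (a i) = b i" "g ` box T N \<subseteq> box T N"
proof -
  obtain \<sigma> where tw: "twister T N I a b \<sigma>" using twister_exists[of T N I a b] assms by blast
  note tw' = twister_inverse[OF tw]
  have inv: "inv_into UNIV (inv_into UNIV (\<sigma> r K)) = \<sigma> r K" for r K
    by (rule inv_inv_eq[OF permutes_bij[OF twister_permutes[OF tw]]])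
  have "twist I a \<sigma> \<in> carrier G"
  proof (rule Iso_memI)
    show "twist I a \<sigma> \<in> extensional M" by (simp add: twist_def)
    show "twist I a \<sigma> (twist I b (\<lambda>r K. inv_into UNIV (\<sigma> r K)) x) = x" if "x \<in> M" for x
      using twist_inverse[OF tw' that] by (simp only: inv)
  qed (use twist_M[OF tw] twist_M[OF tw'] dist_twist[OF tw] in auto)
  then show thesis
    by (rule that) (use twist_family[OF tw] twist_box[OF tw] in auto)
qed

text \<open>By homogeneity \<open>q i\<close> can be made to send the truncation of \<open>x\<close>
  to the truncation of \<open>p i x\<close>; the ultrametric inequality then bounds the error at
  \<open>x\<close> by \<open>\<epsilon>\<close> itself. Validity for all larger boxes lets two
  tuples share one.\<close>

lemma approximation:
  fixes p :: "nat \<Rightarrow> (real \<Rightarrow> nat) \<Rightarrow> (real \<Rightarrow> nat)"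
  assumes p: "\<And>i. i \<le> n \<Longrightarrow> p i \<in> carrier G" and F: "finite F" "F \<subseteq> M" and \<epsilon>: "\<epsilon> > 0"
  obtains T N where "finite T" "T \<subseteq> R" "{..<N} \<subseteq> V" "N > 0"
    "\<And>T' N'. finite T' \<Longrightarrow> T \<subseteq> T' \<Longrightarrow> T' \<subseteq> R \<Longrightarrow> N \<le> N' \<Longrightarrow> {..<N'} \<subseteq> V \<Longrightarrow>
       (\<forall>x\<in>F. trunc \<epsilon> x \<in> box T' N') \<and>
       (\<exists>q. \<forall>i\<le>n. q i \<in> carrier G \<and> q i ` box T' N' \<subseteq> box T' N' \<and> (\<forall>x\<in>F. \<delta> (p i x) (q i x) < \<epsilon>))"
proof -
  define E where "E = F \<union> (\<Union>i\<le>n. p i ` F)"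
  have E: "finite E" "E \<subseteq> M" using F p by (auto simp: E_def subset_iff)
  obtain T N where T: "finite T" "T \<subseteq> R" "{..<N} \<subseteq> V" "N > 0"
    and box: "\<And>T' N' x. T \<subseteq> T' \<Longrightarrow> T' \<subseteq> R \<Longrightarrow> N \<le> N' \<Longrightarrow> x \<in> E \<Longrightarrow> trunc \<epsilon> x \<in> box T' N'"
    by (rule trunc_in_some_box[OF E \<epsilon>]) (rule that, auto)
  show thesis
  proof (rule that[OF T])
    fix T' N' assume T': "finite T'" "T \<subseteq> T'" "T' \<subseteq> R" "N \<le> N'" "{..<N'} \<subseteq> V"
    note box' = box[OF T'(2,3,4)]
    have "\<exists>q. q \<in> carrier G \<and> q ` box T' N' \<subseteq> box T' N' \<and> (\<forall>x\<in>F. \<delta> (p i x) (q x) < \<epsilon>)" if i: "i \<le> n" for i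
    proof -
      have pM: "p i x \<in> M" if "x \<in> M" for x using p[OF i] that by simp
      obtain q where q: "q \<in> carrier G" "q ` box T' N' \<subseteq> box T' N'"
        "\<And>x. x \<in> F \<Longrightarrow> q (trunc \<epsilon> x) = trunc \<epsilon> (p i x)"
      proof (rule homogeneity[OF T'(1,3,5), of F "trunc \<epsilon>" "\<lambda>x. trunc \<epsilon> (p i x)"])
        show "\<delta> (trunc \<epsilon> x) (trunc \<epsilon> y) = \<delta> (trunc \<epsilon> (p i x)) (trunc \<epsilon> (p i y))" if "x \<in> F" "y \<in> F" for x y
          using that F(2) p[OF i] \<epsilon> pM by (intro dist_trunc_eq) (auto simp: subset_iff)
      qed (use i box' in \<open>auto simp: E_def\<close>)
      have "\<delta> (p i x) (q x) < \<epsilon>" if x: "x \<in> F" for x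
      proof -
        have xM: "x \<in> M" using x F by auto
        have "\<delta> (q (trunc \<epsilon> x)) (q x) < \<epsilon>"
          using q(1) xM dist_trunc[OF xM \<epsilon>] trunc_M[OF xM \<epsilon>] by (simp add: commute)
        moreover have "\<delta> (p i x) (q (trunc \<epsilon> x)) < \<epsilon>"
          using q(3)[OF x] dist_trunc[OF pM[OF xM] \<epsilon>] by simp
        ultimately show ?thesis
          using ultra_less q(1) pM[OF xM] xM trunc_M[OF xM \<epsilon>] Iso_closed by blast
      qed
      with q show ?thesis by blast
    qed
    then obtain q where "\<And>i. i \<le> n \<Longrightarrow> q i \<in> carrier G \<and> q i ` box T' N' \<subseteq> box T' N' \<and> (\<forall>x\<in>F. \<delta> (p i x) (q i x) < \<epsilon>)"
      by metis
    then show "(\<forall>x\<in>F. trunc \<epsilon> x \<in> box T' N') \<and>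
       (\<exists>q. \<forall>i\<le>n. q i \<in> carrier G \<and> q i ` box T' N' \<subseteq> box T' N' \<and> (\<forall>x\<in>F. \<delta> (p i x) (q i x) < \<epsilon>))"
      using box' by (auto simp: E_def)
  qed
qed

subsection \<open>Amalgamation of permuting tuples\<close>

text \<open>\<open>q i\<close> is to act as \<open>p2 i\<close> on \<open>B\<close> and as
  \<open>p1 i\<close> carried over to the copy of \<open>B\<close> under \<open>g0\<close>. The
  assumptions \<open>iso\<close> and \<open>cross\<close> say that this partial map is isometric, so
  homogeneity extends it.\<close>

lemma amalgam_from_embedding:
  fixes p1 p2 :: "nat \<Rightarrow> (real \<Rightarrow> nat) \<Rightarrow> (real \<Rightarrow> nat)"
  assumes T: "finite T" "T \<subseteq> R" "{..<N} \<subseteq> V"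
    and B: "\<And>b. b \<in> B \<Longrightarrow> b \<in> box T N" "\<And>b. b \<in> B \<Longrightarrow> g0 b \<in> box T N"
    and p: "\<And>i. i \<le> n \<Longrightarrow> p1 i \<in> carrier G" "\<And>i. i \<le> n \<Longrightarrow> p2 i \<in> carrier G"
      "\<And>i b. i \<le> n \<Longrightarrow> b \<in> B \<Longrightarrow> p1 i b \<in> B" "\<And>i b. i \<le> n \<Longrightarrow> b \<in> B \<Longrightarrow> p2 i b \<in> B"
    and iso: "\<And>b b'. b \<in> B \<Longrightarrow> b' \<in> B \<Longrightarrow> \<delta> (g0 b) (g0 b') = \<delta> b b'"
    and cross: "\<And>i b b'. i \<le> n \<Longrightarrow> b \<in> B \<Longrightarrow> b' \<in> B \<Longrightarrow> \<delta> (p2 i b) (g0 (p1 i b')) = \<delta> b (g0 b')"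
  obtains g q where "g \<in> carrier G" "\<And>b. b \<in> B \<Longrightarrow> g b = g0 b"
    "\<And>i. i \<le> n \<Longrightarrow> q i \<in> carrier G"
    "\<And>i b. i \<le> n \<Longrightarrow> b \<in> B \<Longrightarrow> q i b = p2 i b"
    "\<And>i b. i \<le> n \<Longrightarrow> b \<in> B \<Longrightarrow> q i (g b) = g (p1 i b)"
proof -
  have BM: "b \<in> M" if "b \<in> B" for b using B that box_M by blast
  obtain g where g: "g \<in> carrier G" "\<And>b. b \<in> B \<Longrightarrow> g b = g0 b"
    by (rule homogeneity[OF T, of B "\<lambda>b. b" g0]) (use B iso in auto)
  have "\<exists>q. q \<in> carrier G \<and> (\<forall>b\<in>B. q b = p2 i b \<and> q (g0 b) = g0 (p1 i b))" if i: "i \<le> n" for i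
  proof -
    \<comment> \<open>The Boolean tells the copy from the original. Indexing by pairs lets
      \<open>B\<close> and its copy overlap.\<close>
    let ?a = "\<lambda>(b, s). if s then g0 b else b" and ?b = "\<lambda>(b, s). if s then g0 (p1 i b) else p2 i b"
    obtain q where q: "q \<in> carrier G" "\<And>j. j \<in> B \<times> (UNIV :: bool set) \<Longrightarrow> q (?a j) = ?b j"
    proof (rule homogeneity[OF T, of "B \<times> UNIV" ?a ?b])
      fix j k :: "(real \<Rightarrow> nat) \<times> bool" assume jk: "j \<in> B \<times> UNIV" "k \<in> B \<times> UNIV"
      obtain b s where j: "j = (b, s)" "b \<in> B" using jk by auto
      obtain b' s' where k: "k = (b', s')" "b' \<in> B" using jk by auto
      have 1: "\<delta> (p2 i b) (p2 i b') = \<delta> b b'" "\<delta> (p1 i b) (p1 i b') = \<delta> b b'"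
        using p(1,2)[OF i] BM j k by auto
      have 2: "\<delta> (g0 (p1 i b)) (p2 i b') = \<delta> (g0 b) b'"
        using cross[OF i k(2) j(2)] by (simp add: commute)
      show "\<delta> (?a j) (?a k) = \<delta> (?b j) (?b k)"
        using 1 2 iso[OF j(2) k(2)] iso[OF p(3)[OF i j(2)] p(3)[OF i k(2)]] cross[OF i j(2) k(2)]
        by (simp add: j k)
    qed (use B p i in \<open>auto split: if_splits\<close>)
    have "q b = p2 i b \<and> q (g0 b) = g0 (p1 i b)" if "b \<in> B" for b
      using q(2)[of "(b, False)"] q(2)[of "(b, True)"] that by simp
    with q(1) show ?thesis by blast
  qed
  then obtain q where q: "\<And>i. i \<le> n \<Longrightarrow> q i \<in> carrier G \<and> (\<forall>b\<in>B. q i b = p2 i b \<and> q i (g0 b) = g0 (p1 i b))"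
    by metis
  show thesis
    by (rule that[of g q]) (use g q p(3) in auto)
qed

text \<open>\<open>0\<close> is never a coordinate, so \<open>\<rho> b = 0\<close> marks a point
  that stays.\<close>

definition shift :: "((real \<Rightarrow> nat) \<Rightarrow> real) \<Rightarrow> nat \<Rightarrow> (real \<Rightarrow> nat) \<Rightarrow> (real \<Rightarrow> nat)" where
  "shift \<rho> c b = (if \<rho> b = 0 then b else b(\<rho> b := b (\<rho> b) + c))"

lemma dist_shift:
  assumes M: "b \<in> M" "b' \<in> M" and \<rho>: "\<rho> b' \<in> insert 0 R"
    and new: "\<rho> b' \<noteq> 0 \<Longrightarrow> b (\<rho> b') \<noteq> b' (\<rho> b') + c"
  shows "\<delta> b (shift \<rho> c b') = max (\<delta> b b') (\<rho> b')"
  using urysohn_dist_update[OF R_pos M_urysohn[OF M(1)] M_urysohn[OF M(2)], of "\<rho> b'"] \<rho> new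
  by (auto simp: shift_def)

text \<open>Points of equal height are shifted alike; points of different heights are by
  \<open>far\<close> so distant that the shift goes unnoticed. So the copy is isometric. By
  \<open>new\<close>, the distance from \<open>b\<close> to the copy of \<open>b'\<close> is the
  maximum of \<open>\<delta> b b'\<close> and \<open>\<rho> b'\<close>, which reduces compatibility
  to \<open>invariant\<close> and \<open>match\<close>.\<close>

lemma amalgam_by_shift:
  fixes p1 p2 :: "nat \<Rightarrow> (real \<Rightarrow> nat) \<Rightarrow> (real \<Rightarrow> nat)"
  assumes T: "finite T" "T \<subseteq> R" "{..<N} \<subseteq> V"
    and B: "\<And>b. b \<in> B \<Longrightarrow> b \<in> box T N" "\<And>b. b \<in> B \<Longrightarrow> shift \<rho> c b \<in> box T N"
    and p: "\<And>i. i \<le> n \<Longrightarrow> p1 i \<in> carrier G" "\<And>i. i \<le> n \<Longrightarrow> p2 i \<in> carrier G"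
      "\<And>i b. i \<le> n \<Longrightarrow> b \<in> B \<Longrightarrow> p1 i b \<in> B" "\<And>i b. i \<le> n \<Longrightarrow> b \<in> B \<Longrightarrow> p2 i b \<in> B"
    and \<rho>: "\<And>b. b \<in> B \<Longrightarrow> \<rho> b \<in> insert 0 R"
    and invariant: "\<And>i b. i \<le> n \<Longrightarrow> b \<in> B \<Longrightarrow> \<rho> (p1 i b) = \<rho> b"
    and far: "\<And>b b'. b \<in> B \<Longrightarrow> b' \<in> B \<Longrightarrow> \<rho> b < \<rho> b' \<Longrightarrow> \<rho> b' \<le> \<delta> b b'"
    and new: "\<And>b b'. b \<in> B \<Longrightarrow> b' \<in> B \<Longrightarrow> \<rho> b' \<noteq> 0 \<Longrightarrow> b (\<rho> b') \<noteq> b' (\<rho> b') + c"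
    and match: "\<And>i b b'. i \<le> n \<Longrightarrow> b \<in> B \<Longrightarrow> b' \<in> B \<Longrightarrow>
       max (\<delta> (p2 i b) (p1 i b')) (\<rho> b') = max (\<delta> b b') (\<rho> b')"
  obtains g q where "g \<in> carrier G" "\<And>b. b \<in> B \<Longrightarrow> \<delta> (g b) b = \<rho> b"
    "\<And>i. i \<le> n \<Longrightarrow> q i \<in> carrier G"
    "\<And>i b. i \<le> n \<Longrightarrow> b \<in> B \<Longrightarrow> q i b = p2 i b"
    "\<And>i b. i \<le> n \<Longrightarrow> b \<in> B \<Longrightarrow> q i (g b) = g (p1 i b)"
proof -
  have BM: "b \<in> M" if "b \<in> B" for b using B that box_M by blast
  have SM: "shift \<rho> c b \<in> M" if "b \<in> B" for b using B that box_M by blast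
  have \<rho>0: "\<rho> b \<ge> 0" if "b \<in> B" for b using \<rho>[OF that] R_pos by auto
  have cross: "\<delta> b (shift \<rho> c b') = max (\<delta> b b') (\<rho> b')" if "b \<in> B" "b' \<in> B" for b b'
    by (rule dist_shift) (use that BM \<rho> new in auto)
  have less: "\<delta> (shift \<rho> c b) (shift \<rho> c b') = \<delta> b b'" if b: "b \<in> B" "b' \<in> B" "\<rho> b < \<rho> b'" for b b'
  proof -
    have "\<rho> b' > 0" using \<rho>0[OF b(1)] b(3) by simp
    have "shift \<rho> c b (\<rho> b') = b (\<rho> b')" using b(3) by (simp add: shift_def)
    then have "\<delta> (shift \<rho> c b) (shift \<rho> c b') = max (\<delta> (shift \<rho> c b) b') (\<rho> b')"
      using b new[OF b(1,2)] by (intro dist_shift SM BM \<rho>) auto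
    also have "\<delta> (shift \<rho> c b) b' = max (\<delta> b' b) (\<rho> b)" using cross b by (simp add: commute)
    finally show ?thesis using far[OF b] b(3) by (simp add: commute)
  qed
  have iso: "\<delta> (shift \<rho> c b) (shift \<rho> c b') = \<delta> b b'" if b: "b \<in> B" "b' \<in> B" for b b'
  proof (cases "\<rho> b" "\<rho> b'" rule: linorder_cases)
    case equal
    then show ?thesis
      using urysohn_dist_shift[OF R_pos M_urysohn[OF BM[OF b(1)]] M_urysohn[OF BM[OF b(2)]], of "\<rho> b" c] \<rho>[OF b(1)]
      by (auto simp: shift_def)
  next
    case greater
    then show ?thesis using less[OF b(2,1)] by (simp add: commute)
  qed (use less b in blast)
  have cross': "\<delta> (p2 i b) (shift \<rho> c (p1 i b')) = \<delta> b (shift \<rho> c b')" if "i \<le> n" "b \<in> B" "b' \<in> B" for i b b'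
    using that match[OF that] invariant p(3,4) by (simp add: cross)
  obtain g q where gq: "g \<in> carrier G" "\<And>b. b \<in> B \<Longrightarrow> g b = shift \<rho> c b"
    "\<And>i. i \<le> n \<Longrightarrow> q i \<in> carrier G"
    "\<And>i b. i \<le> n \<Longrightarrow> b \<in> B \<Longrightarrow> q i b = p2 i b"
    "\<And>i b. i \<le> n \<Longrightarrow> b \<in> B \<Longrightarrow> q i (g b) = g (p1 i b)"
    by (rule amalgam_from_embedding[OF T B p iso cross']) auto
  have "\<delta> (g b) b = \<rho> b" if "b \<in> B" for b
    using cross[OF that that] gq(2)[OF that] \<rho>0[OF that] BM[OF that] by (simp add: commute)
  then show thesis using that gq by blast
qed

text \<open>The distance from \<open>b\<close> to \<open>A\<close>, capped by \<open>D\<close>,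
  which also covers an empty \<open>A\<close>, and then raised to at least \<open>\<tau>\<close>,
  the precision to which tuples are known on \<open>A\<close>.\<close>

definition radius :: "(real \<Rightarrow> nat) set \<Rightarrow> real \<Rightarrow> real \<Rightarrow> (real \<Rightarrow> nat) \<Rightarrow> real" where
  "radius A D \<tau> b = max (Min (insert D (\<delta> b ` A))) \<tau>"

lemma radius_le_iff:
  "finite A \<Longrightarrow> radius A D \<tau> b \<le> t \<longleftrightarrow> \<tau> \<le> t \<and> (D \<le> t \<or> (\<exists>a\<in>A. \<delta> b a \<le> t))"
  by (auto simp: radius_def Min_le_iff)

lemma radius_in: "finite A \<Longrightarrow> radius A D \<tau> b \<in> insert \<tau> (insert D (\<delta> b ` A))"
  using Min_in[of "insert D (\<delta> b ` A)"] by (auto simp: radius_def max_def)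

lemma radius_near: "finite A \<Longrightarrow> a \<in> A \<Longrightarrow> a \<in> M \<Longrightarrow> 0 \<le> \<tau> \<Longrightarrow> radius A D \<tau> a = \<tau>"
  using radius_le_iff[of A D \<tau> a \<tau>] by (force simp: radius_def)

text \<open>If \<open>b\<close> and \<open>b'\<close> were closer than the larger radius, a point of
  \<open>A\<close> near \<open>b\<close> would be near \<open>b'\<close> as well and the larger
  radius would drop.\<close>

lemma radius_far:
  assumes "finite A" "A \<subseteq> M" "b \<in> M" "b' \<in> M" "radius A D \<tau> b < radius A D \<tau> b'"
  shows "radius A D \<tau> b' \<le> \<delta> b b'"
proof (rule ccontr)
  assume gt: "\<not> radius A D \<tau> b' \<le> \<delta> b b'"
  define t where "t = max (radius A D \<tau> b) (\<delta> b b')"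
  have "radius A D \<tau> b \<le> t" "\<delta> b' b \<le> t" by (auto simp: t_def commute)
  moreover have "\<delta> b' a \<le> t" if "\<delta> b' b \<le> t" "\<delta> b a \<le> t" "a \<in> A" for a
    using that assms by (intro ultra_le[of b' b t a]) auto
  ultimately have "radius A D \<tau> b' \<le> t" using assms(1) by (auto simp: radius_le_iff)
  then show False using gt assms(5) by (simp add: t_def)
qed

text \<open>At scales from \<open>\<tau>\<close> upwards \<open>q a\<close> and \<open>p a\<close>
  are the same centre of a ball, and \<open>p\<close> merely permutes the centres.\<close>

lemma radius_invariant:
  assumes A: "finite A" "A \<subseteq> M" "p ` A = A" and q: "q \<in> carrier G" and b: "b \<in> M"
    and near: "\<And>a. a \<in> A \<Longrightarrow> \<delta> (q a) (p a) \<le> \<tau>"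
  shows "radius A D \<tau> (q b) = radius A D \<tau> b"
proof -
  have iff: "\<delta> (q b) (p a) \<le> t \<longleftrightarrow> \<delta> b a \<le> t" if a: "a \<in> A" and t: "\<tau> \<le> t" for a t
  proof -
    have M: "q b \<in> M" "q a \<in> M" "p a \<in> M" "a \<in> M" using A a q b by auto
    have "\<delta> (q a) (p a) \<le> t" using near[OF a] t by simp
    then have "\<delta> (q b) (p a) \<le> t \<longleftrightarrow> \<delta> (q b) (q a) \<le> t"
      using M ultra_le[of "q b" "q a" t "p a"] ultra_le[of "q b" "p a" t "q a"] by (auto simp: commute)
    then show ?thesis using q b M by simp
  qed
  have "radius A D \<tau> (q b) \<le> t \<longleftrightarrow> radius A D \<tau> b \<le> t" for t
  proof -
    have "(\<exists>a\<in>p ` A. \<delta> (q b) a \<le> t) \<longleftrightarrow> (\<exists>a\<in>A. \<delta> (q b) (p a) \<le> t)" by simp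
    then have "(\<exists>a\<in>A. \<delta> (q b) a \<le> t) \<longleftrightarrow> (\<exists>a\<in>A. \<delta> (q b) (p a) \<le> t)" by (simp only: A(3))
    then show ?thesis using iff by (auto simp: radius_le_iff[OF A(1)])
  qed
  then show ?thesis by (meson order_antisym order_refl)
qed

text \<open>The point \<open>a\<close> serves as reference: within \<open>t\<close>,
  \<open>p1 b'\<close> is the same as \<open>p1 a\<close>, hence as \<open>p2 a\<close>. So
  \<open>p2 b\<close> is compared with \<open>p2 a\<close>, that is \<open>b\<close> with
  \<open>a\<close>, that is \<open>b\<close> with \<open>b'\<close>.\<close>

lemma match_le:
  assumes a: "\<delta> b' a \<le> t" "\<delta> (p2 a) (p1 a) \<le> t" and p: "p1 \<in> carrier G" "p2 \<in> carrier G"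
    and M: "a \<in> M" "b \<in> M" "b' \<in> M"
  shows "\<delta> (p2 b) (p1 b') \<le> t \<longleftrightarrow> \<delta> b b' \<le> t"
proof -
  have cl: "p1 a \<in> M" "p2 a \<in> M" "p2 b \<in> M" "p1 b' \<in> M" using p M by auto
  have "\<delta> (p1 a) (p1 b') \<le> t" using a p M by (simp add: commute)
  then have *: "\<delta> (p2 a) (p1 b') \<le> t" using ultra_le[OF a(2)] cl by blast
  then have "\<delta> (p2 b) (p1 b') \<le> t \<longleftrightarrow> \<delta> (p2 b) (p2 a) \<le> t"
    using cl ultra_le[of "p2 b" "p2 a" t "p1 b'"] ultra_le[of "p2 b" "p1 b'" t "p2 a"] by (auto simp: commute)
  also have "\<dots> \<longleftrightarrow> \<delta> b a \<le> t" using p M by simp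
  also have "\<dots> \<longleftrightarrow> \<delta> b b' \<le> t"
    using a(1) M ultra_le[of b a t b'] ultra_le[of b b' t a] by (auto simp: commute)
  finally show ?thesis .
qed

text \<open>Only four distances are involved, so being below \<open>t\<close> means being at most
  the largest of them below \<open>t\<close>, and the closed version applies.\<close>

lemma match_less:
  assumes a: "\<delta> b' a < t" "\<delta> (p2 a) (p1 a) < t" and p: "p1 \<in> carrier G" "p2 \<in> carrier G"
    and M: "a \<in> M" "b \<in> M" "b' \<in> M"
  shows "\<delta> (p2 b) (p1 b') < t \<longleftrightarrow> \<delta> b b' < t"
proof -
  have "\<delta> u v < t \<longleftrightarrow> \<delta> u v \<le> s"
    if "s = Max {u. u < t \<and> u \<in> {\<delta> b' a, \<delta> (p2 a) (p1 a), \<delta> (p2 b) (p1 b'), \<delta> b b'}}"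
      "\<delta> u v \<in> {\<delta> b' a, \<delta> (p2 a) (p1 a), \<delta> (p2 b) (p1 b'), \<delta> b b'}" for u v s
  proof -
    have fin: "finite {u. u < t \<and> u \<in> {\<delta> b' a, \<delta> (p2 a) (p1 a), \<delta> (p2 b) (p1 b'), \<delta> b b'}}" by simp
    then have "s < t" using Max_in[OF fin] a that by blast
    then show ?thesis using Max_ge[OF fin, of "\<delta> u v"] that by force
  qed
  then show ?thesis using match_le[OF _ _ p M] a by blast
qed

text \<open>With coordinates \<open>0\<close> and \<open>1\<close>, the closed ball of radius
  \<open>r\<close> around \<open>a\<close> has two branches at coordinate \<open>r\<close>: that of
  \<open>a\<close>, and one containing all points at distance exactly \<open>r\<close> from
  \<open>a\<close>.\<close>

lemma two_branches:
  assumes V: "V = {..<2}" and M: "x \<in> M" "y \<in> M" "a \<in> M" and r: "\<delta> x a = r" "r > 0"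
  shows "\<delta> y x < r \<longleftrightarrow> \<delta> y a = r"
proof
  assume "\<delta> y x < r"
  then have "\<not> \<delta> y a < r" using ultra_less[of x y r a] M r(1) by (auto simp: commute)
  moreover have "\<delta> y a \<le> r" using dist_ultra[of y x a] M r \<open>\<delta> y x < r\<close> by simp
  ultimately show "\<delta> y a = r" by simp
next
  assume y: "\<delta> y a = r"
  have "x \<noteq> a" "y \<noteq> a" using r y M by auto
  then have "r \<in> R" "x r \<noteq> a r" "y r \<noteq> a r"
    using urysohn_dist_max(1,2)[OF R_pos M_urysohn[OF M(1)] M_urysohn[OF M(3)]]
      urysohn_dist_max(1,2)[OF R_pos M_urysohn[OF M(2)] M_urysohn[OF M(3)]] r(1) y by auto
  moreover have "x r \<in> V" "y r \<in> V" "a r \<in> V" using M \<open>r \<in> R\<close> by (auto simp: M_def)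
  then have "x r < 2" "y r < 2" "a r < 2" by (simp_all add: V)
  ultimately have "y r = x r" by linarith
  moreover have "y s = x s" if "s \<in> R" "s > r" for s
    using dist_le_iff[OF M(1,3), of r] dist_le_iff[OF M(2,3), of r] r y that by auto
  ultimately show "\<delta> y x < r"
    using dist_less_iff[OF M(2,1) r(2)] by (metis order_le_less)
qed

lemma max_eqI:
  fixes u v w :: real
  shows "(\<And>t. t \<ge> w \<Longrightarrow> u \<le> t \<longleftrightarrow> v \<le> t) \<Longrightarrow> max u w = max v w"
  by (metis max.cobounded1 max.cobounded2 max_def order_antisym)

section \<open>Amalgamating two tuples over a common finite set\<close>

context
  fixes T N A \<epsilon> n and p1 p2 p :: "nat \<Rightarrow> (real \<Rightarrow> nat) \<Rightarrow> (real \<Rightarrow> nat)"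
  assumes T: "finite T" "T \<subseteq> R" "{..<N} \<subseteq> V" "N > 0" and A: "A \<subseteq> box T N" and \<epsilon>: "\<epsilon> > 0"
    and p12: "\<And>i. i \<le> n \<Longrightarrow> p1 i \<in> carrier G" "\<And>i. i \<le> n \<Longrightarrow> p2 i \<in> carrier G"
      "\<And>i b. i \<le> n \<Longrightarrow> b \<in> box T N \<Longrightarrow> p1 i b \<in> box T N"
      "\<And>i b. i \<le> n \<Longrightarrow> b \<in> box T N \<Longrightarrow> p2 i b \<in> box T N"
    and pA: "\<And>i. i \<le> n \<Longrightarrow> p i ` A = A"
    and near: "\<And>i a. i \<le> n \<Longrightarrow> a \<in> A \<Longrightarrow> \<delta> (p1 i a) (p i a) < \<epsilon>"
      "\<And>i a. i \<le> n \<Longrightarrow> a \<in> A \<Longrightarrow> \<delta> (p2 i a) (p i a) < \<epsilon>"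
begin

lemma finite_A: "finite A" using finite_subset[OF A] T finite_box by blast

lemma A_M: "A \<subseteq> M" using A box_M by blast

lemma p_A: "i \<le> n \<Longrightarrow> a \<in> A \<Longrightarrow> p i a \<in> A" using pA by blast

lemma near12: "i \<le> n \<Longrightarrow> a \<in> A \<Longrightarrow> \<delta> (p2 i a) (p1 i a) < \<epsilon>"
  using ultra_less[OF near(2), of i a "p1 i a"] near(1)[of i a] p12(1,2) p_A A_M
  by (auto simp: commute subset_iff)

lemma amalgamation_all_values:
  assumes V: "V = UNIV"
  shows "\<exists>g q. g \<in> carrier G \<and> (\<forall>a\<in>A. \<delta> (g a) a < \<epsilon>) \<and> (\<forall>i\<le>n. q i \<in> carrier G \<and>
    (\<forall>b\<in>box T N. q i b = p2 i b \<and> q i (g b) = g (p1 i b)))"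
proof -
  have in_V: "v \<in> V" for v using V by simp
  define S where "S = {t \<in> insert 0 T. t < \<epsilon>}"
  have S: "finite S" "S \<noteq> {}" using T \<epsilon> by (auto simp: S_def)
  \<comment> \<open>The largest distance of the box below \<open>\<epsilon>\<close>: being less than
    \<open>\<epsilon>\<close> apart in the box means being at most \<open>\<tau>\<close> apart, and
    \<open>\<tau>\<close> is a legitimate height.\<close>
  define \<tau> where "\<tau> = Max S"
  have \<tau>: "\<tau> \<in> insert 0 T" "\<tau> < \<epsilon>" "\<And>t. t \<in> insert 0 T \<Longrightarrow> t < \<epsilon> \<Longrightarrow> t \<le> \<tau>"
    using Max_in[OF S] S(1) by (auto simp: \<tau>_def S_def)
  have \<tau>0: "0 \<le> \<tau>" using \<tau>(3)[of 0] \<epsilon> by simp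
  \<comment> \<open>No two points of the box are further apart, so from \<open>D\<close> upwards
    matching is trivial.\<close>
  define D where "D = Max (insert 0 T)"
  have D: "D \<in> insert 0 T" "\<And>t. t \<in> insert 0 T \<Longrightarrow> t \<le> D"
    using Max_in[of "insert 0 T"] T(1) unfolding D_def by auto
  let ?\<rho> = "radius A D \<tau>"
  have \<rho>_in: "?\<rho> b \<in> insert 0 T" if "b \<in> box T N" for b
  proof -
    have "\<delta> b ` A \<subseteq> insert 0 T" using box_dist_in[OF that] A by blast
    then have "insert \<tau> (insert D (\<delta> b ` A)) \<subseteq> insert 0 T"
      using \<tau>(1) D(1) by (simp only: insert_subset simp_thms)
    then show ?thesis using radius_in[OF finite_A] by (rule subsetD)
  qed
  have in_M: "b \<in> M" if "b \<in> box T N" for b using that by (rule box_M)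
  obtain g q where gq: "g \<in> carrier G" "\<And>b. b \<in> box T N \<Longrightarrow> \<delta> (g b) b = ?\<rho> b"
    "\<And>i. i \<le> n \<Longrightarrow> q i \<in> carrier G"
    "\<And>i b. i \<le> n \<Longrightarrow> b \<in> box T N \<Longrightarrow> q i b = p2 i b"
    "\<And>i b. i \<le> n \<Longrightarrow> b \<in> box T N \<Longrightarrow> q i (g b) = g (p1 i b)"
  proof (rule amalgam_by_shift[of T "N + N" "box T N" ?\<rho> N n p1 p2])
    show "finite T" "T \<subseteq> R" "{..<N + N} \<subseteq> V" using T V by auto
    show "b \<in> box T (N + N)" if "b \<in> box T N" for b
      using box_mono[of T T N "N + N"] T that by auto
    show "shift ?\<rho> N b \<in> box T (N + N)" if b: "b \<in> box T N" for b
    proof (cases "?\<rho> b = 0")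
      case True
      then show ?thesis using box_mono[of T T N "N + N"] T b by (auto simp: shift_def)
    next
      case False
      then have r: "?\<rho> b \<in> T" using \<rho>_in[OF b] by simp
      then have "?\<rho> b \<in> R" using T(2) by blast
      then have "b(?\<rho> b := b (?\<rho> b) + N) \<in> M"
        using urysohn_update[OF R_pos M_urysohn[OF in_M[OF b]]] in_V by (simp add: M_def)
      moreover have "b s < N" if "s \<in> T" for s using b that by (simp add: box_def)
      ultimately show ?thesis
        using False r b by (auto simp: shift_def box_def trans_less_add1)
    qed
    show "?\<rho> b \<in> insert 0 R" if "b \<in> box T N" for b using \<rho>_in[OF that] T(2) by blast
    show "?\<rho> (p1 i b) = ?\<rho> b" if i: "i \<le> n" and "b \<in> box T N" for i b
    proof (rule radius_invariant[OF finite_A A_M pA[OF i] p12(1)[OF i] box_M])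
      show "\<delta> (p1 i a) (p i a) \<le> \<tau>" if "a \<in> A" for a
        using \<tau>(3) near(1)[OF i that] box_dist_in[of "p1 i a" T N "p i a"] p12(3)[OF i, of a] p_A[OF i that] A that by blast
    qed (rule that)
    show "?\<rho> b' \<le> \<delta> b b'" if "b \<in> box T N" "b' \<in> box T N" "?\<rho> b < ?\<rho> b'" for b b'
      using radius_far[OF finite_A A_M] that box_M by blast
    show "b (?\<rho> b') \<noteq> b' (?\<rho> b') + N" if "b \<in> box T N" "b' \<in> box T N" "?\<rho> b' \<noteq> 0" for b b'
    proof -
      have "b (?\<rho> b') < N" using \<rho>_in[OF that(2)] that by (auto simp: box_def)
      then show ?thesis by simp
    qed
    show "max (\<delta> (p2 i b) (p1 i b')) (?\<rho> b') = max (\<delta> b b') (?\<rho> b')"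
      if i: "i \<le> n" and b: "b \<in> box T N" "b' \<in> box T N" for i b b'
    proof (rule max_eqI)
      fix t assume t: "?\<rho> b' \<le> t"
      then consider "D \<le> t" | a where "a \<in> A" "\<delta> b' a \<le> t" "\<tau> \<le> t"
        unfolding radius_le_iff[OF finite_A] by blast
      then show "(\<delta> (p2 i b) (p1 i b') \<le> t) = (\<delta> b b' \<le> t)"
      proof cases
        case 1
        then show ?thesis
          using D(2)[OF box_dist_in[OF b]] D(2)[OF box_dist_in[OF p12(4)[OF i b(1)] p12(3)[OF i b(2)]]] by simp
      next
        case 2
        have aB: "a \<in> box T N" using 2 A by blast
        have "\<delta> (p2 i a) (p1 i a) \<le> \<tau>"
          by (rule \<tau>(3)[OF box_dist_in near12]) (use p12(3,4) i aB 2 in auto)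
        then show ?thesis
          using 2 i in_M[OF aB] in_M[OF b(1)] in_M[OF b(2)] p12(1,2) by (intro match_le) auto
      qed
    qed
  qed (use p12 in auto)
  have "\<delta> (g a) a < \<epsilon>" if "a \<in> A" for a
    using gq(2)[OF subsetD[OF A that]] radius_near[OF finite_A that subsetD[OF A_M that] \<tau>0] \<tau>(2) by simp
  then show ?thesis using gq by blast
qed

text \<open>Heights are chosen just below the radius \<open>r\<close>, with no distance of
  \<open>T\<close> in between; density of \<open>R\<close> makes room. Matching strictly below
  \<open>r\<close> goes through a point of \<open>A\<close> closer than \<open>r\<close> or, if that
  point is at distance exactly \<open>r\<close>, through \<open>two_branches\<close>.\<close>

lemma amalgamation_two_values:
  assumes V: "V = {..<2}" and dense: "\<And>s r. 0 \<le> s \<Longrightarrow> s < r \<Longrightarrow> \<exists>t\<in>R. s < t \<and> t < r"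
  shows "\<exists>g q. g \<in> carrier G \<and> (\<forall>a\<in>A. \<delta> (g a) a < \<epsilon>) \<and> (\<forall>i\<le>n. q i \<in> carrier G \<and>
    (\<forall>b\<in>box T N. q i b = p2 i b \<and> q i (g b) = g (p1 i b)))"
proof -
  \<comment> \<open>The summand \<open>1\<close> puts \<open>D\<close> strictly above all distances
    in \<open>T\<close>, so that the lowered height of \<open>D\<close> is still above all of
    them.\<close>
  define D where "D = 1 + Max (insert 0 T)"
  have D: "t < D" if "t \<in> insert 0 T" for t
  proof -
    have "t \<le> Max (insert 0 T)" using T(1) that by (intro Max_ge) auto
    then show ?thesis by (simp add: D_def)
  qed
  \<comment> \<open>All possible radii, and all distances of the box. The element \<open>0\<close>
    keeps the heights positive.\<close>
  define L where "L = insert 0 (insert \<epsilon> (insert D T))"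
  have L: "finite L" "0 \<in> L" using T(1) by (auto simp: L_def)
  have "\<exists>t\<in>R. t < r \<and> (\<forall>s\<in>L. s < r \<longrightarrow> s < t)" if r: "r > 0" for r
  proof -
    let ?S = "{s \<in> L. s < r}"
    have S: "finite ?S" "0 \<in> ?S" using L r by auto
    then have "0 \<le> Max ?S" by simp
    moreover have "?S \<noteq> {}" using S(2) by blast
    then have "Max ?S < r" using Max_in[OF S(1)] by blast
    ultimately obtain t where t: "t \<in> R" "Max ?S < t" "t < r" using dense by blast
    have "s < t" if "s \<in> L" "s < r" for s
    proof -
      have "s \<le> Max ?S" using S that by simp
      then show ?thesis using t by simp
    qed
    then show ?thesis using t by blast
  qed
  then obtain \<sigma> where \<sigma>: "\<And>r. r > 0 \<Longrightarrow> \<sigma> r \<in> R" "\<And>r. r > 0 \<Longrightarrow> \<sigma> r < r"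
    "\<And>r s. r > 0 \<Longrightarrow> s \<in> L \<Longrightarrow> s < r \<Longrightarrow> s < \<sigma> r" by metis
  \<comment> \<open>With \<open>\<epsilon>\<close> as lower bound, points of \<open>A\<close> get
    the height \<open>\<sigma> \<epsilon>\<close>, which is strictly below
    \<open>\<epsilon>\<close>, as closeness to the identity on \<open>A\<close> requires.\<close>
  let ?r = "radius A D \<epsilon>"
  let ?\<rho> = "\<lambda>b. \<sigma> (?r b)"
  let ?T = "T \<union> ?\<rho> ` box T N"
  have r_ge: "\<epsilon> \<le> ?r b" and r_pos: "0 < ?r b" for b using \<epsilon> by (auto simp: radius_def)
  have r_in: "?r b \<in> L" if "b \<in> box T N" for b
  proof -
    have "\<delta> b ` A \<subseteq> insert 0 T" using box_dist_in[OF that] A by blast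
    also have "insert 0 T \<subseteq> L" by (auto simp: L_def)
    finally have "insert \<epsilon> (insert D (\<delta> b ` A)) \<subseteq> L" by (simp add: L_def)
    then show ?thesis using radius_in[OF finite_A] by (rule subsetD)
  qed
  have \<sigma>T: "\<sigma> r \<notin> T" if "r > 0" for r
    using \<sigma>(2,3)[OF that] by (auto simp: L_def)
  have in_M: "b \<in> M" if "b \<in> box T N" for b using that by (rule box_M)
  have one_V: "1 \<in> V" using V by simp
  have N2: "N \<le> 2" using T(3) V by (metis lessThan_subset_iff)
  have finT: "finite ?T" "?T \<subseteq> R" using T finite_box \<sigma>(1) r_pos by auto
  have zero: "b (?\<rho> b') = 0" if "b \<in> box T N" for b b'
    using that \<sigma>T[OF r_pos] \<sigma>(1)[OF r_pos] by (auto simp: box_def)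
  obtain g q where gq: "g \<in> carrier G" "\<And>b. b \<in> box T N \<Longrightarrow> \<delta> (g b) b = ?\<rho> b"
    "\<And>i. i \<le> n \<Longrightarrow> q i \<in> carrier G"
    "\<And>i b. i \<le> n \<Longrightarrow> b \<in> box T N \<Longrightarrow> q i b = p2 i b"
    "\<And>i b. i \<le> n \<Longrightarrow> b \<in> box T N \<Longrightarrow> q i (g b) = g (p1 i b)"
  proof (rule amalgam_by_shift[of ?T 2 "box T N" ?\<rho> 1 n p1 p2])
    show "finite ?T" "?T \<subseteq> R" "{..<2} \<subseteq> V" using finT V by auto
    have sub: "box T N \<subseteq> box ?T 2" by (rule box_mono) (use N2 finT T(4) in auto)
    then show "b \<in> box ?T 2" if "b \<in> box T N" for b using that by blast
    show "shift ?\<rho> 1 b \<in> box ?T 2" if b: "b \<in> box T N" for b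
    proof -
      have "b \<in> box ?T 2" using sub b by blast
      moreover have "b(?\<rho> b := 1) \<in> M"
        using urysohn_update[OF R_pos M_urysohn[OF in_M[OF b]] \<sigma>(1)[OF r_pos]] in_M[OF b] one_V
        by (simp add: M_def)
      moreover have "?\<rho> b \<in> ?T" using b by blast
      ultimately show ?thesis using zero[OF b, of b] by (auto simp: shift_def box_def)
    qed
    show "?\<rho> b \<in> insert 0 R" for b using \<sigma>(1)[OF r_pos] by blast
    show "?\<rho> (p1 i b) = ?\<rho> b" if i: "i \<le> n" and "b \<in> box T N" for i b
    proof -
      have "?r (p1 i b) = ?r b"
        by (rule radius_invariant[OF finite_A A_M pA[OF i] p12(1)[OF i] box_M])
          (use near(1)[OF i] that in \<open>auto intro: less_imp_le\<close>)
      then show ?thesis by simp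
    qed
    show "?\<rho> b' \<le> \<delta> b b'" if b: "b \<in> box T N" "b' \<in> box T N" and less: "?\<rho> b < ?\<rho> b'" for b b'
    proof -
      \<comment> \<open>Radii lie in \<open>L\<close>, so a smaller radius is below the lowered
        height of a larger one; lowering preserves their order.\<close>
      have "?r b < ?r b'"
      proof (rule ccontr)
        assume "\<not> ?r b < ?r b'"
        then consider "?r b = ?r b'" | "?r b' < ?r b" by linarith
        then show False
        proof cases
          case 2
          then have "?r b' < ?\<rho> b" using \<sigma>(3)[OF r_pos r_in[OF b(2)]] by blast
          then show False using \<sigma>(2)[OF r_pos[of b']] less by linarith
        qed (use less in simp)
      qed
      then have "?r b' \<le> \<delta> b b'" using radius_far[OF finite_A A_M] b box_M by blast
      then show ?thesis using \<sigma>(2)[OF r_pos[of b']] by linarith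
    qed
    show "b (?\<rho> b') \<noteq> b' (?\<rho> b') + 1" if "b \<in> box T N" "b' \<in> box T N" for b b'
      using zero[OF that(1)] by simp
    show "max (\<delta> (p2 i b) (p1 i b')) (?\<rho> b') = max (\<delta> b b') (?\<rho> b')"
      if i: "i \<le> n" and b: "b \<in> box T N" "b' \<in> box T N" for i b b'
    proof (rule max_eqI)
      fix t assume t: "?\<rho> b' \<le> t"
      let ?s = "?r b'"
      note P = p12(1)[OF i] p12(2)[OF i]
      note dT = box_dist_in[OF b] box_dist_in[OF p12(4)[OF i b(1)] p12(3)[OF i b(2)]]
      consider "D \<le> ?s" | a where "a \<in> A" "\<delta> b' a \<le> ?s"
        using radius_le_iff[OF finite_A, of D \<epsilon> b' ?s] by blast
      then show "(\<delta> (p2 i b) (p1 i b') \<le> t) = (\<delta> b b' \<le> t)"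
      proof cases
        case 1
        have "u \<le> t" if "u \<in> insert 0 T" for u
        proof -
          have "u < ?s" using D[OF that] 1 by simp
          then have "u < ?\<rho> b'" using \<sigma>(3)[OF r_pos] that by (auto simp: L_def)
          then show ?thesis using t by simp
        qed
        then show ?thesis using dT by blast
      next
        case 2
        have aM: "a \<in> M" using 2 A_M by blast
        note bM = in_M[OF b(1)] in_M[OF b(2)]
        have n12: "\<delta> (p2 i a) (p1 i a) < ?s" using near12[OF i 2(1)] r_ge[of b'] by linarith
        show ?thesis
        proof (cases "?s \<le> t")
          case True
          then show ?thesis using 2 n12 aM bM P by (intro match_le) auto
        next
          case False
          \<comment> \<open>No element of \<open>L\<close> lies between \<open>\<sigma> ?s\<close>
            and \<open>?s\<close>, so for distances in the box being at most \<open>t\<close>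
            amounts to being strictly below \<open>?s\<close>.\<close>
          have below: "u \<le> t \<longleftrightarrow> u < ?s" if "u \<in> insert 0 T" for u
            using \<sigma>(3)[OF r_pos, of u b'] that t False by (auto simp: L_def)
          have "\<delta> (p2 i b) (p1 i b') < ?s \<longleftrightarrow> \<delta> b b' < ?s"
          proof (cases "\<delta> b' a < ?s")
            case True
            then show ?thesis using n12 aM bM P by (intro match_less) auto
          next
            case False
            then have s: "\<delta> b' a = ?s" using 2 by simp
            have cl: "p1 i a \<in> M" "p2 i a \<in> M" "p1 i b' \<in> M" "p2 i b \<in> M" using P aM bM by auto
            have "\<delta> (p1 i b') (p1 i a) = ?s" using P aM bM s by simp
            then have s': "\<delta> (p1 i b') (p2 i a) = ?s"
              using n12 dist_ultra[of "p1 i b'" "p1 i a" "p2 i a"] dist_ultra[of "p1 i b'" "p2 i a" "p1 i a"] cl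
              by (auto simp: commute)
            \<comment> \<open>Only one branch lies at distance exactly \<open>?s\<close> from
              \<open>p2 i a\<close>, so sharing the branch of \<open>p1 i b'\<close> is decided by
              the distance to \<open>p2 i a\<close>, which \<open>p2 i\<close> carries back to
              \<open>b\<close> and \<open>a\<close>.\<close>
            have "\<delta> (p2 i b) (p1 i b') < ?s \<longleftrightarrow> \<delta> (p2 i b) (p2 i a) = ?s"
              by (rule two_branches[OF V cl(3,4,2) s' r_pos])
            also have "\<dots> \<longleftrightarrow> \<delta> b a = ?s" using P aM bM by simp
            also have "\<dots> \<longleftrightarrow> \<delta> b b' < ?s"
              using two_branches[OF V bM(2,1) aM s r_pos] by simp
            finally show ?thesis .
          qed
          then show ?thesis using below[OF dT(1)] below[OF dT(2)] by simp
        qed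
      qed
    qed
  qed (use p12 in auto)
  have "\<delta> (g a) a < \<epsilon>" if "a \<in> A" for a
    using gq(2)[OF subsetD[OF A that]] radius_near[OF finite_A that subsetD[OF A_M that] less_imp_le[OF \<epsilon>]]
      \<sigma>(2)[OF \<epsilon>] by simp
  then show ?thesis using gq by blast
qed

end

subsection \<open>Conjugacy classes of tuples\<close>

abbreviation tuples :: "nat \<Rightarrow> (nat \<Rightarrow> (real \<Rightarrow> nat) \<Rightarrow> (real \<Rightarrow> nat)) topology" where
  "tuples n \<equiv> product_topology (\<lambda>_. Iso_topology M \<delta>) {..n}"

definition near :: "nat \<Rightarrow> (nat \<Rightarrow> (real \<Rightarrow> nat) \<Rightarrow> (real \<Rightarrow> nat)) \<Rightarrow> (real \<Rightarrow> nat) set \<Rightarrow> real \<Rightarrow>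
    (nat \<Rightarrow> (real \<Rightarrow> nat) \<Rightarrow> (real \<Rightarrow> nat)) set" where
  "near n p F \<epsilon> = {q \<in> {..n} \<rightarrow>\<^sub>E carrier G. \<forall>i\<le>n. \<forall>x\<in>F. \<delta> (p i x) (q i x) < \<epsilon>}"

lemma openin_near:
  assumes "finite F" "F \<subseteq> M" "\<And>i x. i \<le> n \<Longrightarrow> x \<in> F \<Longrightarrow> p i x \<in> M"
  shows "openin (tuples n) (near n p F \<epsilon>)"
proof -
  have "near n p F \<epsilon> = (\<Pi>\<^sub>E i\<in>{..n}. {f \<in> carrier G. \<forall>x\<in>F. \<delta> (p i x) (f x) < \<epsilon>})"
    by (auto simp: near_def PiE_def Pi_iff)
  then show ?thesis
    using assms openin_Iso_basic by (simp add: openin_PiE)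
qed

lemma near_basic:
  assumes U: "openin (tuples n) U" and p: "p \<in> U"
  obtains F \<epsilon> where "finite F" "F \<subseteq> M" "\<epsilon> > 0" "near n p F \<epsilon> \<subseteq> U"
proof -
  obtain W where W: "\<And>i. i \<le> n \<Longrightarrow> openin (Iso_topology M \<delta>) (W i)" "p \<in> Pi\<^sub>E {..n} W" "Pi\<^sub>E {..n} W \<subseteq> U"
    using bspec[OF U[unfolded openin_product_topology_alt] p] by auto
  define Q where "Q i F \<epsilon> \<longleftrightarrow> finite F \<and> F \<subseteq> M \<and> \<epsilon> > 0 \<and>
      (\<forall>f\<in>carrier G. (\<forall>x\<in>F. \<delta> (p i x) (f x) < \<epsilon>) \<longrightarrow> f \<in> W i)" for i F \<epsilon>
  have "\<exists>F \<epsilon>. Q i F \<epsilon>" if i: "i \<le> n" for i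
  proof -
    have "p i \<in> W i" using W(2) i by auto
    then obtain F \<epsilon> where "finite F" "F \<subseteq> M" "\<epsilon> > 0"
      "\<And>f. f \<in> carrier G \<Longrightarrow> (\<And>x. x \<in> F \<Longrightarrow> \<delta> (p i x) (f x) < \<epsilon>) \<Longrightarrow> f \<in> W i"
      using Iso_nbhd_basic[OF W(1)[OF i]] by metis
    then have "Q i F \<epsilon>" by (simp add: Q_def)
    then show ?thesis by blast
  qed
  then obtain F e where "\<And>i. i \<le> n \<Longrightarrow> Q i (F i) (e i)" by metis
  then have Fe: "\<And>i. i \<le> n \<Longrightarrow> finite (F i)" "\<And>i. i \<le> n \<Longrightarrow> F i \<subseteq> M" "\<And>i. i \<le> n \<Longrightarrow> e i > 0"
    "\<And>i f. i \<le> n \<Longrightarrow> f \<in> carrier G \<Longrightarrow> \<forall>x\<in>F i. \<delta> (p i x) (f x) < e i \<Longrightarrow> f \<in> W i"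
    by (simp_all add: Q_def)
  define \<epsilon> where "\<epsilon> = Min (e ` {..n})"
  have le: "\<epsilon> \<le> e i" if "i \<le> n" for i using that by (simp add: \<epsilon>_def)
  show thesis
  proof (rule that[of "\<Union>i\<le>n. F i" \<epsilon>])
    show "\<epsilon> > 0" unfolding \<epsilon>_def using Fe(3) by (subst Min_gr_iff) auto
    show "near n p (\<Union>i\<le>n. F i) \<epsilon> \<subseteq> U"
    proof
      fix q assume q: "q \<in> near n p (\<Union>i\<le>n. F i) \<epsilon>"
      have "q i \<in> W i" if i: "i \<le> n" for i
      proof (rule Fe(4)[OF i])
        show "q i \<in> carrier G" using q i by (auto simp: near_def)
        show "\<forall>x\<in>F i. \<delta> (p i x) (q i x) < e i"
          using q i le[OF i] by (fastforce simp: near_def)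
      qed
      then have "q \<in> Pi\<^sub>E {..n} W" using q by (auto simp: near_def PiE_def)
      then show "q \<in> U" using W(3) by blast
    qed
  qed (use Fe in auto)
qed

text \<open>Each \<open>x\<close> in \<open>F\<close> is within \<open>\<epsilon>\<close> of its
  truncation, where \<open>w\<close> and \<open>q\<close> agree; the ultrametric inequality passes
  this to \<open>x\<close> without loss.\<close>

lemma near_transfer:
  assumes q: "\<And>i. i \<le> n \<Longrightarrow> q i \<in> carrier G" "\<And>i x. i \<le> n \<Longrightarrow> x \<in> F \<Longrightarrow> \<delta> (p i x) (q i x) < \<epsilon>"
    and w: "w \<in> {..n} \<rightarrow>\<^sub>E carrier G" "\<And>i b. i \<le> n \<Longrightarrow> b \<in> B \<Longrightarrow> w i b = q i b"
    and F: "F \<subseteq> M" "\<And>x. x \<in> F \<Longrightarrow> trunc \<epsilon> x \<in> B" and \<epsilon>: "\<epsilon> > 0"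
    and p: "\<And>i x. i \<le> n \<Longrightarrow> x \<in> F \<Longrightarrow> p i x \<in> M"
  shows "w \<in> near n p F \<epsilon>"
proof -
  have "\<delta> (p i x) (w i x) < \<epsilon>" if i: "i \<le> n" and x: "x \<in> F" for i x
  proof -
    have wi: "w i \<in> carrier G" using w(1) i by auto
    have xM: "x \<in> M" using x F by blast
    note tM = trunc_M[OF xM \<epsilon>] and t = dist_trunc[OF xM \<epsilon>]
    have "\<delta> (q i x) (q i (trunc \<epsilon> x)) < \<epsilon>" using q(1)[OF i] xM tM t by simp
    moreover have "\<delta> (w i (trunc \<epsilon> x)) (w i x) < \<epsilon>" using wi xM tM t by (simp add: commute)
    ultimately have "\<delta> (q i x) (w i x) < \<epsilon>"
      using w(2)[OF i F(2)[OF x]] ultra_less[of "q i x" "q i (trunc \<epsilon> x)" \<epsilon> "w i x"] q(1)[OF i] wi xM tM by simp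
    then show ?thesis
      using ultra_less[OF q(2)[OF i x]] p[OF i x] q(1)[OF i] wi xM by simp
  qed
  then show ?thesis using w(1) by (simp add: near_def)
qed

text \<open>The two situations in which fresh branches are available: unlimited values, or two
  values with distances dense down to \<open>0\<close>.\<close>

definition amalgamable :: bool where
  "amalgamable \<longleftrightarrow> V = UNIV \<or> V = {..<2} \<and> (\<forall>s r. 0 \<le> s \<longrightarrow> s < r \<longrightarrow> (\<exists>t\<in>R. s < t \<and> t < r))"

text \<open>Members of \<open>W1\<close> and \<open>W2\<close> are replaced by tuples preserving one
  box that contains \<open>A\<close>, and these are amalgamated over \<open>A\<close>. The amalgam
  lies in \<open>W2\<close>, and undoing the motion \<open>g\<close> brings it into
  \<open>W1\<close>.\<close>

lemma local_transitivity:
  assumes am: amalgamable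
    and S: "finite S" "S \<subseteq> R" "{..<K} \<subseteq> V" "K > 0" and A: "A \<subseteq> box S K" and \<epsilon>: "\<epsilon> > 0"
    and p: "\<And>i. i \<le> n \<Longrightarrow> p i ` A = A"
    and W1: "openin (tuples n) W1" "W1 \<noteq> {}" "W1 \<subseteq> near n p A \<epsilon>"
    and W2: "openin (tuples n) W2" "W2 \<noteq> {}" "W2 \<subseteq> near n p A \<epsilon>"
  shows "\<exists>g\<in>carrier G. (\<forall>a\<in>A. \<delta> (g a) a < \<epsilon>) \<and> (\<exists>w\<in>W1. diag_conj G n g w \<in> W2)"
proof -
  obtain w1 w2 where w: "w1 \<in> W1" "w2 \<in> W2" using W1(2) W2(2) by blast
  obtain F1 e1 where F1: "finite F1" "F1 \<subseteq> M" "e1 > 0" "near n w1 F1 e1 \<subseteq> W1"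
    using near_basic[OF W1(1) w(1)] by blast
  obtain F2 e2 where F2: "finite F2" "F2 \<subseteq> M" "e2 > 0" "near n w2 F2 e2 \<subseteq> W2"
    using near_basic[OF W2(1) w(2)] by blast
  have A': "finite A" "A \<subseteq> M" using A finite_subset[OF A finite_box[OF S(1,2)]] box_M by auto
  define F where "F = F1 \<union> F2 \<union> A"
  \<comment> \<open>Being at most \<open>\<epsilon>\<close>, this precision keeps the approximating
    tuples \<open>\<epsilon>\<close>-close to \<open>p\<close> on \<open>A\<close>.\<close>
  define e where "e = min (min e1 e2) \<epsilon>"
  have F: "finite F" "F \<subseteq> M" "e > 0" "e \<le> e1" "e \<le> e2" "e \<le> \<epsilon>" "F1 \<subseteq> F" "F2 \<subseteq> F" "A \<subseteq> F"
    using F1 F2 A' \<epsilon> by (auto simp: F_def e_def)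
  have near_mono: "near n w F e \<subseteq> near n w F' e'" if "F' \<subseteq> F" "e \<le> e'" for w F' e'
    using that by (fastforce simp: near_def)
  have W: "near n w1 F e \<subseteq> W1" "near n w2 F e \<subseteq> W2"
    using near_mono F F1(4) F2(4) by (meson order_trans)+
  have carr: "w1 i \<in> carrier G" "w2 i \<in> carrier G" if "i \<le> n" for i
    using w W1(3) W2(3) that by (auto simp: near_def)
  obtain T1 N1 where T1: "finite T1" "T1 \<subseteq> R" "{..<N1} \<subseteq> V" "N1 > 0"
    and a1: "\<And>T' N'. finite T' \<Longrightarrow> T1 \<subseteq> T' \<Longrightarrow> T' \<subseteq> R \<Longrightarrow> N1 \<le> N' \<Longrightarrow> {..<N'} \<subseteq> V \<Longrightarrow>
       (\<forall>x\<in>F. trunc e x \<in> box T' N') \<and>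
       (\<exists>q. \<forall>i\<le>n. q i \<in> carrier G \<and> q i ` box T' N' \<subseteq> box T' N' \<and> (\<forall>x\<in>F. \<delta> (w1 i x) (q i x) < e))"
    by (rule approximation[of n w1 F e]) (use carr F in auto)
  obtain T2 N2 where T2: "finite T2" "T2 \<subseteq> R" "{..<N2} \<subseteq> V" "N2 > 0"
    and a2: "\<And>T' N'. finite T' \<Longrightarrow> T2 \<subseteq> T' \<Longrightarrow> T' \<subseteq> R \<Longrightarrow> N2 \<le> N' \<Longrightarrow> {..<N'} \<subseteq> V \<Longrightarrow>
       (\<forall>x\<in>F. trunc e x \<in> box T' N') \<and>
       (\<exists>q. \<forall>i\<le>n. q i \<in> carrier G \<and> q i ` box T' N' \<subseteq> box T' N' \<and> (\<forall>x\<in>F. \<delta> (w2 i x) (q i x) < e))"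
    by (rule approximation[of n w2 F e]) (use carr F in auto)
  define T where "T = S \<union> T1 \<union> T2"
  define N where "N = max K (max N1 N2)"
  have T: "finite T" "T \<subseteq> R" "{..<N} \<subseteq> V" "N > 0"
    using S T1 T2 by (auto simp: T_def N_def max_def)
  have sub: "T1 \<subseteq> T" "T2 \<subseteq> T" "N1 \<le> N" "N2 \<le> N" by (auto simp: T_def N_def)
  have AB: "A \<subseteq> box T N"
    using A box_mono[of S T K N] T S(4) by (auto simp: T_def N_def)
  have trunc: "trunc e x \<in> box T N" if "x \<in> F" for x
    using a1[OF T(1) sub(1) T(2) sub(3) T(3)] that by blast
  obtain q1 where q1: "\<And>i. i \<le> n \<Longrightarrow> q1 i \<in> carrier G" "\<And>i b. i \<le> n \<Longrightarrow> b \<in> box T N \<Longrightarrow> q1 i b \<in> box T N"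
    "\<And>i x. i \<le> n \<Longrightarrow> x \<in> F \<Longrightarrow> \<delta> (w1 i x) (q1 i x) < e"
    using conjunct2[OF a1[OF T(1) sub(1) T(2) sub(3) T(3)]] by (auto simp: image_subset_iff)
  obtain q2 where q2: "\<And>i. i \<le> n \<Longrightarrow> q2 i \<in> carrier G" "\<And>i b. i \<le> n \<Longrightarrow> b \<in> box T N \<Longrightarrow> q2 i b \<in> box T N"
    "\<And>i x. i \<le> n \<Longrightarrow> x \<in> F \<Longrightarrow> \<delta> (w2 i x) (q2 i x) < e"
    using conjunct2[OF a2[OF T(1) sub(2) T(2) sub(4) T(3)]] by (auto simp: image_subset_iff)
  have pM: "p i a \<in> M" if "i \<le> n" "a \<in> A" for i a using p that A' by blast
  have close: "\<delta> (q i a) (p i a) < \<epsilon>"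
    if "w \<in> near n p A \<epsilon>" "\<And>i x. i \<le> n \<Longrightarrow> x \<in> F \<Longrightarrow> \<delta> (w i x) (q i x) < e"
      "i \<le> n" "a \<in> A" "w i \<in> carrier G" "q i \<in> carrier G" for w q i a
  proof -
    have aM: "a \<in> M" "a \<in> F" using that A' F by auto
    have "\<delta> (q i a) (w i a) < \<epsilon>" using that(2)[OF that(3) aM(2)] F(6) by (simp add: commute)
    moreover have "\<delta> (w i a) (p i a) < \<epsilon>" using that(1,3,4) by (auto simp: near_def commute)
    ultimately show ?thesis using ultra_less that aM pM[OF that(3,4)] Iso_closed by blast
  qed
  have close1: "\<delta> (q1 i a) (p i a) < \<epsilon>" if "i \<le> n" "a \<in> A" for i a
    by (rule close[of w1 q1]) (use w W1(3) q1 carr that in auto)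
  have close2: "\<delta> (q2 i a) (p i a) < \<epsilon>" if "i \<le> n" "a \<in> A" for i a
    by (rule close[of w2 q2]) (use w W2(3) q2 carr that in auto)
  define P where "P g q \<longleftrightarrow> g \<in> carrier G \<and> (\<forall>a\<in>A. \<delta> (g a) a < \<epsilon>) \<and> (\<forall>i\<le>n. q i \<in> carrier G \<and>
    (\<forall>b\<in>box T N. q i b = q2 i b \<and> q i (g b) = g (q1 i b)))" for g q
  have "\<exists>g q. P g q"
  proof (cases "V = UNIV")
    case True
    show ?thesis
      unfolding P_def by (rule amalgamation_all_values[OF T AB \<epsilon> q1(1) q2(1) q1(2) q2(2) p close1 close2 True])
  next
    case False
    then have V: "V = {..<2}" "\<And>s r. 0 \<le> s \<Longrightarrow> s < r \<Longrightarrow> \<exists>t\<in>R. s < t \<and> t < r"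
      using am by (simp_all add: amalgamable_def)
    show ?thesis
      unfolding P_def by (rule amalgamation_two_values[OF T AB \<epsilon> q1(1) q2(1) q1(2) q2(2) p close1 close2 V])
  qed
  then obtain g q where "P g q" by blast
  then have g: "g \<in> carrier G" "\<And>a. a \<in> A \<Longrightarrow> \<delta> (g a) a < \<epsilon>"
    and q: "\<And>i. i \<le> n \<Longrightarrow> q i \<in> carrier G" "\<And>i b. i \<le> n \<Longrightarrow> b \<in> box T N \<Longrightarrow> q i b = q2 i b"
      "\<And>i b. i \<le> n \<Longrightarrow> b \<in> box T N \<Longrightarrow> q i (g b) = g (q1 i b)"
    by (simp_all add: P_def)
  \<comment> \<open>On the box \<open>v\<close> acts like \<open>q1\<close>, which puts it into
    \<open>W1\<close>; its conjugate by \<open>g\<close> is \<open>q\<close>, which acts like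
    \<open>q2\<close>.\<close>
  define v where "v = (\<lambda>i\<in>{..n}. inv\<^bsub>G\<^esub> g \<otimes>\<^bsub>G\<^esub> q i \<otimes>\<^bsub>G\<^esub> g)"
  have v: "v \<in> {..n} \<rightarrow>\<^sub>E carrier G" using g q by (auto simp: v_def)
  have "v i b = q1 i b" if "i \<le> n" "b \<in> box T N" for i b
    using that g(1) q q1 box_M by (simp add: v_def)
  then have "v \<in> near n w1 F e"
    using carr F by (intro near_transfer[of n q1 F w1 e v "box T N"] q1 v trunc) auto
  then have "v \<in> W1" using W(1) by blast
  moreover have "diag_conj G n g v = restrict q {..n}"
  proof (rule extensionalityI[of _ "{..n}"])
    show "diag_conj G n g v \<in> extensional {..n}" using v by (simp add: diag_conj_def)
    fix i assume "i \<in> {..n}"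
    then have i: "i \<le> n" by simp
    have "diag_conj G n g v i = g \<otimes>\<^bsub>G\<^esub> (inv\<^bsub>G\<^esub> g \<otimes>\<^bsub>G\<^esub> q i \<otimes>\<^bsub>G\<^esub> g) \<otimes>\<^bsub>G\<^esub> inv\<^bsub>G\<^esub> g"
      using diag_conj_apply[OF v i] i by (simp add: v_def)
    also have "\<dots> = q i"
      by (rule Iso_eqI) (use g q(1)[OF i] in auto)
    finally show "diag_conj G n g v i = restrict q {..n} i" using i by simp
  qed simp
  moreover have "restrict q {..n} \<in> near n w2 F e"
    using carr F q by (intro near_transfer[of n q2 F w2 e _ "box T N"] q2 trunc) auto
  then have "restrict q {..n} \<in> W2" using W(2) by blast
  ultimately have "\<exists>w\<in>W1. diag_conj G n g w \<in> W2" by metis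
  then show ?thesis using g by blast
qed

text \<open>Both transitivity conditions of the orbit criterion are instances of
  \<open>local_transitivity\<close>. For the local one, \<open>F\<close> collects the points
  defining the given neighbourhoods of \<open>p\<close> and of the identity.\<close>

theorem ample_generics_Iso:
  assumes am: amalgamable
  shows "ample_generics G (Iso_topology M \<delta>)"
  unfolding ample_generics_def
proof (intro conjI allI)
  show "Polish_group G (Iso_topology M \<delta>)" by (rule Polish)
  fix n :: nat
  let ?E = "{..n} \<rightarrow>\<^sub>E carrier G"
  have sub: "U \<subseteq> ?E" if "openin (tuples n) U" for U
    using openin_subset[OF that] by simp
  show "\<exists>p\<in>?E. comeager_in (tuples n) (orbit G (diag_conj G n) p)"
  proof (rule continuous_action.comeager_orbit_criterion[OF continuous_action_diag_conj[OF Polish]])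
    have "(\<lambda>i\<in>{..n}. \<one>\<^bsub>G\<^esub>) \<in> ?E" by simp
    then show "?E \<noteq> {}" by blast
  next
    fix W1 W2 assume W: "openin (tuples n) W1" "openin (tuples n) W2" "W1 \<noteq> {}" "W2 \<noteq> {}"
    \<comment> \<open>Global transitivity is the local statement over the empty set; the tuple, the
      precision \<open>1\<close> and the box over no distances are placeholders.\<close>
    have "\<exists>g\<in>carrier G. (\<forall>a\<in>{}. \<delta> (g a) a < 1) \<and> (\<exists>w\<in>W1. diag_conj G n g w \<in> W2)"
      by (rule local_transitivity[OF am, of "{}" 1 "{}" 1 n "\<lambda>_ x. x"])
        (use W sub zero_V in \<open>auto simp: near_def\<close>)
    then show "\<exists>g\<in>carrier G. \<exists>w\<in>W1. diag_conj G n g w \<in> W2" by blast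
  next
    fix V' U assume V': "openin (Iso_topology M \<delta>) V'" "\<one>\<^bsub>G\<^esub> \<in> V'" and U: "openin (tuples n) U" "U \<noteq> {}"
    obtain p where p: "p \<in> U" using U by blast
    have pG: "p i \<in> carrier G" if "i \<le> n" for i using sub[OF U(1)] p that by auto
    obtain F1 e1 where F1: "finite F1" "F1 \<subseteq> M" "e1 > 0" "near n p F1 e1 \<subseteq> U"
      using near_basic[OF U(1) p] by blast
    obtain F2 e2 where F2: "finite F2" "F2 \<subseteq> M" "e2 > 0"
      "\<And>f. f \<in> carrier G \<Longrightarrow> (\<And>x. x \<in> F2 \<Longrightarrow> \<delta> (\<one>\<^bsub>G\<^esub> x) (f x) < e2) \<Longrightarrow> f \<in> V'"
      using Iso_nbhd_basic[OF V'] by metis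
    define F where "F = F1 \<union> F2"
    define e where "e = min e1 e2"
    have F: "finite F" "F \<subseteq> M" "e > 0" using F1 F2 by (auto simp: F_def e_def)
    obtain T N where T: "finite T" "T \<subseteq> R" "{..<N} \<subseteq> V" "N > 0"
      and a: "\<And>T' N'. finite T' \<Longrightarrow> T \<subseteq> T' \<Longrightarrow> T' \<subseteq> R \<Longrightarrow> N \<le> N' \<Longrightarrow> {..<N'} \<subseteq> V \<Longrightarrow>
       (\<forall>x\<in>F. trunc e x \<in> box T' N') \<and>
       (\<exists>q. \<forall>i\<le>n. q i \<in> carrier G \<and> q i ` box T' N' \<subseteq> box T' N' \<and> (\<forall>x\<in>F. \<delta> (p i x) (q i x) < e))"
      by (rule approximation[of n p F e]) (use pG F in auto)
    \<comment> \<open>The whole box is taken, not only the truncations of \<open>F\<close>: an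
      injective self-map of a finite set is onto, so each \<open>q i\<close> permutes it.\<close>
    let ?A = "box T N"
    have trunc: "trunc e x \<in> ?A" if "x \<in> F" for x
      using a[OF T(1) _ T(2) _ T(3)] that by blast
    obtain q where q': "\<forall>i\<le>n. q i \<in> carrier G \<and> q i ` ?A \<subseteq> ?A \<and> (\<forall>x\<in>F. \<delta> (p i x) (q i x) < e)"
      using conjunct2[OF a[OF T(1) subset_refl T(2) le_refl T(3)]] by (rule exE)
    then have q: "\<And>i. i \<le> n \<Longrightarrow> q i \<in> carrier G" "\<And>i. i \<le> n \<Longrightarrow> q i ` ?A \<subseteq> ?A"
      "\<And>i x. i \<le> n \<Longrightarrow> x \<in> F \<Longrightarrow> \<delta> (p i x) (q i x) < e"
      by simp_all
    have AM: "?A \<subseteq> M" using box_M by blast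
    have qA: "q i ` ?A = ?A" if i: "i \<le> n" for i
    proof (rule endo_inj_surj[OF finite_box[OF T(1,2)] q(2)[OF i]])
      have "inj_on (q i) M" using q(1)[OF i] by (simp add: Iso_carrier bij_betw_def)
      then show "inj_on (q i) ?A" using AM by (rule inj_on_subset)
    qed
    let ?U = "near n q ?A e"
    show "\<exists>U'. openin (tuples n) U' \<and> U' \<noteq> {} \<and> U' \<subseteq> U \<and>
      (\<forall>W1 W2. openin (tuples n) W1 \<and> openin (tuples n) W2 \<and> W1 \<noteq> {} \<and> W2 \<noteq> {} \<and> W1 \<subseteq> U' \<and> W2 \<subseteq> U' \<longrightarrow>
        (\<exists>v\<in>V'. \<exists>w\<in>W1. diag_conj G n v w \<in> W2))"
    proof (intro exI[of _ ?U] conjI allI impI)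
      show "openin (tuples n) ?U"
        using q AM finite_box[OF T(1,2)] by (intro openin_near) auto
      have "restrict q {..n} \<in> ?U" using q(1) AM F(3) by (auto simp: near_def subset_iff)
      then show "?U \<noteq> {}" by blast
      have "?U \<subseteq> near n p F1 e1"
      proof
        fix w assume w: "w \<in> ?U"
        have wG: "w i \<in> carrier G" if "i \<le> n" for i using w that by (auto simp: near_def)
        have "\<delta> (p i x) (w i x) < e1" if i: "i \<le> n" and x: "x \<in> F1" for i x
        proof -
          have xF: "x \<in> F" and xM: "x \<in> M" using x F1(2) by (auto simp: F_def)
          note tM = trunc_M[OF xM F(3)] and t = dist_trunc[OF xM F(3)]
          note P = pG[OF i] q(1)[OF i] wG[OF i]
          have 1: "\<delta> (q i x) (q i (trunc e x)) < e" using P xM tM t by simp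
          have 2: "\<delta> (q i (trunc e x)) (w i (trunc e x)) < e"
            using w i trunc[OF xF] by (simp add: near_def)
          have 3: "\<delta> (w i (trunc e x)) (w i x) < e" using P xM tM t by (simp add: commute)
          have "\<delta> (p i x) (w i x) < e"
            using ultra_less[OF ultra_less[OF ultra_less[OF q(3)[OF i xF] 1] 2] 3] P xM tM by simp
          then show ?thesis by (simp add: e_def)
        qed
        then show "w \<in> near n p F1 e1" using w by (simp add: near_def)
      qed
      then show "?U \<subseteq> U" using F1(4) by blast
      fix W1 W2
      assume W: "openin (tuples n) W1 \<and> openin (tuples n) W2 \<and> W1 \<noteq> {} \<and> W2 \<noteq> {} \<and> W1 \<subseteq> ?U \<and> W2 \<subseteq> ?U"
      have "\<exists>g\<in>carrier G. (\<forall>a\<in>?A. \<delta> (g a) a < e) \<and> (\<exists>w\<in>W1. diag_conj G n g w \<in> W2)"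
        by (rule local_transitivity[OF am T subset_refl F(3), of n q]) (use W qA in blast)+
      then obtain g where g: "g \<in> carrier G" "\<And>a. a \<in> ?A \<Longrightarrow> \<delta> (g a) a < e"
        "\<exists>w\<in>W1. diag_conj G n g w \<in> W2"
        by blast
      \<comment> \<open>\<open>g\<close> is within \<open>e\<close> of the identity at the
        truncations of \<open>F2\<close>, hence at the points of \<open>F2\<close>
        themselves.\<close>
      have "g \<in> V'"
      proof (rule F2(4)[OF g(1)])
        fix x assume x: "x \<in> F2"
        then have xF: "x \<in> F" and xM: "x \<in> M" using F2(2) by (auto simp: F_def)
        note tM = trunc_M[OF xM F(3)] and t = dist_trunc[OF xM F(3)]
        have 1: "\<delta> (trunc e x) (g (trunc e x)) < e" using g(2)[OF trunc[OF xF]] by (simp add: commute)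
        have 2: "\<delta> (g (trunc e x)) (g x) < e" using g(1) xM tM t by (simp add: commute)
        have "\<delta> x (g x) < e" using ultra_less[OF ultra_less[OF t 1] 2] g(1) xM tM by simp
        then show "\<delta> (\<one>\<^bsub>G\<^esub> x) (g x) < e2" using xM by (simp add: e_def)
      qed
      then show "\<exists>v\<in>V'. \<exists>w\<in>W1. diag_conj G n v w \<in> W2" using g(3) by blast
    qed
  qed
qed

end

section \<open>The full space and the binary space over the positive rationals\<close>

lemma ample_generics_urysohn:
  assumes "countable R" "R \<subseteq> {0<..}"
  shows "ample_generics (Iso (urysohn R) (urysohn_dist R)) (Iso_topology (urysohn R) (urysohn_dist R))"
proof -
  interpret urysohn_values R UNIV using assms by unfold_locales auto
  have "M = urysohn R" by (simp add: M_def)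
  moreover have amalgamable by (simp add: amalgamable_def)
  ultimately show ?thesis using ample_generics_Iso by simp
qed

lemma ample_generics_2_urysohn_rat:
  defines "Q \<equiv> {q :: real. q \<in> \<rat> \<and> 0 < q}"
  shows "countable Q" "Q \<subseteq> {0<..}"
    "ample_generics (Iso (n_urysohn 2 Q) (urysohn_dist Q)) (Iso_topology (n_urysohn 2 Q) (urysohn_dist Q))"
proof -
  show Q: "countable Q" "Q \<subseteq> {0<..}"
    unfolding Q_def by (auto intro: countable_subset[OF _ countable_rat])
  interpret urysohn_values Q "{..<2}" using Q by unfold_locales auto
  have "\<exists>t\<in>Q. s < t \<and> t < r" if "0 \<le> s" "s < r" for s r
    using Rats_dense_in_real[OF that(2)] that(1) unfolding Q_def by force
  then have amalgamable by (simp add: amalgamable_def)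
  moreover have "M = n_urysohn 2 Q" by (auto simp: M_def n_urysohn_def)
  ultimately show "ample_generics (Iso (n_urysohn 2 Q) (urysohn_dist Q)) (Iso_topology (n_urysohn 2 Q) (urysohn_dist Q))"
    using ample_generics_Iso by simp
qed

theorem corollary6p1:
  shows "(\<forall>R. countable R \<and> R \<subseteq> {0<..} \<longrightarrow>
            ample_generics (Iso (urysohn R) (urysohn_dist R))
                           (Iso_topology (urysohn R) (urysohn_dist R))) \<and>
         (\<exists>R. countable R \<and> R \<subseteq> {0<..} \<and>
            ample_generics (Iso (n_urysohn 2 R) (urysohn_dist R))
                           (Iso_topology (n_urysohn 2 R) (urysohn_dist R))) \<and>
         (let Q = {q :: real. q \<in> \<rat> \<and> 0 < q} in
            ample_generics (Iso (n_urysohn 2 Q) (urysohn_dist Q))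
                           (Iso_topology (n_urysohn 2 Q) (urysohn_dist Q)))"
  unfolding Let_def using ample_generics_urysohn ample_generics_2_urysohn_rat by blast

end
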